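(* Let $\Lambda$ be a finite-dimensional algebra over an algebraically closed field and let $d\geq2$. The subposet of positive torsion pairs in $\mathcal{D}^{[-d+2,0]}(\operatorname{mod}\Lambda)$ is closed under the meets and joins of the lattice of all torsion pairs in $\mathcal{D}^{[-d+2,0]}(\operatorname{mod}\Lambda)$; hence it is a lattice (a sublattice).
   Context: $\mathcal{C}=\mathcal{D}^{[-d+2,0]}(\operatorname{mod}\Lambda)$ is the full subcategory of $\mathcal{D}^b(\operatorname{mod}\Lambda)$ (finitely generated modules) of objects with cohomology concentrated in degrees $-d+2,\dots,0$; $\Sigma$ is the shift of $\mathcal{D}^b(\operatorname{mod}\Lambda)$. A pair $(\mathcal{T},\mathcal{F})$ of full subcategories of $\mathcal{C}$ is a torsion pair if ($\operatorname{Hom}(t,\mathcal{F})=0\iff t\in\mathcal{T}$) and ($\operatorname{Hom}(\mathcal{T},f)=0\iff f\in\mathcal{F}$). It is positive if $\operatorname{Hom}(\mathcal{T},\Sigma^k\mathcal{F})=0$ for all $k\leq-1$. Torsion pairs are ordered by $(\mathcal{T}_1,\mathcal{F}_1)\preceq(\mathcal{T}_2,\mathcal{F}_2)\iff\mathcal{T}_1\subseteq\mathcal{T}_2$; the poset of all torsion pairs in $\mathcal{C}$ is a lattice (any two elements have a meet and a join). *)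

theory Defs
  imports
    "HOL-Algebra.Algebraic_Closure"
    "HOL-Algebra.Elementary_Groups"
    "HOL-Algebra.Module"
    "HOL-Algebra.Lattice"
begin

section \<open>Finite-dimensional algebras and their finitely generated modules\<close>

text \<open>The locales \<^locale>\<open>algebra\<close> and \<^locale>\<open>module\<close> of the library require commutative rings,
  hence the following noncommutative versions.\<close>

locale associative_algebra = K?: field K + A?: ring A + module K A
  for K :: "('k, 'r) ring_scheme" (structure) and A :: "('k, 'a, 's) module_scheme" (structure) +
  assumes smult_mult_left:
      "\<lbrakk>c \<in> carrier K; x \<in> carrier A; y \<in> carrier A\<rbrakk> \<Longrightarrow>
        (c \<odot>\<^bsub>A\<^esub> x) \<otimes>\<^bsub>A\<^esub> y = c \<odot>\<^bsub>A\<^esub> (x \<otimes>\<^bsub>A\<^esub> y)"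
    and smult_mult_right:
      "\<lbrakk>c \<in> carrier K; x \<in> carrier A; y \<in> carrier A\<rbrakk> \<Longrightarrow>
        x \<otimes>\<^bsub>A\<^esub> (c \<odot>\<^bsub>A\<^esub> y) = c \<odot>\<^bsub>A\<^esub> (x \<otimes>\<^bsub>A\<^esub> y)"

locale finite_dimensional_algebra = associative_algebra +
  assumes finite_spanning_set:
    "\<exists>B. finite B \<and> B \<subseteq> carrier A \<and>
      (\<forall>x\<in>carrier A. \<exists>c \<in> B \<rightarrow> carrier K. x = (\<Oplus>\<^bsub>A\<^esub>b\<in>B. c b \<odot>\<^bsub>A\<^esub> b))"

text \<open>Modules are left modules.  They are represented by the library's module record, whose fields
  \<^const>\<open>monoid.mult\<close> and \<^const>\<open>one\<close> are not used.\<close>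

locale left_module = R?: ring R + M?: abelian_group M
  for R :: "('a, 'r) ring_scheme" (structure) and M :: "('a, 'm, 's) module_scheme" (structure) +
  assumes smult_closed [simp, intro]:
      "\<lbrakk>a \<in> carrier R; x \<in> carrier M\<rbrakk> \<Longrightarrow> a \<odot>\<^bsub>M\<^esub> x \<in> carrier M"
    and smult_l_distr:
      "\<lbrakk>a \<in> carrier R; b \<in> carrier R; x \<in> carrier M\<rbrakk> \<Longrightarrow>
        (a \<oplus>\<^bsub>R\<^esub> b) \<odot>\<^bsub>M\<^esub> x = a \<odot>\<^bsub>M\<^esub> x \<oplus>\<^bsub>M\<^esub> b \<odot>\<^bsub>M\<^esub> x"
    and smult_r_distr:
      "\<lbrakk>a \<in> carrier R; x \<in> carrier M; y \<in> carrier M\<rbrakk> \<Longrightarrow>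
        a \<odot>\<^bsub>M\<^esub> (x \<oplus>\<^bsub>M\<^esub> y) = a \<odot>\<^bsub>M\<^esub> x \<oplus>\<^bsub>M\<^esub> a \<odot>\<^bsub>M\<^esub> y"
    and smult_assoc:
      "\<lbrakk>a \<in> carrier R; b \<in> carrier R; x \<in> carrier M\<rbrakk> \<Longrightarrow>
        (a \<otimes>\<^bsub>R\<^esub> b) \<odot>\<^bsub>M\<^esub> x = a \<odot>\<^bsub>M\<^esub> (b \<odot>\<^bsub>M\<^esub> x)"
    and smult_one [simp]:
      "x \<in> carrier M \<Longrightarrow> \<one>\<^bsub>R\<^esub> \<odot>\<^bsub>M\<^esub> x = x"

locale fg_module = left_module +
  assumes finite_generating_set:
    "\<exists>S. finite S \<and> S \<subseteq> carrier M \<and>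
      (\<forall>x\<in>carrier M. \<exists>c \<in> S \<rightarrow> carrier R. x = (\<Oplus>\<^bsub>M\<^esub>s\<in>S. c s \<odot>\<^bsub>M\<^esub> s))"

definition mod_hom ::
  "('a, 'r) ring_scheme \<Rightarrow> ('a, 'm) module \<Rightarrow> ('a, 'n) module \<Rightarrow> ('m \<Rightarrow> 'n) set" where
  "mod_hom R M N = {f \<in> carrier M \<rightarrow> carrier N.
     (\<forall>x\<in>carrier M. \<forall>y\<in>carrier M. f (x \<oplus>\<^bsub>M\<^esub> y) = f x \<oplus>\<^bsub>N\<^esub> f y) \<and>
     (\<forall>a\<in>carrier R. \<forall>x\<in>carrier M. f (a \<odot>\<^bsub>M\<^esub> x) = a \<odot>\<^bsub>N\<^esub> f x)}"

lemma fg_module_transport: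
  fixes R :: "('a, 'r) ring_scheme" and M :: "('a, 'm) module" and e :: "'m \<Rightarrow> 'n"
  assumes "fg_module R M" and inj: "inj_on e (carrier M)"
  shows "\<exists>N :: ('a, 'n) module.
    fg_module R N \<and> e \<in> mod_hom R M N \<and> bij_betw e (carrier M) (carrier N)"
proof -
  interpret M: fg_module R M by fact
  define r where "r = inv_into (carrier M) e"
  define N :: "('a, 'n) module" where "N = \<lparr>carrier = e ` carrier M, monoid.mult = undefined, one = undefined,
    zero = e \<zero>\<^bsub>M\<^esub>, add = (\<lambda>u v. e (r u \<oplus>\<^bsub>M\<^esub> r v)), smult = (\<lambda>a u. e (a \<odot>\<^bsub>M\<^esub> r u))\<rparr>"
  have r[simp]: "r (e x) = x" if "x \<in> carrier M" for x
    using inj that by (simp add: r_def)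
  have N_simps: "carrier N = e ` carrier M" "\<zero>\<^bsub>N\<^esub> = e \<zero>\<^bsub>M\<^esub>"
    "x \<in> carrier M \<Longrightarrow> y \<in> carrier M \<Longrightarrow> e x \<oplus>\<^bsub>N\<^esub> e y = e (x \<oplus>\<^bsub>M\<^esub> y)"
    "x \<in> carrier M \<Longrightarrow> a \<odot>\<^bsub>N\<^esub> e x = e (a \<odot>\<^bsub>M\<^esub> x)" for x y a
    by (simp_all add: N_def)
  have ab: "abelian_group N"
  proof (rule abelian_groupI)
    fix x assume "x \<in> carrier N"
    then obtain u where "u \<in> carrier M" "x = e u" by (auto simp: N_simps)
    then show "\<exists>y\<in>carrier N. y \<oplus>\<^bsub>N\<^esub> x = \<zero>\<^bsub>N\<^esub>"
      by (intro bexI[of _ "e (\<ominus>\<^bsub>M\<^esub> u)"]) (auto simp: N_simps M.M.l_neg)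
  qed (auto simp: N_simps M.M.a_ac)
  interpret N: abelian_group N by (rule ab)
  have lm: "left_module R N"
    by (intro left_module.intro ab M.R.ring_axioms left_module_axioms.intro)
      (auto simp: N_simps M.smult_l_distr M.smult_r_distr M.smult_assoc)
  have sum: "e (\<Oplus>\<^bsub>M\<^esub>s\<in>S. c s \<odot>\<^bsub>M\<^esub> s) = (\<Oplus>\<^bsub>N\<^esub>u\<in>e ` S. c (r u) \<odot>\<^bsub>N\<^esub> u)"
    if "finite S" "S \<subseteq> carrier M" "c \<in> S \<rightarrow> carrier R" for S c
    using that
  proof (induction S)
    case empty
    then show ?case by (simp add: N_simps)
  next
    case (insert s S)
    have cl: "(\<Oplus>\<^bsub>M\<^esub>s\<in>S. c s \<odot>\<^bsub>M\<^esub> s) \<in> carrier M"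
      using insert.prems by (intro M.M.finsum_closed) auto
    have ni: "e s \<notin> e ` S"
      using insert.hyps insert.prems inj by (auto simp: inj_on_def)
    have "(\<Oplus>\<^bsub>M\<^esub>s\<in>insert s S. c s \<odot>\<^bsub>M\<^esub> s) = c s \<odot>\<^bsub>M\<^esub> s \<oplus>\<^bsub>M\<^esub> (\<Oplus>\<^bsub>M\<^esub>s\<in>S. c s \<odot>\<^bsub>M\<^esub> s)"
      using insert.hyps insert.prems by (intro M.M.finsum_insert) auto
    moreover have "(\<Oplus>\<^bsub>N\<^esub>u\<in>insert (e s) (e ` S). c (r u) \<odot>\<^bsub>N\<^esub> u) =
        c (r (e s)) \<odot>\<^bsub>N\<^esub> e s \<oplus>\<^bsub>N\<^esub> (\<Oplus>\<^bsub>N\<^esub>u\<in>e ` S. c (r u) \<odot>\<^bsub>N\<^esub> u)"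
      using insert.hyps insert.prems ni
      by (intro N.finsum_insert) (auto simp: N_simps Pi_iff subset_iff)
    moreover have "e (\<Oplus>\<^bsub>M\<^esub>s\<in>S. c s \<odot>\<^bsub>M\<^esub> s) = (\<Oplus>\<^bsub>N\<^esub>u\<in>e ` S. c (r u) \<odot>\<^bsub>N\<^esub> u)"
      using insert by auto
    ultimately show ?case
      using insert.prems cl by (simp add: N_simps flip: N_simps(3))
  qed
  obtain S where S: "finite S" "S \<subseteq> carrier M"
    "\<And>x. x \<in> carrier M \<Longrightarrow> \<exists>c \<in> S \<rightarrow> carrier R. x = (\<Oplus>\<^bsub>M\<^esub>s\<in>S. c s \<odot>\<^bsub>M\<^esub> s)"
    using M.finite_generating_set by blast
  have "\<exists>c \<in> e ` S \<rightarrow> carrier R. y = (\<Oplus>\<^bsub>N\<^esub>u\<in>e ` S. c u \<odot>\<^bsub>N\<^esub> u)" if "y \<in> carrier N" for y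
  proof -
    obtain x where x: "x \<in> carrier M" "y = e x" using \<open>y \<in> carrier N\<close> by (auto simp: N_simps)
    obtain c where c: "c \<in> S \<rightarrow> carrier R" "x = (\<Oplus>\<^bsub>M\<^esub>s\<in>S. c s \<odot>\<^bsub>M\<^esub> s)" using S(3)[OF x(1)] by blast
    have "y = (\<Oplus>\<^bsub>N\<^esub>u\<in>e ` S. (c \<circ> r) u \<odot>\<^bsub>N\<^esub> u)"
      using sum[OF S(1,2) c(1)] c(2) x(2) by simp
    moreover have "c \<circ> r \<in> e ` S \<rightarrow> carrier R" using c(1) S(2) by (auto simp: subset_iff)
    ultimately show ?thesis by blast
  qed
  then have "fg_module R N"
    using S(1,2) by (intro fg_module.intro lm fg_module_axioms.intro exI[of _ "e ` S"])
      (auto simp: N_simps)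
  moreover have "e \<in> mod_hom R M N" by (auto simp: mod_hom_def N_simps)
  moreover have "bij_betw e (carrier M) (carrier N)" using inj by (simp add: bij_betw_def N_simps)
  ultimately show ?thesis by blast
qed

text \<open>The bounded derived category below is built from modules whose carrier is a set of functions
  \<open>nat \<Rightarrow> 'a\<close>, where \<open>'a\<close> is the element type of the ring.  This is no restriction:
  every finitely generated module, over whatever type, is isomorphic to one of these.\<close>

lemma fg_module_universe:
  fixes R :: "('a, 'r) ring_scheme" and M :: "('a, 'm) module"
  assumes "fg_module R M"
  shows "\<exists>(N :: ('a, nat \<Rightarrow> 'a) module) h.
    fg_module R N \<and> h \<in> mod_hom R M N \<and> bij_betw h (carrier M) (carrier N)"
proof -
  interpret M: fg_module R M by fact
  obtain S where S: "finite S" "S \<subseteq> carrier M"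
    "\<forall>x\<in>carrier M. \<exists>c \<in> S \<rightarrow> carrier R. x = (\<Oplus>\<^bsub>M\<^esub>s\<in>S. c s \<odot>\<^bsub>M\<^esub> s)"
    using M.finite_generating_set by blast
  define c where "c x = (SOME c. c \<in> S \<rightarrow> carrier R \<and> x = (\<Oplus>\<^bsub>M\<^esub>s\<in>S. c s \<odot>\<^bsub>M\<^esub> s))" for x
  have c': "c x \<in> S \<rightarrow> carrier R \<and> x = (\<Oplus>\<^bsub>M\<^esub>s\<in>S. c x s \<odot>\<^bsub>M\<^esub> s)" if "x \<in> carrier M" for x
    unfolding c_def by (rule someI_ex[OF bspec[OF S(3) that, unfolded Bex_def]])
  have c: "c x \<in> S \<rightarrow> carrier R" "x = (\<Oplus>\<^bsub>M\<^esub>s\<in>S. c x s \<odot>\<^bsub>M\<^esub> s)" if "x \<in> carrier M" for x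
    by (rule conjunct1[OF c'[OF that]], rule conjunct2[OF c'[OF that]])
  obtain g :: "nat \<Rightarrow> 'm" and n where g: "S = g ` {i. i < n}"
    using finite_imp_nat_seg_image_inj_on[OF S(1)] by blast
  have "inj_on (\<lambda>x i. c x (g i)) (carrier M)"
  proof (rule inj_onI)
    fix x y assume xy: "x \<in> carrier M" "y \<in> carrier M" "(\<lambda>i. c x (g i)) = (\<lambda>i. c y (g i))"
    have "c x s = c y s" if s: "s \<in> S" for s
    proof -
      obtain i where "s = g i" using s g by blast
      then show ?thesis using fun_cong[OF xy(3), of i] by simp
    qed
    then have "(\<Oplus>\<^bsub>M\<^esub>s\<in>S. c x s \<odot>\<^bsub>M\<^esub> s) = (\<Oplus>\<^bsub>M\<^esub>s\<in>S. c y s \<odot>\<^bsub>M\<^esub> s)"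
      using c(1)[OF xy(2)] S(2) by (intro M.M.finsum_cong') (auto simp: Pi_iff subset_iff)
    then show "x = y" using c(2)[OF xy(1), symmetric] c(2)[OF xy(2), symmetric] by simp
  qed
  from fg_module_transport[OF assms this] show ?thesis by blast
qed

section \<open>Cochain complexes\<close>

record ('a, 'm) cochain =
  obj :: "int \<Rightarrow> ('a, 'm) module"
  diff :: "int \<Rightarrow> 'm \<Rightarrow> 'm"

definition bounded_complex :: "('a, 'r) ring_scheme \<Rightarrow> ('a, 'm) cochain \<Rightarrow> bool" where
  "bounded_complex R C \<longleftrightarrow>
     (\<forall>i. fg_module R (obj C i)) \<and>
     (\<forall>i. diff C i \<in> mod_hom R (obj C i) (obj C (i + 1))) \<and>
     (\<forall>i. \<forall>x\<in>carrier (obj C i). diff C (i + 1) (diff C i x) = \<zero>\<^bsub>obj C (i + 2)\<^esub>) \<and>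
     (\<exists>n. \<forall>i. \<bar>i\<bar> > n \<longrightarrow> carrier (obj C i) = {\<zero>\<^bsub>obj C i\<^esub>})"

definition shift :: "int \<Rightarrow> ('a, 'm) cochain \<Rightarrow> ('a, 'm) cochain" where
  "shift k C = \<lparr>obj = (\<lambda>i. obj C (i + k)),
     diff = (\<lambda>i x. if even k then diff C (i + k) x
                   else \<ominus>\<^bsub>obj C (i + k + 1)\<^esub> diff C (i + k) x)\<rparr>"

text \<open>Chain maps and homotopies are determined only on the carriers; what they do outside is
  arbitrary.\<close>

definition chain_map ::
  "('a, 'r) ring_scheme \<Rightarrow> ('a, 'm) cochain \<Rightarrow> ('a, 'm) cochain \<Rightarrow> (int \<Rightarrow> 'm \<Rightarrow> 'm) \<Rightarrow> bool" where
  "chain_map R C D f \<longleftrightarrow>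
     (\<forall>i. f i \<in> mod_hom R (obj C i) (obj D i)) \<and>
     (\<forall>i. \<forall>x\<in>carrier (obj C i). f (i + 1) (diff C i x) = diff D i (f i x))"

definition homotopic ::
  "('a, 'r) ring_scheme \<Rightarrow> ('a, 'm) cochain \<Rightarrow> ('a, 'm) cochain \<Rightarrow>
    (int \<Rightarrow> 'm \<Rightarrow> 'm) \<Rightarrow> (int \<Rightarrow> 'm \<Rightarrow> 'm) \<Rightarrow> bool" where
  "homotopic R C D f g \<longleftrightarrow>
     (\<exists>h. (\<forall>i. h i \<in> mod_hom R (obj C i) (obj D (i - 1))) \<and>
        (\<forall>i. \<forall>x\<in>carrier (obj C i).
           f i x \<ominus>\<^bsub>obj D i\<^esub> g i x = diff D (i - 1) (h i x) \<oplus>\<^bsub>obj D i\<^esub> h (i + 1) (diff C i x)))"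

definition cocycles :: "('a, 'm) cochain \<Rightarrow> int \<Rightarrow> 'm set" where
  "cocycles C i = {x \<in> carrier (obj C i). diff C i x = \<zero>\<^bsub>obj C (i + 1)\<^esub>}"

definition coboundaries :: "('a, 'm) cochain \<Rightarrow> int \<Rightarrow> 'm set" where
  "coboundaries C i = diff C (i - 1) ` carrier (obj C (i - 1))"

text \<open>Only the additive group of the cohomology module is recorded: this suffices to say that
  cohomology vanishes or that an induced map is an isomorphism.\<close>

definition cohomology :: "('a, 'm) cochain \<Rightarrow> int \<Rightarrow> 'm set monoid" where
  "cohomology C i = (add_monoid (obj C i))\<lparr>carrier := cocycles C i\<rparr> Mod coboundaries C i"

definition cohomology_map ::
  "('a, 'm) cochain \<Rightarrow> (int \<Rightarrow> 'm \<Rightarrow> 'm) \<Rightarrow> int \<Rightarrow> 'm set \<Rightarrow> 'm set" where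
  "cohomology_map D f i c = coboundaries D i <+>\<^bsub>obj D i\<^esub> f i ` c"

definition quasi_iso ::
  "('a, 'r) ring_scheme \<Rightarrow> ('a, 'm) cochain \<Rightarrow> ('a, 'm) cochain \<Rightarrow> (int \<Rightarrow> 'm \<Rightarrow> 'm) \<Rightarrow> bool" where
  "quasi_iso R C D f \<longleftrightarrow> chain_map R C D f \<and>
     (\<forall>i. cohomology_map D f i \<in> iso (cohomology C i) (cohomology D i))"

section \<open>The bounded derived category\<close>

definition Db_objects :: "('a, 'r) ring_scheme \<Rightarrow> ('a, nat \<Rightarrow> 'a) cochain set" where
  "Db_objects R = {C. bounded_complex R C}"

text \<open>Morphisms \<open>C \<rightarrow> D\<close> are those of the localisation of the bounded homotopy category at the
  quasi-isomorphisms: a roof \<open>C \<leftarrow> E \<rightarrow> D\<close>, with first leg \<open>s\<close> a quasi-isomorphism, is a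
  triple \<open>(E, s, f)\<close>, and roofs are identified when they have a common refinement up to homotopy.\<close>

type_synonym 'a roof =
  "('a, nat \<Rightarrow> 'a) cochain \<times>
   (int \<Rightarrow> (nat \<Rightarrow> 'a) \<Rightarrow> nat \<Rightarrow> 'a) \<times> (int \<Rightarrow> (nat \<Rightarrow> 'a) \<Rightarrow> nat \<Rightarrow> 'a)"

definition roofs ::
  "('a, 'r) ring_scheme \<Rightarrow> ('a, nat \<Rightarrow> 'a) cochain \<Rightarrow> ('a, nat \<Rightarrow> 'a) cochain \<Rightarrow> 'a roof set" where
  "roofs R C D = {(E, s, f). E \<in> Db_objects R \<and> quasi_iso R E C s \<and> chain_map R E D f}"

definition roof_equiv ::
  "('a, 'r) ring_scheme \<Rightarrow> ('a, nat \<Rightarrow> 'a) cochain \<Rightarrow> ('a, nat \<Rightarrow> 'a) cochain \<Rightarrow>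
    ('a roof \<times> 'a roof) set" where
  "roof_equiv R C D = {((E, s, f), (E', s', f')).
     (E, s, f) \<in> roofs R C D \<and> (E', s', f') \<in> roofs R C D \<and>
     (\<exists>W u v. W \<in> Db_objects R \<and> chain_map R W E u \<and> chain_map R W E' v \<and>
        quasi_iso R W C (\<lambda>i. s i \<circ> u i) \<and>
        homotopic R W C (\<lambda>i. s i \<circ> u i) (\<lambda>i. s' i \<circ> v i) \<and>
        homotopic R W D (\<lambda>i. f i \<circ> u i) (\<lambda>i. f' i \<circ> v i))}"

definition Db_Hom ::
  "('a, 'r) ring_scheme \<Rightarrow> ('a, nat \<Rightarrow> 'a) cochain \<Rightarrow> ('a, nat \<Rightarrow> 'a) cochain \<Rightarrow>
    'a roof set set" where
  "Db_Hom R C D = roofs R C D // roof_equiv R C D"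

definition Db_zero ::
  "('a, 'r) ring_scheme \<Rightarrow> ('a, nat \<Rightarrow> 'a) cochain \<Rightarrow> ('a, nat \<Rightarrow> 'a) cochain \<Rightarrow> 'a roof set" where
  "Db_zero R C D = roof_equiv R C D `` {(C, (\<lambda>i x. x), (\<lambda>i x. \<zero>\<^bsub>obj D i\<^esub>))}"

definition Hom_vanishes ::
  "('a, 'r) ring_scheme \<Rightarrow> ('a, nat \<Rightarrow> 'a) cochain \<Rightarrow> ('a, nat \<Rightarrow> 'a) cochain \<Rightarrow> bool" where
  "Hom_vanishes R C D \<longleftrightarrow> Db_Hom R C D = {Db_zero R C D}"

definition Db_interval ::
  "('a, 'r) ring_scheme \<Rightarrow> int \<Rightarrow> int \<Rightarrow> ('a, nat \<Rightarrow> 'a) cochain set" where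
  "Db_interval R a b =
     {C \<in> Db_objects R. \<forall>i. i \<notin> {a..b} \<longrightarrow> trivial_group (cohomology C i)}"

section \<open>Torsion pairs\<close>

text \<open>A full subcategory is given by its set of objects; here all are subcategories of the extended
  module category \<open>Db_interval R (- int d + 2) 0\<close>.\<close>

type_synonym 'a subcat_pair =
  "('a, nat \<Rightarrow> 'a) cochain set \<times> ('a, nat \<Rightarrow> 'a) cochain set"

definition torsion_pairs :: "('a, 'r) ring_scheme \<Rightarrow> nat \<Rightarrow> 'a subcat_pair set" where
  "torsion_pairs R d = {(T, F).
     T \<subseteq> Db_interval R (- int d + 2) 0 \<and> F \<subseteq> Db_interval R (- int d + 2) 0 \<and>
     (\<forall>t\<in>Db_interval R (- int d + 2) 0. (\<forall>f\<in>F. Hom_vanishes R t f) \<longleftrightarrow> t \<in> T) \<and>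
     (\<forall>f\<in>Db_interval R (- int d + 2) 0. (\<forall>t\<in>T. Hom_vanishes R t f) \<longleftrightarrow> f \<in> F)}"

definition positive_torsion_pairs :: "('a, 'r) ring_scheme \<Rightarrow> nat \<Rightarrow> 'a subcat_pair set" where
  "positive_torsion_pairs R d = {(T, F) \<in> torsion_pairs R d.
     \<forall>k\<le>-1. \<forall>t\<in>T. \<forall>f\<in>F. Hom_vanishes R t (shift k f)}"

definition torsion_poset :: "('a, 'r) ring_scheme \<Rightarrow> nat \<Rightarrow> 'a subcat_pair gorder" where
  "torsion_poset R d =
     \<lparr>carrier = torsion_pairs R d, eq = (=), le = (\<lambda>p q. fst p \<subseteq> fst q)\<rparr>"

definition positive_torsion_poset :: "('a, 'r) ring_scheme \<Rightarrow> nat \<Rightarrow> 'a subcat_pair gorder" where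
  "positive_torsion_poset R d = (torsion_poset R d)\<lparr>carrier := positive_torsion_pairs R d\<rparr>"

text \<open>The join and meet operations of \<^const>\<open>torsion_poset\<close> are meaningful, because:\<close>

lemma lattice_torsion_poset: "lattice (torsion_poset R d)"
proof -
  let ?C = "Db_interval R (- int d + 2) 0" and ?L = "torsion_poset R d"
  define rperp where "rperp T = {f \<in> ?C. \<forall>t\<in>T. Hom_vanishes R t f}" for T
  define lperp where "lperp F = {t \<in> ?C. \<forall>f\<in>F. Hom_vanishes R t f}" for F
  have tp: "torsion_pairs R d = {(T, F). T \<subseteq> ?C \<and> F \<subseteq> ?C \<and> T = lperp F \<and> F = rperp T}"
    unfolding torsion_pairs_def lperp_def rperp_def by blast
  have anti: "lperp F' \<subseteq> lperp F" "rperp F' \<subseteq> rperp F" if "F \<subseteq> F'" for F F'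
    using that unfolding lperp_def rperp_def by blast+
  have ext: "F \<subseteq> rperp (lperp F)" "F \<subseteq> lperp (rperp F)" if "F \<subseteq> ?C" for F
    using that unfolding lperp_def rperp_def by blast+
  have sub: "lperp F \<subseteq> ?C" "rperp F \<subseteq> ?C" for F
    unfolding lperp_def rperp_def by blast+
  have L: "carrier ?L = torsion_pairs R d" "le ?L = (\<lambda>p q. fst p \<subseteq> fst q)" "eq ?L = (=)"
    by (simp_all add: torsion_poset_def)
  have po: "partial_order ?L"
    by unfold_locales (auto simp: torsion_poset_def tp)
  have "\<exists>s. least ?L s (Upper ?L {p, q})" if "p \<in> carrier ?L" "q \<in> carrier ?L" for p q
  proof -
    obtain T F T' F' where pq: "p = (T, F)" "q = (T', F')" by (metis prod.exhaust)
    then have h: "F \<subseteq> ?C" "T = lperp F" "F = rperp T" "T' = lperp F'" "F' = rperp T'"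
      using that unfolding L tp by blast+
    let ?G = "F \<inter> F'"
    have G: "rperp (lperp ?G) = ?G"
    proof
      have "rperp (lperp ?G) \<subseteq> rperp T" "rperp (lperp ?G) \<subseteq> rperp T'"
        unfolding h(2,4) by (intro anti; blast)+
      then show "rperp (lperp ?G) \<subseteq> ?G" using h(3,5) by blast
      show "?G \<subseteq> rperp (lperp ?G)" using h(1) by (intro ext) blast
    qed
    have "(lperp ?G, ?G) \<in> carrier ?L" unfolding L tp using G sub h(1) by blast
    moreover have "T \<subseteq> lperp ?G" "T' \<subseteq> lperp ?G" unfolding h(2,4) by (intro anti; blast)+
    moreover have "lperp ?G \<subseteq> fst x" if x: "x \<in> carrier ?L" "T \<subseteq> fst x" "T' \<subseteq> fst x" for x
    proof -
      obtain U V where "x = (U, V)" "U = lperp V" "V = rperp U" using x(1) unfolding L tp by blast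
      moreover from this have "V \<subseteq> ?G" using anti(2) x(2,3) h(3,5) by (metis Int_greatest fst_conv)
      ultimately show ?thesis using anti(1) by (metis fst_conv)
    qed
    ultimately have "least ?L (lperp ?G, ?G) (Upper ?L {p, q})"
      using that unfolding least_def Upper_def L(2) pq by auto
    then show ?thesis by blast
  qed
  moreover have "\<exists>s. greatest ?L s (Lower ?L {p, q})" if "p \<in> carrier ?L" "q \<in> carrier ?L" for p q
  proof -
    obtain T F T' F' where pq: "p = (T, F)" "q = (T', F')" by (metis prod.exhaust)
    then have h: "T \<subseteq> ?C" "T = lperp F" "F = rperp T" "T' = lperp F'" "F' = rperp T'"
      using that unfolding L tp by blast+
    let ?G = "T \<inter> T'"
    have G: "lperp (rperp ?G) = ?G"
    proof
      have "lperp (rperp ?G) \<subseteq> lperp F" "lperp (rperp ?G) \<subseteq> lperp F'"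
        unfolding h(3,5) by (intro anti; blast)+
      then show "lperp (rperp ?G) \<subseteq> ?G" using h(2,4) by blast
      show "?G \<subseteq> lperp (rperp ?G)" using h(1) by (intro ext) blast
    qed
    have "(?G, rperp ?G) \<in> carrier ?L" unfolding L tp using G sub h(1) by blast
    then have "greatest ?L (?G, rperp ?G) (Lower ?L {p, q})"
      using that unfolding greatest_def Lower_def L(2) pq by auto
    then show ?thesis by blast
  qed
  ultimately show ?thesis
    using po by (simp add: lattice_def upper_semilattice_def lower_semilattice_def
      upper_semilattice_axioms_def lower_semilattice_axioms_def)
qed

end

theory Submission
  imports Defs
begin

text \<open>A torsion pair \<open>(T, F)\<close> in \<open>D\<^sup>[\<^sup>a\<^sup>,\<^sup>b\<^sup>]\<close> is positive iff \<open>T\<close> is closed under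
  \<open>t \<mapsto> \<tau>\<^sup>\<ge>\<^sup>a \<Sigma>\<^sup>k t\<close> for \<open>k \<ge> 1\<close>, because \<open>Hom(t, \<Sigma>\<^sup>-\<^sup>k f) = Hom(\<tau>\<^sup>\<ge>\<^sup>a \<Sigma>\<^sup>k t, f)\<close>; dually, iff \<open>F\<close> is
  closed under \<open>f \<mapsto> \<tau>\<^sup>\<le>\<^sup>b \<Sigma>\<^sup>-\<^sup>k f\<close>.  The torsion class of a meet is the intersection of the torsion
  classes, and the torsion-free class of a join is the intersection of the torsion-free classes, so
  both closure properties are inherited.

  Only the vanishing of morphism sets matters.  A morphism given by a roof \<open>X \<leftarrow> E \<rightarrow> Y\<close> is zero iff
  \<open>E \<rightarrow> Y\<close> becomes null-homotopic after composition with a quasi-isomorphism \<open>W \<rightarrow> E\<close>; such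
  quasi-isomorphisms are produced as homotopy pullbacks.\<close>

section \<open>Modules\<close>

text \<open>Positivity relates the two classes of a pair, while a meet controls only torsion
  classes: the torsion-free class of a meet can be larger than the union of the two given ones. So
  positivity has to become a closure property of one class alone, and this is where the truncation
  adjunctions enter. A torsion class consists of all objects of the interval without nonzero
  morphisms into the torsion-free class, so membership of a truncated shift is again a vanishing
  statement.

  Two constraints shape the constructions. Objects of the derived category have the fixed element
  type \<open>nat \<Rightarrow> 'a\<close>, so products are interleaved functions and quotients are
  sets of representatives. And terms must stay finitely generated, so complexes are made from
  products and quotients, never from kernels. The homotopy pullback respects both: it serves as the
  Ore condition, as the cocone of a map and as the lower truncation. Its exactness properties take
  the place of long exact sequences and are proved by chasing elements.\<close>

lemma (in abelian_group) a_inv_zero [simp]: "\<ominus> \<zero> = \<zero>"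
  using r_neg[OF zero_closed] by simp

text \<open>Closure under negatives comes from multiplication by minus one, see
  \<open>left_submodule_minus\<close>.\<close>

definition left_submodule :: "('a, 'r) ring_scheme \<Rightarrow> ('a, 'm, 's) module_scheme \<Rightarrow> 'm set \<Rightarrow> bool" where
  "left_submodule R M N \<longleftrightarrow> N \<subseteq> carrier M \<and> \<zero>\<^bsub>M\<^esub> \<in> N \<and>
     (\<forall>x\<in>N. \<forall>y\<in>N. x \<oplus>\<^bsub>M\<^esub> y \<in> N) \<and> (\<forall>a\<in>carrier R. \<forall>x\<in>N. a \<odot>\<^bsub>M\<^esub> x \<in> N)"

lemma mod_homD:
  assumes "f \<in> mod_hom R M N"
  shows "x \<in> carrier M \<Longrightarrow> f x \<in> carrier N"
    and "x \<in> carrier M \<Longrightarrow> y \<in> carrier M \<Longrightarrow> f (x \<oplus>\<^bsub>M\<^esub> y) = f x \<oplus>\<^bsub>N\<^esub> f y"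
    and "a \<in> carrier R \<Longrightarrow> x \<in> carrier M \<Longrightarrow> f (a \<odot>\<^bsub>M\<^esub> x) = a \<odot>\<^bsub>N\<^esub> f x"
  using assms by (auto simp: mod_hom_def)

lemma mod_homI:
  assumes "\<And>x. x \<in> carrier M \<Longrightarrow> f x \<in> carrier N"
    and "\<And>x y. x \<in> carrier M \<Longrightarrow> y \<in> carrier M \<Longrightarrow> f (x \<oplus>\<^bsub>M\<^esub> y) = f x \<oplus>\<^bsub>N\<^esub> f y"
    and "\<And>a x. a \<in> carrier R \<Longrightarrow> x \<in> carrier M \<Longrightarrow> f (a \<odot>\<^bsub>M\<^esub> x) = a \<odot>\<^bsub>N\<^esub> f x"
  shows "f \<in> mod_hom R M N"
  using assms by (auto simp: mod_hom_def)

lemma mod_hom_comp: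
  "f \<in> mod_hom R M N \<Longrightarrow> g \<in> mod_hom R N L \<Longrightarrow> (\<lambda>x. g (f x)) \<in> mod_hom R M L"
  by (auto intro!: mod_homI simp: mod_homD)

lemma mod_hom_zero_minus:
  assumes "abelian_group M" "abelian_group N" "f \<in> mod_hom R M N"
  shows "f \<zero>\<^bsub>M\<^esub> = \<zero>\<^bsub>N\<^esub>"
    and "x \<in> carrier M \<Longrightarrow> f (\<ominus>\<^bsub>M\<^esub> x) = \<ominus>\<^bsub>N\<^esub> f x"
    and "x \<in> carrier M \<Longrightarrow> y \<in> carrier M \<Longrightarrow> f (x \<ominus>\<^bsub>M\<^esub> y) = f x \<ominus>\<^bsub>N\<^esub> f y"
proof -
  interpret M: abelian_group M by fact
  interpret N: abelian_group N by fact
  note [simp] = mod_homD[OF assms(3)]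
  have "f \<zero>\<^bsub>M\<^esub> \<oplus>\<^bsub>N\<^esub> f \<zero>\<^bsub>M\<^esub> = f (\<zero>\<^bsub>M\<^esub> \<oplus>\<^bsub>M\<^esub> \<zero>\<^bsub>M\<^esub>)"
    by (simp del: M.l_zero M.r_zero)
  then show z: "f \<zero>\<^bsub>M\<^esub> = \<zero>\<^bsub>N\<^esub>" by simp
  show m: "f (\<ominus>\<^bsub>M\<^esub> x) = \<ominus>\<^bsub>N\<^esub> f x" if "x \<in> carrier M" for x
  proof -
    have "f (\<ominus>\<^bsub>M\<^esub> x) \<oplus>\<^bsub>N\<^esub> f x = f (\<ominus>\<^bsub>M\<^esub> x \<oplus>\<^bsub>M\<^esub> x)" using that by (simp del: M.l_neg)
    also have "\<dots> = \<zero>\<^bsub>N\<^esub>" using that z by (simp add: M.l_neg)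
    finally show ?thesis using that by (intro N.minus_equality[symmetric]) auto
  qed
  show "f (x \<ominus>\<^bsub>M\<^esub> y) = f x \<ominus>\<^bsub>N\<^esub> f y" if "x \<in> carrier M" "y \<in> carrier M"
    using that by (simp add: a_minus_def m)
qed

section \<open>Submodules, spans and finite generation\<close>

context left_module
begin

lemma smult_zero [simp]: "a \<in> carrier R \<Longrightarrow> a \<odot>\<^bsub>M\<^esub> \<zero>\<^bsub>M\<^esub> = \<zero>\<^bsub>M\<^esub>"
  using smult_r_distr[of a "\<zero>\<^bsub>M\<^esub>" "\<zero>\<^bsub>M\<^esub>"] by simp

lemma zero_smult [simp]: "x \<in> carrier M \<Longrightarrow> \<zero>\<^bsub>R\<^esub> \<odot>\<^bsub>M\<^esub> x = \<zero>\<^bsub>M\<^esub>"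
  using smult_l_distr[of "\<zero>\<^bsub>R\<^esub>" "\<zero>\<^bsub>R\<^esub>" x] by simp

lemma minus_smult:
  assumes "a \<in> carrier R" "x \<in> carrier M"
  shows "(\<ominus>\<^bsub>R\<^esub> a) \<odot>\<^bsub>M\<^esub> x = \<ominus>\<^bsub>M\<^esub> (a \<odot>\<^bsub>M\<^esub> x)"
  using smult_l_distr[of "\<ominus>\<^bsub>R\<^esub> a" a x] assms
  by (intro M.minus_equality[symmetric]) (simp_all add: R.l_neg)

lemma smult_minus:
  assumes "a \<in> carrier R" "x \<in> carrier M"
  shows "a \<odot>\<^bsub>M\<^esub> (\<ominus>\<^bsub>M\<^esub> x) = \<ominus>\<^bsub>M\<^esub> (a \<odot>\<^bsub>M\<^esub> x)"
  using smult_r_distr[of a "\<ominus>\<^bsub>M\<^esub> x" x] assms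
  by (intro M.minus_equality[symmetric]) (simp_all add: M.l_neg)

lemma left_submodule_minus:
  assumes "left_submodule R M N" "x \<in> N"
  shows "\<ominus>\<^bsub>M\<^esub> x \<in> N"
proof -
  have "x \<in> carrier M" using assms by (auto simp: left_submodule_def)
  then have "\<ominus>\<^bsub>M\<^esub> x = (\<ominus>\<^bsub>R\<^esub> \<one>\<^bsub>R\<^esub>) \<odot>\<^bsub>M\<^esub> x" by (simp add: minus_smult)
  then show ?thesis using assms by (simp add: left_submodule_def)
qed

lemma left_submodule_span:
  assumes "S \<subseteq> carrier M"
  shows "left_submodule R M {\<Oplus>\<^bsub>M\<^esub>s\<in>S. c s \<odot>\<^bsub>M\<^esub> s | c. c \<in> S \<rightarrow> carrier R}"
proof -
  have S: "s \<in> carrier M" if "s \<in> S" for s using assms that by blast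
  have cl: "(\<lambda>s. c s \<odot>\<^bsub>M\<^esub> s) \<in> T \<rightarrow> carrier M" if "c \<in> S \<rightarrow> carrier R" "T \<subseteq> S" for c T
    using S that by (intro Pi_I smult_closed) blast+
  have z: "\<zero>\<^bsub>M\<^esub> = (\<Oplus>\<^bsub>M\<^esub>s\<in>S. \<zero>\<^bsub>R\<^esub> \<odot>\<^bsub>M\<^esub> s)"
  proof -
    have "(\<Oplus>\<^bsub>M\<^esub>s\<in>S. \<zero>\<^bsub>R\<^esub> \<odot>\<^bsub>M\<^esub> s) = (\<Oplus>\<^bsub>M\<^esub>s\<in>S. \<zero>\<^bsub>M\<^esub>)"
      using S by (intro M.finsum_cong') simp_all
    then show ?thesis by simp
  qed
  have add: "(\<Oplus>\<^bsub>M\<^esub>s\<in>S. c s \<odot>\<^bsub>M\<^esub> s) \<oplus>\<^bsub>M\<^esub> (\<Oplus>\<^bsub>M\<^esub>s\<in>S. d s \<odot>\<^bsub>M\<^esub> s) = (\<Oplus>\<^bsub>M\<^esub>s\<in>S. (c s \<oplus>\<^bsub>R\<^esub> d s) \<odot>\<^bsub>M\<^esub> s)"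
    if c: "c \<in> S \<rightarrow> carrier R" and d: "d \<in> S \<rightarrow> carrier R" for c d
  proof -
    have "(\<Oplus>\<^bsub>M\<^esub>s\<in>S. (c s \<oplus>\<^bsub>R\<^esub> d s) \<odot>\<^bsub>M\<^esub> s) = (\<Oplus>\<^bsub>M\<^esub>s\<in>S. c s \<odot>\<^bsub>M\<^esub> s \<oplus>\<^bsub>M\<^esub> d s \<odot>\<^bsub>M\<^esub> s)"
      using S c d by (intro M.finsum_cong') (simp_all add: smult_l_distr Pi_iff)
    then show ?thesis using M.finsum_addf[OF cl[OF c order.refl] cl[OF d order.refl]] by simp
  qed
  have smult: "a \<odot>\<^bsub>M\<^esub> (\<Oplus>\<^bsub>M\<^esub>s\<in>S. c s \<odot>\<^bsub>M\<^esub> s) = (\<Oplus>\<^bsub>M\<^esub>s\<in>S. (a \<otimes>\<^bsub>R\<^esub> c s) \<odot>\<^bsub>M\<^esub> s)"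
    if a: "a \<in> carrier R" and c: "c \<in> S \<rightarrow> carrier R" for a c
  proof (cases "finite S")
    case True
    have ac: "(\<lambda>s. a \<otimes>\<^bsub>R\<^esub> c s) \<in> S \<rightarrow> carrier R" using a c by (simp add: Pi_iff)
    have "a \<odot>\<^bsub>M\<^esub> (\<Oplus>\<^bsub>M\<^esub>s\<in>T. c s \<odot>\<^bsub>M\<^esub> s) = (\<Oplus>\<^bsub>M\<^esub>s\<in>T. (a \<otimes>\<^bsub>R\<^esub> c s) \<odot>\<^bsub>M\<^esub> s)"
      if "finite T" "T \<subseteq> S" for T
      using that
    proof (induction T)
      case empty then show ?case using a by simp
    next
      case (insert s T)
      then have T: "T \<subseteq> S" and s: "s \<in> S" by simp_all
      have [simp]: "s \<in> carrier M" "c s \<in> carrier R" using s S c by (simp_all add: Pi_iff)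
      note M.finsum_insert[OF insert.hyps cl[OF c T]] M.finsum_insert[OF insert.hyps cl[OF ac T]]
      moreover have "(\<Oplus>\<^bsub>M\<^esub>s\<in>T. c s \<odot>\<^bsub>M\<^esub> s) \<in> carrier M" by (rule M.finsum_closed[OF cl[OF c T]])
      ultimately show ?case using insert.IH[OF T] a by (simp add: smult_r_distr smult_assoc)
    qed
    then show ?thesis using True by blast
  next
    \<comment> \<open>An infinite \<open>finsum\<close> is zero by convention, so both sides
      vanish.\<close>
    case False then show ?thesis using a by (simp add: M.finsum_infinite)
  qed
  show ?thesis
    unfolding left_submodule_def
  proof (intro conjI ballI subsetI)
    fix x assume "x \<in> {\<Oplus>\<^bsub>M\<^esub>s\<in>S. c s \<odot>\<^bsub>M\<^esub> s | c. c \<in> S \<rightarrow> carrier R}"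
    then show "x \<in> carrier M" using M.finsum_closed[OF cl[OF _ order.refl]] by blast
  next
    show "\<zero>\<^bsub>M\<^esub> \<in> {\<Oplus>\<^bsub>M\<^esub>s\<in>S. c s \<odot>\<^bsub>M\<^esub> s | c. c \<in> S \<rightarrow> carrier R}"
      by (intro CollectI exI[of _ "\<lambda>_. \<zero>\<^bsub>R\<^esub>"] conjI z) simp
  next
    fix x y assume "x \<in> {\<Oplus>\<^bsub>M\<^esub>s\<in>S. c s \<odot>\<^bsub>M\<^esub> s | c. c \<in> S \<rightarrow> carrier R}"
      "y \<in> {\<Oplus>\<^bsub>M\<^esub>s\<in>S. c s \<odot>\<^bsub>M\<^esub> s | c. c \<in> S \<rightarrow> carrier R}"
    then obtain c d where c: "c \<in> S \<rightarrow> carrier R" "x = (\<Oplus>\<^bsub>M\<^esub>s\<in>S. c s \<odot>\<^bsub>M\<^esub> s)"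
      and d: "d \<in> S \<rightarrow> carrier R" "y = (\<Oplus>\<^bsub>M\<^esub>s\<in>S. d s \<odot>\<^bsub>M\<^esub> s)" by blast
    show "x \<oplus>\<^bsub>M\<^esub> y \<in> {\<Oplus>\<^bsub>M\<^esub>s\<in>S. c s \<odot>\<^bsub>M\<^esub> s | c. c \<in> S \<rightarrow> carrier R}"
      using c(1) d(1) add[OF c(1) d(1)] unfolding c(2) d(2)
      by (intro CollectI exI[of _ "\<lambda>s. c s \<oplus>\<^bsub>R\<^esub> d s"] conjI) (simp_all add: Pi_iff)
  next
    fix a x assume a: "a \<in> carrier R" and "x \<in> {\<Oplus>\<^bsub>M\<^esub>s\<in>S. c s \<odot>\<^bsub>M\<^esub> s | c. c \<in> S \<rightarrow> carrier R}"
    then obtain c where c: "c \<in> S \<rightarrow> carrier R" "x = (\<Oplus>\<^bsub>M\<^esub>s\<in>S. c s \<odot>\<^bsub>M\<^esub> s)" by blast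
    show "a \<odot>\<^bsub>M\<^esub> x \<in> {\<Oplus>\<^bsub>M\<^esub>s\<in>S. c s \<odot>\<^bsub>M\<^esub> s | c. c \<in> S \<rightarrow> carrier R}"
      using c(1) a smult[OF a c(1)] unfolding c(2)
      by (intro CollectI exI[of _ "\<lambda>s. a \<otimes>\<^bsub>R\<^esub> c s"] conjI) (simp_all add: Pi_iff)
  qed
qed

lemma span_contains_generators:
  assumes "finite S" "S \<subseteq> carrier M" "t \<in> S"
  shows "t \<in> {\<Oplus>\<^bsub>M\<^esub>s\<in>S. c s \<odot>\<^bsub>M\<^esub> s | c. c \<in> S \<rightarrow> carrier R}"
proof -
  have "(\<Oplus>\<^bsub>M\<^esub>s\<in>S. (if s = t then \<one>\<^bsub>R\<^esub> else \<zero>\<^bsub>R\<^esub>) \<odot>\<^bsub>M\<^esub> s) = (\<Oplus>\<^bsub>M\<^esub>s\<in>S. if t = s then s else \<zero>\<^bsub>M\<^esub>)"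
    using assms by (intro M.finsum_cong') auto
  also have "\<dots> = t" using assms M.finsum_singleton[of t S "\<lambda>s. s"] by auto
  finally show ?thesis
    by (intro CollectI exI[of _ "\<lambda>s. if s = t then \<one>\<^bsub>R\<^esub> else \<zero>\<^bsub>R\<^esub>"]) auto
qed

text \<open>Finite generation without coefficients. In this form it travels along homomorphisms by
  taking preimages of submodules, with no handling of linear combinations.\<close>

lemma fg_module_iff:
  "fg_module R M \<longleftrightarrow>
    (\<exists>S. finite S \<and> S \<subseteq> carrier M \<and> (\<forall>N. left_submodule R M N \<longrightarrow> S \<subseteq> N \<longrightarrow> carrier M \<subseteq> N))"
proof
  assume fg: "fg_module R M"
  obtain S where S: "finite S" "S \<subseteq> carrier M"
    "\<forall>x\<in>carrier M. \<exists>c \<in> S \<rightarrow> carrier R. x = (\<Oplus>\<^bsub>M\<^esub>s\<in>S. c s \<odot>\<^bsub>M\<^esub> s)"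
    using fg_module.finite_generating_set[OF fg] by blast
  have *: "(\<Oplus>\<^bsub>M\<^esub>s\<in>T. c s \<odot>\<^bsub>M\<^esub> s) \<in> N"
    if N: "left_submodule R M N" "S \<subseteq> N" and c: "c \<in> S \<rightarrow> carrier R" and T: "finite T" "T \<subseteq> S" for N c T
    using T
  proof (induction T)
    case empty then show ?case using N by (simp add: left_submodule_def)
  next
    case (insert s T)
    then have T: "T \<subseteq> S" and s: "s \<in> S" by simp_all
    have "(\<lambda>s. c s \<odot>\<^bsub>M\<^esub> s) \<in> T \<rightarrow> carrier M" "c s \<odot>\<^bsub>M\<^esub> s \<in> carrier M"
      using subsetD[OF S(2)] funcset_mem[OF c] subsetD[OF T] s by simp_all
    then have "(\<Oplus>\<^bsub>M\<^esub>s\<in>insert s T. c s \<odot>\<^bsub>M\<^esub> s) = c s \<odot>\<^bsub>M\<^esub> s \<oplus>\<^bsub>M\<^esub> (\<Oplus>\<^bsub>M\<^esub>s\<in>T. c s \<odot>\<^bsub>M\<^esub> s)"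
      using insert.hyps by (intro M.finsum_insert)
    moreover have "c s \<odot>\<^bsub>M\<^esub> s \<in> N" using N c s by (auto simp: left_submodule_def Pi_iff)
    ultimately show ?case using insert.IH[OF T] N(1) by (simp add: left_submodule_def)
  qed
  have "carrier M \<subseteq> N" if N: "left_submodule R M N" "S \<subseteq> N" for N
  proof
    fix x assume "x \<in> carrier M"
    then obtain c where "c \<in> S \<rightarrow> carrier R" "x = (\<Oplus>\<^bsub>M\<^esub>s\<in>S. c s \<odot>\<^bsub>M\<^esub> s)"
      using S(3) by (auto simp: Bex_def)
    then show "x \<in> N" using *[OF N _ S(1)] by simp
  qed
  then show "\<exists>S. finite S \<and> S \<subseteq> carrier M \<and> (\<forall>N. left_submodule R M N \<longrightarrow> S \<subseteq> N \<longrightarrow> carrier M \<subseteq> N)"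
    using S(1,2) by blast
next
  assume "\<exists>S. finite S \<and> S \<subseteq> carrier M \<and> (\<forall>N. left_submodule R M N \<longrightarrow> S \<subseteq> N \<longrightarrow> carrier M \<subseteq> N)"
  then obtain S where S: "finite S" "S \<subseteq> carrier M"
    "\<And>N. left_submodule R M N \<Longrightarrow> S \<subseteq> N \<Longrightarrow> carrier M \<subseteq> N" by blast
  \<comment> \<open>The span of \<open>S\<close> is itself a submodule containing \<open>S\<close>,
    so the minimality hypothesis applies to it.\<close>
  have "carrier M \<subseteq> {\<Oplus>\<^bsub>M\<^esub>s\<in>S. c s \<odot>\<^bsub>M\<^esub> s | c. c \<in> S \<rightarrow> carrier R}"
    by (rule S(3)[OF left_submodule_span[OF S(2)] subsetI], rule span_contains_generators[OF S(1,2)])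
  then have "\<exists>c \<in> S \<rightarrow> carrier R. x = (\<Oplus>\<^bsub>M\<^esub>s\<in>S. c s \<odot>\<^bsub>M\<^esub> s)" if "x \<in> carrier M" for x
    using that by (auto simp: Bex_def)
  then show "fg_module R M"
    using S(1,2) by (intro fg_module.intro left_module_axioms fg_module_axioms.intro exI[of _ S]) simp
qed

end

lemma left_submodule_vimage:
  assumes "f \<in> mod_hom R M N" "left_submodule R N H" "left_module R M" "left_module R N"
  shows "left_submodule R M {x \<in> carrier M. f x \<in> H}"
proof -
  interpret M: left_module R M by fact
  interpret N: left_module R N by fact
  show ?thesis
    using assms(2) mod_homD[OF assms(1)]
       mod_hom_zero_minus(1)[OF M.M.abelian_group_axioms N.M.abelian_group_axioms assms(1)]
    by (auto simp: left_submodule_def)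
qed

text \<open>A submodule that contains the images of generators has a preimage that contains the
  generators, hence all of \<open>M\<close>; so the images generate.\<close>

lemma fg_module_image:
  assumes "fg_module R M" "left_module R N" "f \<in> mod_hom R M N" "f ` carrier M = carrier N"
  shows "fg_module R N"
proof -
  interpret M: fg_module R M by fact
  interpret N: left_module R N by fact
  obtain S where S: "finite S" "S \<subseteq> carrier M"
    "\<And>H. left_submodule R M H \<Longrightarrow> S \<subseteq> H \<Longrightarrow> carrier M \<subseteq> H"
    using assms(1) unfolding M.fg_module_iff by blast
  have "carrier N \<subseteq> H" if H: "left_submodule R N H" "f ` S \<subseteq> H" for H
  proof -
    have "S \<subseteq> {x \<in> carrier M. f x \<in> H}" using H(2) S(2) by blast
    from S(3)[OF left_submodule_vimage[OF assms(3) H(1) M.left_module_axioms assms(2)] this]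
    show ?thesis unfolding assms(4)[symmetric] by (intro image_subsetI) blast
  qed
  then show ?thesis
    unfolding N.fg_module_iff using S(1,2) assms(4) by (intro exI[of _ "f ` S"]) auto
qed

text \<open>A product that stays within the type \<open>nat \<Rightarrow> 'a\<close>.\<close>

definition fpair :: "(nat \<Rightarrow> 'a) \<Rightarrow> (nat \<Rightarrow> 'a) \<Rightarrow> nat \<Rightarrow> 'a" where
  "fpair x y n = (if even n then x (n div 2) else y (n div 2))"

definition ffst :: "(nat \<Rightarrow> 'a) \<Rightarrow> nat \<Rightarrow> 'a" where "ffst w n = w (2 * n)"

definition fsnd :: "(nat \<Rightarrow> 'a) \<Rightarrow> nat \<Rightarrow> 'a" where "fsnd w n = w (2 * n + 1)"

lemma fpair_simps [simp]:
  "ffst (fpair x y) = x" "fsnd (fpair x y) = y" "fpair (ffst w) (fsnd w) = w"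
  by (auto simp: fpair_def ffst_def fsnd_def fun_eq_iff elim!: oddE)

lemma eq_fpair_iff: "w = fpair x y \<longleftrightarrow> ffst w = x \<and> fsnd w = y"
  by (metis fpair_simps)

section \<open>Products and the zero module\<close>

definition prod_module ::
  "('a, nat \<Rightarrow> 'b) module \<Rightarrow> ('a, nat \<Rightarrow> 'b) module \<Rightarrow> ('a, nat \<Rightarrow> 'b) module" where
  "prod_module M N = \<lparr>carrier = {w. ffst w \<in> carrier M \<and> fsnd w \<in> carrier N},
     monoid.mult = undefined, one = undefined, zero = fpair \<zero>\<^bsub>M\<^esub> \<zero>\<^bsub>N\<^esub>,
     add = (\<lambda>u v. fpair (ffst u \<oplus>\<^bsub>M\<^esub> ffst v) (fsnd u \<oplus>\<^bsub>N\<^esub> fsnd v)),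
     smult = (\<lambda>a u. fpair (a \<odot>\<^bsub>M\<^esub> ffst u) (a \<odot>\<^bsub>N\<^esub> fsnd u))\<rparr>"

lemma prod_module_simps [simp]:
  "w \<in> carrier (prod_module M N) \<longleftrightarrow> ffst w \<in> carrier M \<and> fsnd w \<in> carrier N"
  "\<zero>\<^bsub>prod_module M N\<^esub> = fpair \<zero>\<^bsub>M\<^esub> \<zero>\<^bsub>N\<^esub>"
  "u \<oplus>\<^bsub>prod_module M N\<^esub> v = fpair (ffst u \<oplus>\<^bsub>M\<^esub> ffst v) (fsnd u \<oplus>\<^bsub>N\<^esub> fsnd v)"
  "a \<odot>\<^bsub>prod_module M N\<^esub> u = fpair (a \<odot>\<^bsub>M\<^esub> ffst u) (a \<odot>\<^bsub>N\<^esub> fsnd u)"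
  by (auto simp: prod_module_def)

lemma left_module_prod:
  assumes "left_module R M" "left_module R N"
  shows "left_module R (prod_module M N)"
proof -
  interpret M: left_module R M by fact
  interpret N: left_module R N by fact
  have ab: "abelian_group (prod_module M N)"
  proof (rule abelian_groupI)
    fix w assume "w \<in> carrier (prod_module M N)"
    then show "\<exists>v\<in>carrier (prod_module M N). v \<oplus>\<^bsub>prod_module M N\<^esub> w = \<zero>\<^bsub>prod_module M N\<^esub>"
      by (intro bexI[of _ "fpair (\<ominus>\<^bsub>M\<^esub> ffst w) (\<ominus>\<^bsub>N\<^esub> fsnd w)"]) (auto simp: M.M.l_neg N.M.l_neg)
  qed (auto simp: M.M.a_ac N.M.a_ac)
  show ?thesis
    by (intro left_module.intro ab M.R.ring_axioms left_module_axioms.intro)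
      (auto simp: M.smult_l_distr M.smult_r_distr M.smult_assoc N.smult_l_distr N.smult_r_distr N.smult_assoc)
qed

lemma fg_module_prod:
  assumes "fg_module R M" "fg_module R N"
  shows "fg_module R (prod_module M N)"
proof -
  interpret M: fg_module R M by fact
  interpret N: fg_module R N by fact
  have P: "left_module R (prod_module M N)"
    by (intro left_module_prod M.left_module_axioms N.left_module_axioms)
  interpret P: left_module R "prod_module M N" by (rule P)
  let ?i = "\<lambda>x. fpair x \<zero>\<^bsub>N\<^esub>" and ?j = "\<lambda>y. fpair \<zero>\<^bsub>M\<^esub> y"
  obtain S where S: "finite S" "S \<subseteq> carrier M"
    "\<And>H. left_submodule R M H \<Longrightarrow> S \<subseteq> H \<Longrightarrow> carrier M \<subseteq> H"
    using assms(1) unfolding M.fg_module_iff by blast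
  obtain T where T: "finite T" "T \<subseteq> carrier N"
    "\<And>H. left_submodule R N H \<Longrightarrow> T \<subseteq> H \<Longrightarrow> carrier N \<subseteq> H"
    using assms(2) unfolding N.fg_module_iff by blast
  have i: "?i \<in> mod_hom R M (prod_module M N)" and j: "?j \<in> mod_hom R N (prod_module M N)"
    by (auto intro!: mod_homI)
  have "carrier (prod_module M N) \<subseteq> H"
    if H: "left_submodule R (prod_module M N) H" "?i ` S \<union> ?j ` T \<subseteq> H" for H
  proof
    fix w assume w: "w \<in> carrier (prod_module M N)"
    \<comment> \<open>A pair is the sum of its two axis components, so it suffices to pull
      \<open>H\<close> back along both inclusions.\<close>
    have "carrier M \<subseteq> {x \<in> carrier M. ?i x \<in> H}" "carrier N \<subseteq> {y \<in> carrier N. ?j y \<in> H}"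
      using S(2) T(2) H
      by (intro S(3) T(3) left_submodule_vimage[OF i H(1)] left_submodule_vimage[OF j H(1)]
          M.left_module_axioms N.left_module_axioms P; auto)+
    then have "?i (ffst w) \<in> H" "?j (fsnd w) \<in> H" using w by auto
    then have "?i (ffst w) \<oplus>\<^bsub>prod_module M N\<^esub> ?j (fsnd w) \<in> H"
      using H(1) unfolding left_submodule_def by blast
    then show "w \<in> H" using w by simp
  qed
  then show ?thesis
    unfolding P.fg_module_iff using S(1,2) T(1,2) by (intro exI[of _ "?i ` S \<union> ?j ` T"]) auto
qed

text \<open>A module needs an element, and \<open>undefined\<close> supplies one in every type. It
  reappears as the middle coordinate of the tuples formed with \<open>zero_complex\<close>.\<close>

definition zero_module :: "('a, 'm) module" where
  "zero_module = \<lparr>carrier = {undefined}, monoid.mult = undefined, one = undefined, zero = undefined,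
     add = (\<lambda>_ _. undefined), smult = (\<lambda>_ _. undefined)\<rparr>"

lemma zero_module_simps [simp]: "carrier zero_module = {undefined}" "\<zero>\<^bsub>zero_module\<^esub> = undefined"
  "x \<oplus>\<^bsub>zero_module\<^esub> y = undefined" "a \<odot>\<^bsub>zero_module\<^esub> x = undefined"
  by (auto simp: zero_module_def)

lemma fg_module_zero:
  assumes "ring R"
  shows "fg_module R zero_module"
proof -
  have "abelian_group zero_module" by (rule abelian_groupI) auto
  then interpret left_module R zero_module
    by (intro left_module.intro assms left_module_axioms.intro) auto
  show ?thesis unfolding fg_module_iff by (intro exI[of _ "{}"]) (auto simp: left_submodule_def)
qed

text \<open>The quotient module is carried by a set of coset representatives, so it has the same element
  type as the module itself.\<close>

definition coset_rep :: "('a, 'm, 's) module_scheme \<Rightarrow> 'm set \<Rightarrow> 'm \<Rightarrow> 'm" where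
  "coset_rep M N x = (SOME y. y \<in> carrier M \<and> x \<ominus>\<^bsub>M\<^esub> y \<in> N)"

definition quot_module :: "('a, 'm, 's) module_scheme \<Rightarrow> 'm set \<Rightarrow> ('a, 'm) module" where
  "quot_module M N = \<lparr>carrier = coset_rep M N ` carrier M, monoid.mult = undefined, one = undefined,
     zero = coset_rep M N \<zero>\<^bsub>M\<^esub>, add = (\<lambda>u v. coset_rep M N (u \<oplus>\<^bsub>M\<^esub> v)),
     smult = (\<lambda>a u. coset_rep M N (a \<odot>\<^bsub>M\<^esub> u))\<rparr>"

context left_module
begin

context
  fixes N assumes N: "left_submodule R M N"
begin

lemma left_submoduleD:
  "x \<in> N \<Longrightarrow> x \<in> carrier M" "\<zero>\<^bsub>M\<^esub> \<in> N" "x \<in> N \<Longrightarrow> y \<in> N \<Longrightarrow> x \<oplus>\<^bsub>M\<^esub> y \<in> N"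
  "a \<in> carrier R \<Longrightarrow> x \<in> N \<Longrightarrow> a \<odot>\<^bsub>M\<^esub> x \<in> N" "x \<in> N \<Longrightarrow> \<ominus>\<^bsub>M\<^esub> x \<in> N"
  "x \<in> N \<Longrightarrow> y \<in> N \<Longrightarrow> x \<ominus>\<^bsub>M\<^esub> y \<in> N"
  using N left_submodule_minus[OF N] by (auto simp: left_submodule_def a_minus_def)

lemma coset_rep:
  assumes "x \<in> carrier M"
  shows "coset_rep M N x \<in> carrier M" "x \<ominus>\<^bsub>M\<^esub> coset_rep M N x \<in> N"
proof -
  have "\<exists>y. y \<in> carrier M \<and> x \<ominus>\<^bsub>M\<^esub> y \<in> N"
    using assms left_submoduleD(2) by (intro exI[of _ x]) (simp add: M.r_neg a_minus_def)
  from someI_ex[OF this] show "coset_rep M N x \<in> carrier M" "x \<ominus>\<^bsub>M\<^esub> coset_rep M N x \<in> N"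
    by (simp_all add: coset_rep_def)
qed

lemma coset_rep_eq_iff:
  assumes x: "x \<in> carrier M" and y: "y \<in> carrier M"
  shows "coset_rep M N x = coset_rep M N y \<longleftrightarrow> x \<ominus>\<^bsub>M\<^esub> y \<in> N"
proof
  assume eq: "coset_rep M N x = coset_rep M N y"
  have "(x \<ominus>\<^bsub>M\<^esub> coset_rep M N x) \<ominus>\<^bsub>M\<^esub> (y \<ominus>\<^bsub>M\<^esub> coset_rep M N x) \<in> N"
    using left_submoduleD(6)[OF coset_rep(2)[OF x] coset_rep(2)[OF y]] eq by simp
  moreover have "(x \<ominus>\<^bsub>M\<^esub> r) \<ominus>\<^bsub>M\<^esub> (y \<ominus>\<^bsub>M\<^esub> r) = x \<ominus>\<^bsub>M\<^esub> y" if "r \<in> carrier M" for r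
    using x y that by (simp add: a_minus_def M.minus_add M.minus_minus M.a_ac M.r_neg1 M.r_neg2)
  ultimately show "x \<ominus>\<^bsub>M\<^esub> y \<in> N" using coset_rep(1)[OF x] by simp
next
  \<comment> \<open>Congruent elements satisfy the same predicate under the choice operator, so the
    chosen representatives are equal and not merely congruent.\<close>
  assume xy: "x \<ominus>\<^bsub>M\<^esub> y \<in> N"
  have "x \<ominus>\<^bsub>M\<^esub> z \<in> N \<longleftrightarrow> y \<ominus>\<^bsub>M\<^esub> z \<in> N" if z: "z \<in> carrier M" for z
  proof
    assume "x \<ominus>\<^bsub>M\<^esub> z \<in> N"
    from left_submoduleD(6)[OF this xy] show "y \<ominus>\<^bsub>M\<^esub> z \<in> N"
      using x y z by (simp add: a_minus_def M.minus_add M.minus_minus M.a_ac M.r_neg1 M.r_neg2)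
  next
    assume "y \<ominus>\<^bsub>M\<^esub> z \<in> N"
    from left_submoduleD(3)[OF xy this] show "x \<ominus>\<^bsub>M\<^esub> z \<in> N"
      using x y z by (simp add: a_minus_def M.minus_add M.minus_minus M.a_ac M.r_neg1 M.r_neg2)
  qed
  then have "(\<lambda>z. z \<in> carrier M \<and> x \<ominus>\<^bsub>M\<^esub> z \<in> N) = (\<lambda>z. z \<in> carrier M \<and> y \<ominus>\<^bsub>M\<^esub> z \<in> N)"
    by (intro ext) blast
  then show "coset_rep M N x = coset_rep M N y" by (simp add: coset_rep_def)
qed

lemma coset_rep_add:
  assumes "x \<in> carrier M" "y \<in> carrier M"
  shows "coset_rep M N (coset_rep M N x \<oplus>\<^bsub>M\<^esub> coset_rep M N y) = coset_rep M N (x \<oplus>\<^bsub>M\<^esub> y)"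
proof -
  have "(x \<ominus>\<^bsub>M\<^esub> coset_rep M N x) \<oplus>\<^bsub>M\<^esub> (y \<ominus>\<^bsub>M\<^esub> coset_rep M N y) \<in> N"
    by (intro left_submoduleD(3) coset_rep assms)
  then show ?thesis
    using assms coset_rep(1)[OF assms(1)] coset_rep(1)[OF assms(2)]
    by (subst eq_commute, subst coset_rep_eq_iff) (simp_all add: a_minus_def M.minus_add M.a_ac)
qed

lemma coset_rep_smult:
  assumes "a \<in> carrier R" "x \<in> carrier M"
  shows "coset_rep M N (a \<odot>\<^bsub>M\<^esub> coset_rep M N x) = coset_rep M N (a \<odot>\<^bsub>M\<^esub> x)"
proof -
  have "a \<odot>\<^bsub>M\<^esub> (x \<ominus>\<^bsub>M\<^esub> coset_rep M N x) \<in> N"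
    by (intro left_submoduleD(4) coset_rep assms)
  then show ?thesis
    using assms coset_rep(1)[OF assms(2)]
    by (subst eq_commute, subst coset_rep_eq_iff) (simp_all add: a_minus_def smult_r_distr smult_minus)
qed

lemma quot_module_simps:
  "carrier (quot_module M N) = coset_rep M N ` carrier M"
  "\<zero>\<^bsub>quot_module M N\<^esub> = coset_rep M N \<zero>\<^bsub>M\<^esub>"
  "x \<in> carrier M \<Longrightarrow> y \<in> carrier M \<Longrightarrow>
     coset_rep M N x \<oplus>\<^bsub>quot_module M N\<^esub> coset_rep M N y = coset_rep M N (x \<oplus>\<^bsub>M\<^esub> y)"
  "a \<in> carrier R \<Longrightarrow> x \<in> carrier M \<Longrightarrow>
     a \<odot>\<^bsub>quot_module M N\<^esub> coset_rep M N x = coset_rep M N (a \<odot>\<^bsub>M\<^esub> x)"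
  using coset_rep_add coset_rep_smult by (simp_all add: quot_module_def)

lemma left_module_quot: "left_module R (quot_module M N)"
proof -
  have ab: "abelian_group (quot_module M N)"
  proof (rule abelian_groupI)
    fix w assume "w \<in> carrier (quot_module M N)"
    then obtain x where "x \<in> carrier M" "w = coset_rep M N x" by (auto simp: quot_module_simps)
    then show "\<exists>v\<in>carrier (quot_module M N). v \<oplus>\<^bsub>quot_module M N\<^esub> w = \<zero>\<^bsub>quot_module M N\<^esub>"
      by (intro bexI[of _ "coset_rep M N (\<ominus>\<^bsub>M\<^esub> x)"]) (auto simp: quot_module_simps M.l_neg)
  qed (auto simp: quot_module_simps M.a_ac)
  show ?thesis
    by (intro left_module.intro ab R.ring_axioms left_module_axioms.intro)
      (auto simp: quot_module_simps smult_l_distr smult_r_distr smult_assoc)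
qed

lemma coset_rep_zero_iff: "x \<in> carrier M \<Longrightarrow> coset_rep M N x = \<zero>\<^bsub>quot_module M N\<^esub> \<longleftrightarrow> x \<in> N"
  by (simp add: quot_module_simps coset_rep_eq_iff) (simp add: a_minus_def)

end

end

section \<open>Maps induced on quotients\<close>

lemma coset_rep_hom:
  assumes "left_module R M" "left_submodule R M N"
  shows "coset_rep M N \<in> mod_hom R M (quot_module M N)"
  by (auto intro!: mod_homI simp: left_module.quot_module_simps[OF assms])

lemma fg_module_quot:
  fixes M :: "('a, 'm) module"
  assumes "fg_module R M" "left_submodule R M N"
  shows "fg_module R (quot_module M N)"
proof -
  interpret M: fg_module R M by fact
  show ?thesis
    by (rule fg_module_image[OF assms(1) M.left_module_quot[OF assms(2)] coset_rep_hom[OF M.left_module_axioms assms(2)]])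
      (simp add: M.quot_module_simps[OF assms(2)])
qed

text \<open>The image of a representative need not be a representative, so the induced map applies
  \<open>f\<close> and then \<open>coset_rep\<close> of the target. The first claim says that the
  outcome does not depend on the representative fed in.\<close>

lemma induced_hom:
  assumes "left_module R M" "left_module R M'" "left_submodule R M N" "left_submodule R M' N'"
    and f: "f \<in> mod_hom R M M'" and fN: "\<And>x. x \<in> N \<Longrightarrow> f x \<in> N'"
  shows "x \<in> carrier M \<Longrightarrow> coset_rep M' N' (f (coset_rep M N x)) = coset_rep M' N' (f x)"
    and "(\<lambda>x. coset_rep M' N' (f x)) \<in> mod_hom R (quot_module M N) (quot_module M' N')"
proof -
  interpret M: left_module R M by fact
  interpret M': left_module R M' by fact
  note [simp] = mod_homD[OF f]
  show *: "coset_rep M' N' (f (coset_rep M N x)) = coset_rep M' N' (f x)" if x: "x \<in> carrier M" for x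
  proof -
    have "f (x \<ominus>\<^bsub>M\<^esub> coset_rep M N x) \<in> N'" using fN M.coset_rep(2)[OF assms(3) x] by blast
    then show ?thesis using x M.coset_rep(1)[OF assms(3) x]
      by (subst eq_commute, subst M'.coset_rep_eq_iff[OF assms(4)])
        (simp_all add: mod_hom_zero_minus(3)[OF M.M.abelian_group_axioms M'.M.abelian_group_axioms f])
  qed
  show "(\<lambda>x. coset_rep M' N' (f x)) \<in> mod_hom R (quot_module M N) (quot_module M' N')"
    by (rule mod_homI)
      (auto simp: M.quot_module_simps[OF assms(3)] M'.quot_module_simps[OF assms(4)] *)
qed

section \<open>Complexes and their cohomology\<close>

context abelian_group
begin

lemma add_diff_diff: "\<lbrakk>x \<in> carrier G; y \<in> carrier G; z \<in> carrier G\<rbrakk> \<Longrightarrow> (x \<ominus> y) \<oplus> (y \<ominus> z) = x \<ominus> z"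
  by (simp add: a_minus_def a_ac r_neg1 r_neg2)

lemma minus_diff: "\<lbrakk>x \<in> carrier G; y \<in> carrier G\<rbrakk> \<Longrightarrow> \<ominus> (x \<ominus> y) = y \<ominus> x"
  by (simp add: a_minus_def minus_add minus_minus a_ac)

lemma diff_self [simp]: "x \<in> carrier G \<Longrightarrow> x \<ominus> x = \<zero>"
  by (simp add: a_minus_def r_neg)

lemma diff_zero [simp]: "x \<in> carrier G \<Longrightarrow> x \<ominus> \<zero> = x"
  by (simp add: a_minus_def)

lemma zero_diff [simp]: "x \<in> carrier G \<Longrightarrow> \<zero> \<ominus> x = \<ominus> x"
  by (simp add: a_minus_def)

lemma diff_eq_zero_iff: "\<lbrakk>x \<in> carrier G; y \<in> carrier G\<rbrakk> \<Longrightarrow> x \<ominus> y = \<zero> \<longleftrightarrow> x = y"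
  by (metis a_minus_def add.inv_closed add.inv_equality add.inv_inv r_neg)

lemma diff_add_eq: "\<lbrakk>x \<in> carrier G; y \<in> carrier G\<rbrakk> \<Longrightarrow> (x \<ominus> y) \<oplus> y = x"
  by (simp add: a_minus_def a_assoc l_neg)

lemma add_diff_eq: "\<lbrakk>x \<in> carrier G; y \<in> carrier G\<rbrakk> \<Longrightarrow> (x \<oplus> y) \<ominus> y = x"
  by (simp add: a_minus_def a_assoc r_neg)

lemma diff_diff_self: "\<lbrakk>x \<in> carrier G; y \<in> carrier G\<rbrakk> \<Longrightarrow> x \<ominus> (x \<ominus> y) = y"
  by (simp add: a_minus_def minus_add minus_minus r_neg2)

lemma add_diff_diff_eq:
  "\<lbrakk>x \<in> carrier G; y \<in> carrier G; z \<in> carrier G\<rbrakk> \<Longrightarrow> ((x \<oplus> y) \<ominus> z) \<ominus> y = x \<ominus> z"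
  using add_diff_eq[of "x \<ominus> z" y] by (simp add: a_minus_def a_ac)

lemma add_diff_add:
  "\<lbrakk>x \<in> carrier G; y \<in> carrier G; u \<in> carrier G; v \<in> carrier G\<rbrakk> \<Longrightarrow>
    (x \<oplus> y) \<ominus> (u \<oplus> v) = (x \<ominus> u) \<oplus> (y \<ominus> v)"
  by (simp add: a_minus_def a_ac minus_add)

end

section \<open>Cocycles, coboundaries and cohomology classes of a complex\<close>

locale cplx =
  fixes R :: "('a, 'r) ring_scheme" and C :: "('a, 'm) cochain"
  assumes bounded_complex: "bounded_complex R C"
begin

lemma fg_module_obj: "fg_module R (obj C i)"
  using bounded_complex by (simp add: bounded_complex_def)

lemma left_module_obj: "left_module R (obj C i)"
  using fg_module_obj by (simp add: fg_module_def)

lemma ring_R: "ring R"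
  using left_module_obj[of 0] by (simp add: left_module_def)

end

sublocale cplx \<subseteq> M: abelian_group "obj C i" for i
  using left_module_obj by (simp add: left_module_def)

context cplx
begin

lemma diff_hom: "diff C i \<in> mod_hom R (obj C i) (obj C (i + 1))"
  using bounded_complex by (simp add: bounded_complex_def)

text \<open>The degree is tied by an equation so that the rule also applies to
  \<open>diff C (i - 1) x\<close> in degree \<open>i\<close>.\<close>

lemma diff_closed [simp]: "j = i + 1 \<Longrightarrow> x \<in> carrier (obj C i) \<Longrightarrow> diff C i x \<in> carrier (obj C j)"
  using mod_homD(1)[OF diff_hom] by simp

lemma diff_add:
  "x \<in> carrier (obj C i) \<Longrightarrow> y \<in> carrier (obj C i) \<Longrightarrow>
    diff C i (x \<oplus>\<^bsub>obj C i\<^esub> y) = diff C i x \<oplus>\<^bsub>obj C (i + 1)\<^esub> diff C i y"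
  using mod_homD(2)[OF diff_hom] by simp

lemma diff_smult:
  "a \<in> carrier R \<Longrightarrow> x \<in> carrier (obj C i) \<Longrightarrow>
    diff C i (a \<odot>\<^bsub>obj C i\<^esub> x) = a \<odot>\<^bsub>obj C (i + 1)\<^esub> diff C i x"
  using mod_homD(3)[OF diff_hom] by simp

lemma diff_zero' [simp]: "diff C i \<zero>\<^bsub>obj C i\<^esub> = \<zero>\<^bsub>obj C (i + 1)\<^esub>"
  and diff_minus: "x \<in> carrier (obj C i) \<Longrightarrow> diff C i (\<ominus>\<^bsub>obj C i\<^esub> x) = \<ominus>\<^bsub>obj C (i + 1)\<^esub> diff C i x"
  and diff_diff: "x \<in> carrier (obj C i) \<Longrightarrow> y \<in> carrier (obj C i) \<Longrightarrow>
    diff C i (x \<ominus>\<^bsub>obj C i\<^esub> y) = diff C i x \<ominus>\<^bsub>obj C (i + 1)\<^esub> diff C i y"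
  using mod_hom_zero_minus[OF M.abelian_group_axioms M.abelian_group_axioms diff_hom] by simp_all

lemma dd [simp]: "j = i + 1 \<Longrightarrow> x \<in> carrier (obj C i) \<Longrightarrow> diff C j (diff C i x) = \<zero>\<^bsub>obj C (j + 1)\<^esub>"
  using bounded_complex by (simp add: bounded_complex_def add.commute[of 2])

lemma left_submodule_cocycles: "left_submodule R (obj C i) (cocycles C i)"
  using left_module.smult_zero[OF left_module_obj] left_module.smult_closed[OF left_module_obj]
  by (auto simp: left_submodule_def cocycles_def diff_add diff_smult)

lemma left_submodule_coboundaries: "left_submodule R (obj C i) (coboundaries C i)"
proof -
  interpret L: left_module R "obj C (i - 1)" by (rule left_module_obj)
  have *: "coboundaries C i \<subseteq> carrier (obj C i)" by (auto simp: coboundaries_def)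
  have "diff C (i - 1) ` carrier (obj C (i - 1)) \<subseteq> carrier (obj C i)" by auto
  moreover have "\<zero>\<^bsub>obj C i\<^esub> \<in> diff C (i - 1) ` carrier (obj C (i - 1))"
    using diff_zero'[of "i - 1"] by (intro image_eqI[of _ _ "\<zero>\<^bsub>obj C (i - 1)\<^esub>"]) auto
  moreover have "diff C (i - 1) x \<oplus>\<^bsub>obj C i\<^esub> diff C (i - 1) y \<in> diff C (i - 1) ` carrier (obj C (i - 1))"
    if "x \<in> carrier (obj C (i - 1))" "y \<in> carrier (obj C (i - 1))" for x y
    using diff_add[of x "i - 1" y] that by (intro image_eqI[of _ _ "x \<oplus>\<^bsub>obj C (i - 1)\<^esub> y"]) auto
  moreover have "a \<odot>\<^bsub>obj C i\<^esub> diff C (i - 1) x \<in> diff C (i - 1) ` carrier (obj C (i - 1))"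
    if "x \<in> carrier (obj C (i - 1))" "a \<in> carrier R" for x a
    using diff_smult[of a x "i - 1"] that by (intro image_eqI[of _ _ "a \<odot>\<^bsub>obj C (i - 1)\<^esub> x"]) auto
  ultimately show ?thesis unfolding left_submodule_def coboundaries_def by blast
qed

lemmas cocycleD = left_module.left_submoduleD[OF left_module_obj left_submodule_cocycles]
lemmas coboundaryD = left_module.left_submoduleD[OF left_module_obj left_submodule_coboundaries]

lemma coboundary_cocycle: "x \<in> coboundaries C i \<Longrightarrow> x \<in> cocycles C i"
  by (auto simp: coboundaries_def cocycles_def)

lemma coboundaryI: "j = i + 1 \<Longrightarrow> x \<in> carrier (obj C i) \<Longrightarrow> diff C i x \<in> coboundaries C j"
  by (auto simp: coboundaries_def)

lemma coboundaryE:
  assumes "x \<in> coboundaries C i"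
  obtains y where "y \<in> carrier (obj C (i - 1))" "x = diff C (i - 1) y"
  using assms by (auto simp: coboundaries_def)

text \<open>Coboundaries are added on the left to match the right cosets that form the factor
  group.\<close>

definition cls :: "int \<Rightarrow> 'm \<Rightarrow> 'm set" where
  "cls i x = (\<lambda>b. b \<oplus>\<^bsub>obj C i\<^esub> x) ` coboundaries C i"

lemma carrier_cohomology: "carrier (cohomology C i) = cls i ` cocycles C i"
  by (auto simp: cohomology_def carrier_FactGroup cls_def r_coset_def)

lemma cls_eq_iff:
  assumes "x \<in> cocycles C i" "y \<in> cocycles C i"
  shows "cls i x = cls i y \<longleftrightarrow> x \<ominus>\<^bsub>obj C i\<^esub> y \<in> coboundaries C i"
proof
  have xy [simp]: "x \<in> carrier (obj C i)" "y \<in> carrier (obj C i)" using assms cocycleD(1) by auto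
  assume "cls i x = cls i y"
  moreover have "x \<in> cls i x"
    unfolding cls_def using coboundaryD(2) by (intro image_eqI[of _ _ "\<zero>\<^bsub>obj C i\<^esub>"]) auto
  ultimately obtain b where b: "b \<in> coboundaries C i" "x = b \<oplus>\<^bsub>obj C i\<^esub> y" unfolding cls_def by auto
  then have "x \<ominus>\<^bsub>obj C i\<^esub> y = b" using coboundaryD(1)[OF b(1)] by (simp add: M.add_diff_eq)
  then show "x \<ominus>\<^bsub>obj C i\<^esub> y \<in> coboundaries C i" using b by simp
next
  have *: "cls i u \<subseteq> cls i v"
    if "u \<in> carrier (obj C i)" "v \<in> carrier (obj C i)" and uv: "u \<ominus>\<^bsub>obj C i\<^esub> v \<in> coboundaries C i" for u v
  proof
    fix z assume "z \<in> cls i u"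
    then obtain b where b: "b \<in> coboundaries C i" "z = b \<oplus>\<^bsub>obj C i\<^esub> u" by (auto simp: cls_def)
    then have "z = (b \<oplus>\<^bsub>obj C i\<^esub> (u \<ominus>\<^bsub>obj C i\<^esub> v)) \<oplus>\<^bsub>obj C i\<^esub> v"
      using that coboundaryD(1)[OF b(1)] by (simp add: M.a_assoc M.diff_add_eq)
    then show "z \<in> cls i v" using coboundaryD(3)[OF b(1) uv] by (auto simp: cls_def)
  qed
  have xy [simp]: "x \<in> carrier (obj C i)" "y \<in> carrier (obj C i)" using assms cocycleD(1) by auto
  assume a: "x \<ominus>\<^bsub>obj C i\<^esub> y \<in> coboundaries C i"
  then have "y \<ominus>\<^bsub>obj C i\<^esub> x \<in> coboundaries C i"
    using coboundaryD(5)[OF a] by (simp add: M.minus_diff)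
  then show "cls i x = cls i y" using * a by (intro equalityI) auto
qed

lemma mult_cohomology:
  assumes "x \<in> cocycles C i" "y \<in> cocycles C i"
  shows "cls i x \<otimes>\<^bsub>cohomology C i\<^esub> cls i y = cls i (x \<oplus>\<^bsub>obj C i\<^esub> y)"
proof -
  have xy [simp]: "x \<in> carrier (obj C i)" "y \<in> carrier (obj C i)" using assms cocycleD(1) by auto
  have "cls i x \<otimes>\<^bsub>cohomology C i\<^esub> cls i y = {u \<oplus>\<^bsub>obj C i\<^esub> v | u v. u \<in> cls i x \<and> v \<in> cls i y}"
    by (auto simp: cohomology_def set_mult_def)
  also have "\<dots> = cls i (x \<oplus>\<^bsub>obj C i\<^esub> y)"
  proof (intro equalityI subsetI)
    fix w assume "w \<in> {u \<oplus>\<^bsub>obj C i\<^esub> v | u v. u \<in> cls i x \<and> v \<in> cls i y}"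
    then obtain a b where ab: "a \<in> coboundaries C i" "b \<in> coboundaries C i"
      "w = (a \<oplus>\<^bsub>obj C i\<^esub> x) \<oplus>\<^bsub>obj C i\<^esub> (b \<oplus>\<^bsub>obj C i\<^esub> y)" by (auto simp: cls_def)
    then have "w = (a \<oplus>\<^bsub>obj C i\<^esub> b) \<oplus>\<^bsub>obj C i\<^esub> (x \<oplus>\<^bsub>obj C i\<^esub> y)"
      using coboundaryD(1) by (simp add: M.a_ac)
    then show "w \<in> cls i (x \<oplus>\<^bsub>obj C i\<^esub> y)" using coboundaryD(3)[OF ab(1,2)] by (auto simp: cls_def)
  next
    fix w assume "w \<in> cls i (x \<oplus>\<^bsub>obj C i\<^esub> y)"
    then obtain a where a: "a \<in> coboundaries C i" "w = a \<oplus>\<^bsub>obj C i\<^esub> (x \<oplus>\<^bsub>obj C i\<^esub> y)"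
      by (auto simp: cls_def)
    then have "w = (a \<oplus>\<^bsub>obj C i\<^esub> x) \<oplus>\<^bsub>obj C i\<^esub> (\<zero>\<^bsub>obj C i\<^esub> \<oplus>\<^bsub>obj C i\<^esub> y)"
      using coboundaryD(1) by (simp add: M.a_ac)
    then show "w \<in> {u \<oplus>\<^bsub>obj C i\<^esub> v | u v. u \<in> cls i x \<and> v \<in> cls i y}"
      using a coboundaryD(2) unfolding cls_def by blast
  qed
  finally show ?thesis .
qed

lemma one_cohomology: "\<one>\<^bsub>cohomology C i\<^esub> = cls i \<zero>\<^bsub>obj C i\<^esub>"
proof -
  have "cls i \<zero>\<^bsub>obj C i\<^esub> = (\<lambda>b. b) ` coboundaries C i"
    unfolding cls_def using coboundaryD(1) by (intro image_cong) auto
  then show ?thesis by (simp add: cohomology_def)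
qed

lemma group_cohomology: "group (cohomology C i)"
proof (rule groupI)
  fix c assume "c \<in> carrier (cohomology C i)"
  then obtain x where x: "x \<in> cocycles C i" "c = cls i x" by (auto simp: carrier_cohomology)
  have "cls i (\<ominus>\<^bsub>obj C i\<^esub> x) \<otimes>\<^bsub>cohomology C i\<^esub> c = \<one>\<^bsub>cohomology C i\<^esub>"
    using x cocycleD(5)[OF x(1)] cocycleD(1)[OF x(1)] by (simp add: mult_cohomology one_cohomology M.l_neg)
  then show "\<exists>y\<in>carrier (cohomology C i). y \<otimes>\<^bsub>cohomology C i\<^esub> c = \<one>\<^bsub>cohomology C i\<^esub>"
    using cocycleD(5)[OF x(1)] by (auto simp: carrier_cohomology)
qed (auto simp: carrier_cohomology mult_cohomology one_cohomology M.a_assoc cocycleD)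

text \<open>This removes cosets from the discussion: from here on, exactness in a degree is an
  inclusion of sets.\<close>

lemma trivial_cohomology_iff:
  "trivial_group (cohomology C i) \<longleftrightarrow> cocycles C i \<subseteq> coboundaries C i"
proof -
  have "x \<in> cocycles C i \<Longrightarrow> cls i x = cls i \<zero>\<^bsub>obj C i\<^esub> \<longleftrightarrow> x \<in> coboundaries C i" for x
    using cocycleD(1,2) by (simp add: cls_eq_iff)
  then show ?thesis
    using cocycleD(2) unfolding trivial_group_def by (auto simp: group_cohomology carrier_cohomology one_cohomology)
qed

end

subsection \<open>Chain maps\<close>

locale cmap = C: cplx R C + D: cplx R D
  for R :: "('a, 'r) ring_scheme" and C :: "('a, 'm) cochain" and D :: "('a, 'm) cochain" +
  fixes f :: "int \<Rightarrow> 'm \<Rightarrow> 'm"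
  assumes chain_map: "chain_map R C D f"
begin

lemma hom: "f i \<in> mod_hom R (obj C i) (obj D i)"
  using chain_map by (simp add: chain_map_def)

lemma closed [simp]: "x \<in> carrier (obj C i) \<Longrightarrow> f i x \<in> carrier (obj D i)"
  using mod_homD(1)[OF hom] by simp

lemma map_add:
  "x \<in> carrier (obj C i) \<Longrightarrow> y \<in> carrier (obj C i) \<Longrightarrow>
    f i (x \<oplus>\<^bsub>obj C i\<^esub> y) = f i x \<oplus>\<^bsub>obj D i\<^esub> f i y"
  using mod_homD(2)[OF hom] by simp

lemma map_zero [simp]: "f i \<zero>\<^bsub>obj C i\<^esub> = \<zero>\<^bsub>obj D i\<^esub>"
  and map_minus: "x \<in> carrier (obj C i) \<Longrightarrow> f i (\<ominus>\<^bsub>obj C i\<^esub> x) = \<ominus>\<^bsub>obj D i\<^esub> f i x"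
  and map_diff: "x \<in> carrier (obj C i) \<Longrightarrow> y \<in> carrier (obj C i) \<Longrightarrow>
    f i (x \<ominus>\<^bsub>obj C i\<^esub> y) = f i x \<ominus>\<^bsub>obj D i\<^esub> f i y"
  using mod_hom_zero_minus[OF C.M.abelian_group_axioms D.M.abelian_group_axioms hom] by simp_all

lemma map_d: "j = i + 1 \<Longrightarrow> x \<in> carrier (obj C i) \<Longrightarrow> f j (diff C i x) = diff D i (f i x)"
  using chain_map by (simp add: chain_map_def)

lemma map_cocycle: "x \<in> cocycles C i \<Longrightarrow> f i x \<in> cocycles D i"
  by (auto simp: cocycles_def map_d[symmetric])

lemma map_coboundary: "x \<in> coboundaries C i \<Longrightarrow> f i x \<in> coboundaries D i"
  by (auto elim!: C.coboundaryE simp: map_d intro!: D.coboundaryI)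

text \<open>The image of a class under \<open>f i\<close> need not be a whole class; adding all
  coboundaries of \<open>D\<close>, as \<open>cohomology_map\<close> does, fills it up.\<close>

lemma cohomology_map_cls:
  assumes "x \<in> cocycles C i"
  shows "cohomology_map D f i (C.cls i x) = D.cls i (f i x)"
proof -
  have [simp]: "x \<in> carrier (obj C i)" using assms C.cocycleD(1) by auto
  have "cohomology_map D f i (C.cls i x) =
    {b \<oplus>\<^bsub>obj D i\<^esub> f i (a \<oplus>\<^bsub>obj C i\<^esub> x) | a b. a \<in> coboundaries C i \<and> b \<in> coboundaries D i}"
    by (auto simp: cohomology_map_def C.cls_def set_add_def set_mult_def)
  also have "\<dots> = D.cls i (f i x)"
  proof (intro equalityI subsetI)
    fix z assume "z \<in> {b \<oplus>\<^bsub>obj D i\<^esub> f i (a \<oplus>\<^bsub>obj C i\<^esub> x) | a b. a \<in> coboundaries C i \<and> b \<in> coboundaries D i}"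
    then obtain a b where ab: "a \<in> coboundaries C i" "b \<in> coboundaries D i"
      "z = b \<oplus>\<^bsub>obj D i\<^esub> f i (a \<oplus>\<^bsub>obj C i\<^esub> x)" by blast
    then have "z = (b \<oplus>\<^bsub>obj D i\<^esub> f i a) \<oplus>\<^bsub>obj D i\<^esub> f i x"
      using C.coboundaryD(1)[OF ab(1)] D.coboundaryD(1)[OF ab(2)] by (simp add: map_add D.M.a_assoc)
    then show "z \<in> D.cls i (f i x)"
      using D.coboundaryD(3)[OF ab(2) map_coboundary[OF ab(1)]] by (auto simp: D.cls_def)
  next
    fix z assume "z \<in> D.cls i (f i x)"
    then obtain b where "b \<in> coboundaries D i" "z = b \<oplus>\<^bsub>obj D i\<^esub> f i x"
      unfolding D.cls_def by (elim imageE)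
    then show "z \<in> {b \<oplus>\<^bsub>obj D i\<^esub> f i (a \<oplus>\<^bsub>obj C i\<^esub> x) | a b. a \<in> coboundaries C i \<and> b \<in> coboundaries D i}"
      using C.coboundaryD(2) by (intro CollectI exI[of _ "\<zero>\<^bsub>obj C i\<^esub>"] exI[of _ b]) simp
  qed
  finally show ?thesis .
qed

end

text \<open>Injectivity on cohomology, and below it surjectivity, are kept apart and indexed by
  degree because they are needed in different degrees: pullbacks use surjectivity one degree below
  injectivity, and truncation compares cohomology only from some degree on.\<close>

definition hinj :: "('a, 'm) cochain \<Rightarrow> ('a, 'm) cochain \<Rightarrow> (int \<Rightarrow> 'm \<Rightarrow> 'm) \<Rightarrow> int \<Rightarrow> bool" where
  "hinj C D f i \<longleftrightarrow> (\<forall>x\<in>cocycles C i. f i x \<in> coboundaries D i \<longrightarrow> x \<in> coboundaries C i)"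

definition hsurj :: "('a, 'm) cochain \<Rightarrow> ('a, 'm) cochain \<Rightarrow> (int \<Rightarrow> 'm \<Rightarrow> 'm) \<Rightarrow> int \<Rightarrow> bool" where
  "hsurj C D f i \<longleftrightarrow> (\<forall>y\<in>cocycles D i. \<exists>x\<in>cocycles C i. y \<ominus>\<^bsub>obj D i\<^esub> f i x \<in> coboundaries D i)"

lemma (in cmap) cohomology_iso_iff:
  "cohomology_map D f i \<in> iso (cohomology C i) (cohomology D i) \<longleftrightarrow> hinj C D f i \<and> hsurj C D f i"
proof -
  have "cohomology_map D f i \<in> hom (cohomology C i) (cohomology D i)"
    by (intro homI) (auto simp: C.carrier_cohomology D.carrier_cohomology C.mult_cohomology
      D.mult_cohomology cohomology_map_cls map_cocycle C.cocycleD map_add)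
  moreover have "inj_on (cohomology_map D f i) (carrier (cohomology C i)) \<longleftrightarrow> hinj C D f i"
  proof
    assume inj: "inj_on (cohomology_map D f i) (carrier (cohomology C i))"
    show "hinj C D f i"
      unfolding hinj_def
    proof (intro ballI impI)
      fix x assume x: "x \<in> cocycles C i" "f i x \<in> coboundaries D i"
      have xc: "x \<in> carrier (obj C i)" by (rule C.cocycleD(1)[OF x(1)])
      have "D.cls i (f i x) = D.cls i (f i \<zero>\<^bsub>obj C i\<^esub>)"
        using x xc D.cocycleD(2) by (simp add: D.cls_eq_iff map_cocycle)
      then have "cohomology_map D f i (C.cls i x) = cohomology_map D f i (C.cls i \<zero>\<^bsub>obj C i\<^esub>)"
        using x C.cocycleD(2) by (simp add: cohomology_map_cls)
      then have "C.cls i x = C.cls i \<zero>\<^bsub>obj C i\<^esub>"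
        by (rule inj_onD[OF inj]) (simp_all add: C.carrier_cohomology x(1) C.cocycleD(2))
      then show "x \<in> coboundaries C i" using x xc C.cocycleD(2) by (simp add: C.cls_eq_iff)
    qed
  next
    assume h: "hinj C D f i"
    show "inj_on (cohomology_map D f i) (carrier (cohomology C i))"
    proof (rule inj_onI, unfold C.carrier_cohomology, elim imageE)
      fix c c' x y assume eq: "cohomology_map D f i c = cohomology_map D f i c'"
        and c: "c = C.cls i x" "c' = C.cls i y" and xy: "x \<in> cocycles C i" "y \<in> cocycles C i"
      have "D.cls i (f i x) = D.cls i (f i y)" using eq xy c by (simp add: cohomology_map_cls)
      then have "f i (x \<ominus>\<^bsub>obj C i\<^esub> y) \<in> coboundaries D i"
        using xy C.cocycleD(1) by (simp add: D.cls_eq_iff map_cocycle map_diff)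
      then have "x \<ominus>\<^bsub>obj C i\<^esub> y \<in> coboundaries C i"
        using h C.cocycleD(6)[OF xy] by (auto simp: hinj_def)
      then show "c = c'" using xy c by (simp add: C.cls_eq_iff)
    qed
  qed
  moreover have "cohomology_map D f i ` carrier (cohomology C i) = carrier (cohomology D i) \<longleftrightarrow> hsurj C D f i"
  proof -
    have "cohomology_map D f i ` carrier (cohomology C i) = (\<lambda>x. D.cls i (f i x)) ` cocycles C i"
      unfolding C.carrier_cohomology image_image by (intro image_cong) (auto simp: cohomology_map_cls)
    moreover have "(\<lambda>x. D.cls i (f i x)) ` cocycles C i = D.cls i ` cocycles D i \<longleftrightarrow>
      (\<forall>y\<in>cocycles D i. \<exists>x\<in>cocycles C i. D.cls i y = D.cls i (f i x))"
    proof
      assume "(\<lambda>x. D.cls i (f i x)) ` cocycles C i = D.cls i ` cocycles D i"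
      then have "D.cls i y \<in> (\<lambda>x. D.cls i (f i x)) ` cocycles C i" if "y \<in> cocycles D i" for y
        using that by blast
      then show "\<forall>y\<in>cocycles D i. \<exists>x\<in>cocycles C i. D.cls i y = D.cls i (f i x)"
        unfolding image_iff by blast
    qed (use map_cocycle in \<open>auto simp: image_iff\<close>)
    moreover have "\<dots> \<longleftrightarrow> hsurj C D f i"
      unfolding hsurj_def by (intro ball_cong bex_cong refl) (simp add: D.cls_eq_iff map_cocycle)
    ultimately show ?thesis by (simp add: D.carrier_cohomology)
  qed
  ultimately show ?thesis by (auto simp: iso_def bij_betw_def)
qed

lemma quasi_iso_iff:
  assumes "bounded_complex R C" "bounded_complex R D"
  shows "quasi_iso R C D f \<longleftrightarrow> chain_map R C D f \<and> (\<forall>i. hinj C D f i \<and> hsurj C D f i)"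
  using cmap.cohomology_iso_iff[of R C D f] assms
  by (auto simp: quasi_iso_def cmap_def cmap_axioms_def cplx_def)

lemma chain_map_id: "chain_map R C C (\<lambda>i x. x)"
  by (auto simp: chain_map_def mod_hom_def)

lemma chain_map_comp:
  assumes "chain_map R C D f" "chain_map R D E g"
  shows "chain_map R C E (\<lambda>i. g i \<circ> f i)"
proof -
  have "f i x \<in> carrier (obj D i)" if "x \<in> carrier (obj C i)" for i x
    using assms(1) that by (auto simp: chain_map_def intro: mod_homD(1))
  then show ?thesis using assms by (auto simp: chain_map_def comp_def intro: mod_hom_comp)
qed

lemma chain_map_zero:
  assumes "bounded_complex R D"
  shows "chain_map R C D (\<lambda>i x. \<zero>\<^bsub>obj D i\<^esub>)"
proof -
  interpret D: cplx R D using assms by (simp add: cplx_def)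
  show ?thesis
    using left_module.smult_zero[OF D.left_module_obj] by (auto simp: chain_map_def intro!: mod_homI)
qed

lemma cmapI: "bounded_complex R C \<Longrightarrow> bounded_complex R D \<Longrightarrow> chain_map R C D f \<Longrightarrow> cmap R C D f"
  by (simp add: cmap_def cmap_axioms_def cplx_def)

text \<open>Two composable chain maps. The lemmas of this locale are the two-out-of-three property,
  split by degree and into its injective and surjective halves.\<close>

locale cmap2 = f: cmap R C D f + g: cmap R D E g
  for R :: "('a, 'r) ring_scheme" and C D E :: "('a, 'm) cochain" and f g
begin

lemma hinj_comp: "hinj C D f i \<Longrightarrow> hinj D E g i \<Longrightarrow> hinj C E (\<lambda>i. g i \<circ> f i) i"
  using f.map_cocycle by (auto simp: hinj_def)

lemma hinj_right: "hinj C E (\<lambda>i. g i \<circ> f i) i \<Longrightarrow> hinj C D f i"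
  using g.map_coboundary by (auto simp: hinj_def)

lemma hsurj_left: "hsurj C E (\<lambda>i. g i \<circ> f i) i \<Longrightarrow> hsurj D E g i"
  using f.map_cocycle unfolding hsurj_def comp_def by blast

lemma hsurj_comp:
  assumes "hsurj C D f i" "hsurj D E g i"
  shows "hsurj C E (\<lambda>i. g i \<circ> f i) i"
  unfolding hsurj_def
proof
  fix y assume y: "y \<in> cocycles E i"
  obtain z where z: "z \<in> cocycles D i" "y \<ominus>\<^bsub>obj E i\<^esub> g i z \<in> coboundaries E i"
    using assms(2) y by (auto simp: hsurj_def)
  obtain x where x: "x \<in> cocycles C i" "z \<ominus>\<^bsub>obj D i\<^esub> f i x \<in> coboundaries D i"
    using assms(1) z by (auto simp: hsurj_def)
  have [simp]: "y \<in> carrier (obj E i)" "z \<in> carrier (obj D i)" "x \<in> carrier (obj C i)"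
    using x y z g.D.cocycleD(1) f.D.cocycleD(1) f.C.cocycleD(1) by auto
  have "(y \<ominus>\<^bsub>obj E i\<^esub> g i z) \<oplus>\<^bsub>obj E i\<^esub> g i (z \<ominus>\<^bsub>obj D i\<^esub> f i x) \<in> coboundaries E i"
    using z(2) g.map_coboundary[OF x(2)] by (rule g.D.coboundaryD(3))
  then have "y \<ominus>\<^bsub>obj E i\<^esub> (g i \<circ> f i) x \<in> coboundaries E i"
    by (simp add: g.map_diff g.D.M.add_diff_diff)
  then show "\<exists>x\<in>cocycles C i. y \<ominus>\<^bsub>obj E i\<^esub> (g i \<circ> f i) x \<in> coboundaries E i" using x by blast
qed

lemma hsurj_right:
  assumes "hsurj C E (\<lambda>i. g i \<circ> f i) i" "hinj D E g i"
  shows "hsurj C D f i"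
  unfolding hsurj_def
proof
  fix z assume z: "z \<in> cocycles D i"
  obtain x where x: "x \<in> cocycles C i" "g i z \<ominus>\<^bsub>obj E i\<^esub> g i (f i x) \<in> coboundaries E i"
    using assms(1) g.map_cocycle[OF z] by (auto simp: hsurj_def)
  have [simp]: "z \<in> carrier (obj D i)" "x \<in> carrier (obj C i)"
    using x z f.D.cocycleD(1) f.C.cocycleD(1) by auto
  have "g i (z \<ominus>\<^bsub>obj D i\<^esub> f i x) \<in> coboundaries E i" using x by (simp add: g.map_diff)
  then have "z \<ominus>\<^bsub>obj D i\<^esub> f i x \<in> coboundaries D i"
    using assms(2) f.D.cocycleD(6)[OF z f.map_cocycle[OF x(1)]] by (auto simp: hinj_def)
  then show "\<exists>x\<in>cocycles C i. z \<ominus>\<^bsub>obj D i\<^esub> f i x \<in> coboundaries D i" using x by blast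
qed

lemma hinj_left:
  assumes "hinj C E (\<lambda>i. g i \<circ> f i) i" "hsurj C D f i"
  shows "hinj D E g i"
  unfolding hinj_def
proof (intro ballI impI)
  fix z assume z: "z \<in> cocycles D i" "g i z \<in> coboundaries E i"
  obtain x where x: "x \<in> cocycles C i" "z \<ominus>\<^bsub>obj D i\<^esub> f i x \<in> coboundaries D i"
    using assms(2) z by (auto simp: hsurj_def)
  have [simp]: "z \<in> carrier (obj D i)" "x \<in> carrier (obj C i)"
    using x z f.D.cocycleD(1) f.C.cocycleD(1) by auto
  have "g i z \<ominus>\<^bsub>obj E i\<^esub> g i (z \<ominus>\<^bsub>obj D i\<^esub> f i x) \<in> coboundaries E i"
    using z(2) g.map_coboundary[OF x(2)] by (rule g.D.coboundaryD(6))
  moreover have "g i z \<ominus>\<^bsub>obj E i\<^esub> g i (z \<ominus>\<^bsub>obj D i\<^esub> f i x) = g i (f i x)"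
    by (simp add: g.map_diff g.D.M.diff_diff_self)
  ultimately have "x \<in> coboundaries C i" using assms(1) x by (auto simp: hinj_def)
  then have "(z \<ominus>\<^bsub>obj D i\<^esub> f i x) \<oplus>\<^bsub>obj D i\<^esub> f i x \<in> coboundaries D i"
    using x(2) f.map_coboundary by (intro f.D.coboundaryD(3))
  then show "z \<in> coboundaries D i" by (simp add: f.D.M.diff_add_eq)
qed

end

subsection \<open>Homotopies\<close>

lemma mod_hom_plus:
  assumes "left_module R N" "f \<in> mod_hom R M N" "g \<in> mod_hom R M N"
  shows "(\<lambda>x. f x \<oplus>\<^bsub>N\<^esub> g x) \<in> mod_hom R M N"
proof -
  interpret N: left_module R N by fact
  show ?thesis
    by (rule mod_homI) (simp_all add: mod_homD[OF assms(2)] mod_homD[OF assms(3)] N.M.a_ac N.smult_r_distr)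
qed

lemma mod_hom_uminus:
  assumes "left_module R N" "f \<in> mod_hom R M N"
  shows "(\<lambda>x. \<ominus>\<^bsub>N\<^esub> f x) \<in> mod_hom R M N"
proof -
  interpret N: left_module R N by fact
  show ?thesis
    by (rule mod_homI) (simp_all add: mod_homD[OF assms(2)] N.M.minus_add N.smult_minus)
qed

lemma homotopicI:
  assumes "\<And>i. h i \<in> mod_hom R (obj C i) (obj D (i - 1))"
    and "\<And>i x. x \<in> carrier (obj C i) \<Longrightarrow>
      f i x \<ominus>\<^bsub>obj D i\<^esub> g i x = diff D (i - 1) (h i x) \<oplus>\<^bsub>obj D i\<^esub> h (i + 1) (diff C i x)"
  shows "homotopic R C D f g"
  using assms by (auto simp: homotopic_def)

lemma homotopicE:
  assumes "homotopic R C D f g"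
  obtains h where "\<And>i. h i \<in> mod_hom R (obj C i) (obj D (i - 1))"
    and "\<And>i x. x \<in> carrier (obj C i) \<Longrightarrow>
      f i x \<ominus>\<^bsub>obj D i\<^esub> g i x = diff D (i - 1) (h i x) \<oplus>\<^bsub>obj D i\<^esub> h (i + 1) (diff C i x)"
  using assms unfolding homotopic_def by blast

lemma homotopic_refl:
  assumes "cmap R C D f"
  shows "homotopic R C D f f"
proof -
  interpret f: cmap R C D f by fact
  show ?thesis
  proof (rule homotopicI[where h = "\<lambda>i x. \<zero>\<^bsub>obj D (i - 1)\<^esub>"])
    show "(\<lambda>x. \<zero>\<^bsub>obj D (i - 1)\<^esub>) \<in> mod_hom R (obj C i) (obj D (i - 1))" for i
      using left_module.smult_zero[OF f.D.left_module_obj] by (auto intro!: mod_homI)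
    show "f i x \<ominus>\<^bsub>obj D i\<^esub> f i x = diff D (i - 1) \<zero>\<^bsub>obj D (i - 1)\<^esub> \<oplus>\<^bsub>obj D i\<^esub> \<zero>\<^bsub>obj D (i + 1 - 1)\<^esub>"
      if "x \<in> carrier (obj C i)" for i x
      using that f.D.diff_zero'[of "i - 1"] by simp
  qed
qed

lemma homotopic_trans:
  assumes "cmap R C D f" "cmap R C D g" "cmap R C D k" "homotopic R C D f g" "homotopic R C D g k"
  shows "homotopic R C D f k"
proof -
  interpret f: cmap R C D f by fact
  interpret g: cmap R C D g by fact
  interpret k: cmap R C D k by fact
  obtain h where h: "\<And>i. h i \<in> mod_hom R (obj C i) (obj D (i - 1))"
    "\<And>i x. x \<in> carrier (obj C i) \<Longrightarrow>
      f i x \<ominus>\<^bsub>obj D i\<^esub> g i x = diff D (i - 1) (h i x) \<oplus>\<^bsub>obj D i\<^esub> h (i + 1) (diff C i x)"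
    using homotopicE[OF assms(4)] by blast
  obtain l where l: "\<And>i. l i \<in> mod_hom R (obj C i) (obj D (i - 1))"
    "\<And>i x. x \<in> carrier (obj C i) \<Longrightarrow>
      g i x \<ominus>\<^bsub>obj D i\<^esub> k i x = diff D (i - 1) (l i x) \<oplus>\<^bsub>obj D i\<^esub> l (i + 1) (diff C i x)"
    using homotopicE[OF assms(5)] by blast
  note [simp] = mod_homD(1)[OF h(1)] mod_homD(1)[OF l(1)]
  have cl: "x \<in> carrier (obj C (i + 1)) \<Longrightarrow> h (i + 1) x \<in> carrier (obj D i)"
    "x \<in> carrier (obj C (i + 1)) \<Longrightarrow> l (i + 1) x \<in> carrier (obj D i)" for x i
    using mod_homD(1)[OF h(1), of x "i + 1"] mod_homD(1)[OF l(1), of x "i + 1"] by simp_all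
  show ?thesis
  proof (rule homotopicI[where h = "\<lambda>i x. h i x \<oplus>\<^bsub>obj D (i - 1)\<^esub> l i x"])
    show "(\<lambda>x. h i x \<oplus>\<^bsub>obj D (i - 1)\<^esub> l i x) \<in> mod_hom R (obj C i) (obj D (i - 1))" for i
      by (rule mod_hom_plus[OF f.D.left_module_obj h(1) l(1)])
    show "f i x \<ominus>\<^bsub>obj D i\<^esub> k i x = diff D (i - 1) (h i x \<oplus>\<^bsub>obj D (i - 1)\<^esub> l i x) \<oplus>\<^bsub>obj D i\<^esub>
        (h (i + 1) (diff C i x) \<oplus>\<^bsub>obj D (i + 1 - 1)\<^esub> l (i + 1) (diff C i x))"
      if x: "x \<in> carrier (obj C i)" for i x
    proof -
      have "f i x \<ominus>\<^bsub>obj D i\<^esub> k i x = (f i x \<ominus>\<^bsub>obj D i\<^esub> g i x) \<oplus>\<^bsub>obj D i\<^esub> (g i x \<ominus>\<^bsub>obj D i\<^esub> k i x)"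
        using x by (simp add: f.D.M.add_diff_diff)
      then show ?thesis
        using x f.D.diff_add[of "h i x" "i - 1" "l i x"] by (simp add: h(2) l(2) f.D.M.a_ac cl)
    qed
  qed
qed

lemma homotopic_sym:
  assumes "cmap R C D f" "cmap R C D g" "homotopic R C D f g"
  shows "homotopic R C D g f"
proof -
  interpret f: cmap R C D f by fact
  interpret g: cmap R C D g by fact
  obtain h where h: "\<And>i. h i \<in> mod_hom R (obj C i) (obj D (i - 1))"
    "\<And>i x. x \<in> carrier (obj C i) \<Longrightarrow>
      f i x \<ominus>\<^bsub>obj D i\<^esub> g i x = diff D (i - 1) (h i x) \<oplus>\<^bsub>obj D i\<^esub> h (i + 1) (diff C i x)"
    using homotopicE[OF assms(3)] by blast
  note [simp] = mod_homD(1)[OF h(1)]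
  have cl: "x \<in> carrier (obj C (i + 1)) \<Longrightarrow> h (i + 1) x \<in> carrier (obj D i)" for x i
    using mod_homD(1)[OF h(1), of x "i + 1"] by simp
  show ?thesis
  proof (rule homotopicI[where h = "\<lambda>i x. \<ominus>\<^bsub>obj D (i - 1)\<^esub> h i x"])
    show "(\<lambda>x. \<ominus>\<^bsub>obj D (i - 1)\<^esub> h i x) \<in> mod_hom R (obj C i) (obj D (i - 1))" for i
      by (rule mod_hom_uminus[OF f.D.left_module_obj h(1)])
    show "g i x \<ominus>\<^bsub>obj D i\<^esub> f i x = diff D (i - 1) (\<ominus>\<^bsub>obj D (i - 1)\<^esub> h i x) \<oplus>\<^bsub>obj D i\<^esub>
        (\<ominus>\<^bsub>obj D (i + 1 - 1)\<^esub> h (i + 1) (diff C i x))"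
      if x: "x \<in> carrier (obj C i)" for i x
    proof -
      have "g i x \<ominus>\<^bsub>obj D i\<^esub> f i x = \<ominus>\<^bsub>obj D i\<^esub> (f i x \<ominus>\<^bsub>obj D i\<^esub> g i x)"
        using x by (simp add: f.D.M.minus_diff)
      then show ?thesis
        using x f.D.diff_minus[of "h i x" "i - 1"] by (simp add: h(2) f.D.M.minus_add cl)
    qed
  qed
qed

lemma homotopic_comp_right:
  assumes "cmap R W C u" "homotopic R C D f g"
  shows "homotopic R W D (\<lambda>i. f i \<circ> u i) (\<lambda>i. g i \<circ> u i)"
proof -
  interpret u: cmap R W C u by fact
  obtain h where h: "\<And>i. h i \<in> mod_hom R (obj C i) (obj D (i - 1))"
    "\<And>i x. x \<in> carrier (obj C i) \<Longrightarrow>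
      f i x \<ominus>\<^bsub>obj D i\<^esub> g i x = diff D (i - 1) (h i x) \<oplus>\<^bsub>obj D i\<^esub> h (i + 1) (diff C i x)"
    using homotopicE[OF assms(2)] by blast
  show ?thesis
    by (rule homotopicI[where h = "\<lambda>i x. h i (u i x)"])
      (auto intro: mod_hom_comp[OF u.hom h(1)] simp: h(2) u.map_d)
qed

lemma homotopic_comp_left:
  assumes "cmap R D E v" "cmap R C D f" "cmap R C D g" "homotopic R C D f g"
  shows "homotopic R C E (\<lambda>i. v i \<circ> f i) (\<lambda>i. v i \<circ> g i)"
proof -
  interpret v: cmap R D E v by fact
  interpret f: cmap R C D f by fact
  interpret g: cmap R C D g by fact
  obtain h where h: "\<And>i. h i \<in> mod_hom R (obj C i) (obj D (i - 1))"
    "\<And>i x. x \<in> carrier (obj C i) \<Longrightarrow>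
      f i x \<ominus>\<^bsub>obj D i\<^esub> g i x = diff D (i - 1) (h i x) \<oplus>\<^bsub>obj D i\<^esub> h (i + 1) (diff C i x)"
    using homotopicE[OF assms(4)] by blast
  note [simp] = mod_homD(1)[OF h(1)]
  have cl: "x \<in> carrier (obj C (i + 1)) \<Longrightarrow> h (i + 1) x \<in> carrier (obj D i)" for x i
    using mod_homD(1)[OF h(1), of x "i + 1"] by simp
  show ?thesis
  proof (rule homotopicI[where h = "\<lambda>i x. v (i - 1) (h i x)"])
    show "(\<lambda>x. v (i - 1) (h i x)) \<in> mod_hom R (obj C i) (obj E (i - 1))" for i
      by (rule mod_hom_comp[OF h(1) v.hom])
    show "(v i \<circ> f i) x \<ominus>\<^bsub>obj E i\<^esub> (v i \<circ> g i) x =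
        diff E (i - 1) (v (i - 1) (h i x)) \<oplus>\<^bsub>obj E i\<^esub> v (i + 1 - 1) (h (i + 1) (diff C i x))"
      if x: "x \<in> carrier (obj C i)" for i x
    proof -
      have "(v i \<circ> f i) x \<ominus>\<^bsub>obj E i\<^esub> (v i \<circ> g i) x = v i (f i x \<ominus>\<^bsub>obj D i\<^esub> g i x)"
        using x by (simp add: v.map_diff)
      then show ?thesis
        using x v.map_d[of i "i - 1" "h i x"] by (simp add: h(2) v.map_add cl)
    qed
  qed
qed

text \<open>On a cocycle the summand \<open>h (i + 1) (diff C i x)\<close> vanishes, so homotopic
  maps agree on cohomology.\<close>

lemma homotopic_coboundary:
  assumes "cmap R C D f" "cmap R C D g" "homotopic R C D f g" "x \<in> cocycles C i"
  shows "f i x \<ominus>\<^bsub>obj D i\<^esub> g i x \<in> coboundaries D i"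
proof -
  interpret f: cmap R C D f by fact
  obtain h where h: "\<And>i. h i \<in> mod_hom R (obj C i) (obj D (i - 1))"
    "\<And>i x. x \<in> carrier (obj C i) \<Longrightarrow>
      f i x \<ominus>\<^bsub>obj D i\<^esub> g i x = diff D (i - 1) (h i x) \<oplus>\<^bsub>obj D i\<^esub> h (i + 1) (diff C i x)"
    using homotopicE[OF assms(3)] by blast
  have x: "x \<in> carrier (obj C i)" "diff C i x = \<zero>\<^bsub>obj C (i + 1)\<^esub>" using assms(4) by (auto simp: cocycles_def)
  have "h (i + 1) \<zero>\<^bsub>obj C (i + 1)\<^esub> = \<zero>\<^bsub>obj D i\<^esub>"
    using mod_hom_zero_minus(1)[OF f.C.M.abelian_group_axioms f.D.M.abelian_group_axioms h(1)[of "i + 1"]] by simp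
  then have "f i x \<ominus>\<^bsub>obj D i\<^esub> g i x = diff D (i - 1) (h i x)"
    using x h(2) mod_homD(1)[OF h(1)] by simp
  then show ?thesis using x mod_homD(1)[OF h(1)] by (auto intro: f.D.coboundaryI)
qed

lemma homotopic_hinj:
  assumes fg: "cmap R C D f" "cmap R C D g" "homotopic R C D f g" and "hinj C D f i"
  shows "hinj C D g i"
  unfolding hinj_def
proof (intro ballI impI)
  interpret f: cmap R C D f by fact
  interpret g: cmap R C D g by fact
  fix x assume x: "x \<in> cocycles C i" "g i x \<in> coboundaries D i"
  have [simp]: "x \<in> carrier (obj C i)" by (rule f.C.cocycleD(1)[OF x(1)])
  have "(f i x \<ominus>\<^bsub>obj D i\<^esub> g i x) \<oplus>\<^bsub>obj D i\<^esub> g i x \<in> coboundaries D i"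
    by (rule f.D.coboundaryD(3)[OF homotopic_coboundary[OF fg x(1)] x(2)])
  then have "f i x \<in> coboundaries D i" by (simp add: f.D.M.diff_add_eq)
  then show "x \<in> coboundaries C i" using assms(4) x(1) by (auto simp: hinj_def)
qed

lemma homotopic_hsurj:
  assumes fg: "cmap R C D f" "cmap R C D g" "homotopic R C D f g" and "hsurj C D f i"
  shows "hsurj C D g i"
  unfolding hsurj_def
proof
  interpret f: cmap R C D f by fact
  interpret g: cmap R C D g by fact
  fix y assume y: "y \<in> cocycles D i"
  obtain x where x: "x \<in> cocycles C i" "y \<ominus>\<^bsub>obj D i\<^esub> f i x \<in> coboundaries D i"
    using assms(4) y unfolding hsurj_def by blast
  have [simp]: "x \<in> carrier (obj C i)" "y \<in> carrier (obj D i)"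
    using f.C.cocycleD(1)[OF x(1)] f.D.cocycleD(1)[OF y] .
  have "(y \<ominus>\<^bsub>obj D i\<^esub> f i x) \<oplus>\<^bsub>obj D i\<^esub> (f i x \<ominus>\<^bsub>obj D i\<^esub> g i x) \<in> coboundaries D i"
    by (rule f.D.coboundaryD(3)[OF x(2) homotopic_coboundary[OF fg x(1)]])
  then have "y \<ominus>\<^bsub>obj D i\<^esub> g i x \<in> coboundaries D i" by (simp add: f.D.M.add_diff_diff)
  then show "\<exists>x\<in>cocycles C i. y \<ominus>\<^bsub>obj D i\<^esub> g i x \<in> coboundaries D i" using x(1) by blast
qed

subsection \<open>The zero complex\<close>

definition zero_complex :: "('a, 'm) cochain" where
  "zero_complex = \<lparr>obj = \<lambda>_. zero_module, diff = \<lambda>_ _. undefined\<rparr>"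

lemma zero_complex_simps [simp]: "obj zero_complex i = zero_module" "diff zero_complex i x = undefined"
  by (simp_all add: zero_complex_def)

lemma bounded_complex_zero: "ring R \<Longrightarrow> bounded_complex R zero_complex"
  using fg_module_zero by (auto simp: bounded_complex_def intro!: mod_homI)

lemma zero_complex_exact: "cocycles zero_complex i \<subseteq> coboundaries zero_complex i"
  by (auto simp: cocycles_def coboundaries_def)

subsection \<open>Homotopy pullbacks\<close>

text \<open>The homotopy pullback of \<open>E \<rightarrow> C \<leftarrow> E'\<close> consists of triples \<open>(x, y, c)\<close> where \<open>c\<close> records a
  homotopy between the images of \<open>x\<close> and \<open>y\<close>; for \<open>E' = 0\<close> it is the cocone of \<open>E \<rightarrow> C\<close>.\<close>

definition hpullback :: "('a, nat \<Rightarrow> 'b) cochain \<Rightarrow> (int \<Rightarrow> (nat \<Rightarrow> 'b) \<Rightarrow> (nat \<Rightarrow> 'b)) \<Rightarrow>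
    ('a, nat \<Rightarrow> 'b) cochain \<Rightarrow> (int \<Rightarrow> (nat \<Rightarrow> 'b) \<Rightarrow> (nat \<Rightarrow> 'b)) \<Rightarrow> ('a, nat \<Rightarrow> 'b) cochain \<Rightarrow>
    ('a, nat \<Rightarrow> 'b) cochain" where
  "hpullback E s E' s' C = \<lparr>
     obj = (\<lambda>i. prod_module (obj E i) (prod_module (obj E' i) (obj C (i - 1)))),
     diff = (\<lambda>i w. fpair (diff E i (ffst w)) (fpair (diff E' i (ffst (fsnd w)))
       ((s i (ffst w) \<ominus>\<^bsub>obj C i\<^esub> s' i (ffst (fsnd w))) \<ominus>\<^bsub>obj C i\<^esub> diff C (i - 1) (fsnd (fsnd w)))))\<rparr>"

lemma hpullback_simps [simp]:
  "obj (hpullback E s E' s' C) i = prod_module (obj E i) (prod_module (obj E' i) (obj C (i - 1)))"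
  "diff (hpullback E s E' s' C) i w = fpair (diff E i (ffst w)) (fpair (diff E' i (ffst (fsnd w)))
       ((s i (ffst w) \<ominus>\<^bsub>obj C i\<^esub> s' i (ffst (fsnd w))) \<ominus>\<^bsub>obj C i\<^esub> diff C (i - 1) (fsnd (fsnd w))))"
  by (simp_all add: hpullback_def)

locale hpb = s: cmap R E C s + s': cmap R E' C s'
  for R :: "('a, 'r) ring_scheme" and E E' C :: "('a, nat \<Rightarrow> 'b) cochain" and s s'
begin

abbreviation W where "W \<equiv> hpullback E s E' s' C"

lemma bounded_complex_hpullback: "bounded_complex R W"
  unfolding bounded_complex_def
proof (intro conjI allI ballI)
  show "fg_module R (obj W i)" for i
    by (simp add: fg_module_prod s.C.fg_module_obj s'.C.fg_module_obj s.D.fg_module_obj)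
  have d: "diff C (i - 1) c \<in> carrier (obj C i)" if "c \<in> carrier (obj C (i - 1))" for i c
    using that by simp
  have smult: "a \<odot>\<^bsub>obj C i\<^esub> x \<ominus>\<^bsub>obj C i\<^esub> a \<odot>\<^bsub>obj C i\<^esub> y = a \<odot>\<^bsub>obj C i\<^esub> (x \<ominus>\<^bsub>obj C i\<^esub> y)"
    if "x \<in> carrier (obj C i)" "y \<in> carrier (obj C i)" "a \<in> carrier R" for i x y a
  proof -
    interpret L: left_module R "obj C i" by (rule s.D.left_module_obj)
    show ?thesis using that by (simp add: a_minus_def L.smult_r_distr L.smult_minus)
  qed
  show "diff W i \<in> mod_hom R (obj W i) (obj W (i + 1))" for i
  proof (rule mod_homI)
    fix a w assume a: "a \<in> carrier R" and w: "w \<in> carrier (obj W i)"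
    show "diff W i (a \<odot>\<^bsub>obj W i\<^esub> w) = a \<odot>\<^bsub>obj W (i + 1)\<^esub> diff W i w"
      using a w s.D.diff_smult[of a "fsnd (fsnd w)" "i - 1"] mod_homD(3)[OF s.hom] mod_homD(3)[OF s'.hom]
      by (simp add: s.C.diff_smult s'.C.diff_smult smult d)
  next
    fix v w assume "v \<in> carrier (obj W i)" "w \<in> carrier (obj W i)"
    then show "diff W i (v \<oplus>\<^bsub>obj W i\<^esub> w) = diff W i v \<oplus>\<^bsub>obj W (i + 1)\<^esub> diff W i w"
      using s.D.diff_add[of "fsnd (fsnd v)" "i - 1" "fsnd (fsnd w)"]
      by (simp add: s.C.diff_add s'.C.diff_add s.map_add s'.map_add s.D.M.add_diff_add d)
  qed (simp add: d)
  \<comment> \<open>The third coordinate is s(dx) - s'(dy) - d(sx - s'y - dc); it vanishes because s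
    and s' commute with d and d squares to zero.\<close>
  show "diff W (i + 1) (diff W i w) = \<zero>\<^bsub>obj W (i + 2)\<^esub>" if "w \<in> carrier (obj W i)" for i w
    using that by (simp add: s.map_d s'.map_d s.D.diff_diff d) (simp add: add.commute)
  obtain n1 n2 n3 where n: "\<And>i. \<bar>i\<bar> > n1 \<Longrightarrow> carrier (obj E i) = {\<zero>\<^bsub>obj E i\<^esub>}"
     "\<And>i. \<bar>i\<bar> > n2 \<Longrightarrow> carrier (obj E' i) = {\<zero>\<^bsub>obj E' i\<^esub>}"
     "\<And>i. \<bar>i\<bar> > n3 \<Longrightarrow> carrier (obj C i) = {\<zero>\<^bsub>obj C i\<^esub>}"
    using s.C.bounded_complex s'.C.bounded_complex s.D.bounded_complex unfolding bounded_complex_def by metis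
  \<comment> \<open>The extra 1 in the bound is due to \<open>C\<close>, which enters in degree
    \<open>i - 1\<close>.\<close>
  have "carrier (obj W i) = {\<zero>\<^bsub>obj W i\<^esub>}" if "\<bar>i\<bar> > \<bar>n1\<bar> + \<bar>n2\<bar> + \<bar>n3\<bar> + 1" for i
  proof -
    have "carrier (obj E i) = {\<zero>\<^bsub>obj E i\<^esub>}" "carrier (obj E' i) = {\<zero>\<^bsub>obj E' i\<^esub>}"
      "carrier (obj C (i - 1)) = {\<zero>\<^bsub>obj C (i - 1)\<^esub>}"
      using that by (intro n; linarith)+
    then show ?thesis by (auto simp: eq_fpair_iff)
  qed
  then show "\<exists>n. \<forall>i. n < \<bar>i\<bar> \<longrightarrow> carrier (obj W i) = {\<zero>\<^bsub>obj W i\<^esub>}" by blast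
qed

end

sublocale hpb \<subseteq> W: cplx R W
  using bounded_complex_hpullback by (simp add: cplx_def)

context hpb
begin

lemma chain_map_fst: "chain_map R W E (\<lambda>i. ffst)"
  by (auto simp: chain_map_def intro!: mod_homI)

lemma chain_map_snd: "chain_map R W E' (\<lambda>i w. ffst (fsnd w))"
  by (auto simp: chain_map_def intro!: mod_homI)

text \<open>The third coordinate is itself the homotopy: the last entry of the differential, sx -
  s'y - dc, is the homotopy formula solved for the term h(dw).\<close>

lemma homotopic_hpullback: "homotopic R W C (\<lambda>i. s i \<circ> ffst) (\<lambda>i. s' i \<circ> (\<lambda>w. ffst (fsnd w)))"
proof (rule homotopicI[where h = "\<lambda>i w. fsnd (fsnd w)"])
  show "(\<lambda>w. fsnd (fsnd w)) \<in> mod_hom R (obj W i) (obj C (i - 1))" for i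
    by (auto intro!: mod_homI)
  show "(s i \<circ> ffst) w \<ominus>\<^bsub>obj C i\<^esub> (s' i \<circ> (\<lambda>w. ffst (fsnd w))) w =
      diff C (i - 1) (fsnd (fsnd w)) \<oplus>\<^bsub>obj C i\<^esub> fsnd (fsnd (diff W i w))" if "w \<in> carrier (obj W i)" for i w
  proof -
    have "diff C (i - 1) (fsnd (fsnd w)) \<in> carrier (obj C i)" using that by simp
    then show ?thesis using that by (simp add: s.D.M.a_comm[of "diff C (i - 1) (fsnd (fsnd w))"] s.D.M.diff_add_eq)
  qed
qed

text \<open>The universal property: a map into the homotopy pullback is a pair of maps together with
  a chosen homotopy. The homotopy \<open>h\<close> is explicit because it becomes the third
  coordinate.\<close>

lemma chain_map_pair:
  assumes "cmap R V E \<alpha>" "cmap R V E' \<beta>"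
    and h: "\<And>i. h i \<in> mod_hom R (obj V i) (obj C (i - 1))"
      "\<And>i x. x \<in> carrier (obj V i) \<Longrightarrow>
        s i (\<alpha> i x) \<ominus>\<^bsub>obj C i\<^esub> s' i (\<beta> i x) = diff C (i - 1) (h i x) \<oplus>\<^bsub>obj C i\<^esub> h (i + 1) (diff V i x)"
  shows "chain_map R V W (\<lambda>i x. fpair (\<alpha> i x) (fpair (\<beta> i x) (h i x)))"
proof -
  interpret \<alpha>: cmap R V E \<alpha> by fact
  interpret \<beta>: cmap R V E' \<beta> by fact
  show ?thesis
    unfolding chain_map_def
  proof (intro conjI allI ballI)
    show "(\<lambda>x. fpair (\<alpha> i x) (fpair (\<beta> i x) (h i x))) \<in> mod_hom R (obj V i) (obj W i)" for i
      using mod_homD[OF \<alpha>.hom] mod_homD[OF \<beta>.hom] mod_homD[OF h(1)] by (auto intro!: mod_homI)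
    show "fpair (\<alpha> (i + 1) (diff V i x)) (fpair (\<beta> (i + 1) (diff V i x)) (h (i + 1) (diff V i x))) =
      diff W i (fpair (\<alpha> i x) (fpair (\<beta> i x) (h i x)))" if x: "x \<in> carrier (obj V i)" for i x
    proof -
      have cl: "h i x \<in> carrier (obj C (i - 1))" "h (i + 1) (diff V i x) \<in> carrier (obj C i)"
        using x mod_homD(1)[OF h(1), of x i] mod_homD(1)[OF h(1), of "diff V i x" "i + 1"] by simp_all
      have dcl: "diff C (i - 1) (h i x) \<in> carrier (obj C i)" using cl by simp
      show ?thesis
        using x cl dcl by (simp add: \<alpha>.map_d \<beta>.map_d h(2)
          s.D.M.a_comm[of "diff C (i - 1) (h i x)"] s.D.M.add_diff_eq)
    qed
  qed
qed

text \<open>The kernel of the projection \<open>W -> E\<close> is, up to sign, the cocone of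
  \<open>s'\<close>. The two assumptions make its cohomology vanish in degree \<open>i\<close>,
  whence injectivity. The proof constructs the primitive of \<open>w\<close> by hand.\<close>

lemma hinj_fst:
  assumes "hinj E' C s' i" "hsurj E' C s' (i - 1)"
  shows "hinj W E (\<lambda>i. ffst) i"
  unfolding hinj_def
proof (intro ballI impI)
  fix w assume w: "w \<in> cocycles W i" "ffst w \<in> coboundaries E i"
  define x y c where "x = ffst w" and "y = ffst (fsnd w)" and "c = fsnd (fsnd w)"
  have w_eq: "w = fpair x (fpair y c)" by (simp add: x_def y_def c_def)
  have [simp]: "x \<in> carrier (obj E i)" "y \<in> carrier (obj E' i)" "c \<in> carrier (obj C (i - 1))"
    and dy: "diff E' i y = \<zero>\<^bsub>obj E' (i + 1)\<^esub>"
    and dc: "(s i x \<ominus>\<^bsub>obj C i\<^esub> s' i y) \<ominus>\<^bsub>obj C i\<^esub> diff C (i - 1) c = \<zero>\<^bsub>obj C i\<^esub>"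
    using w by (simp_all add: cocycles_def x_def y_def c_def eq_fpair_iff)
  have d1 [simp]: "diff C (i - 1) z \<in> carrier (obj C i)" if "z \<in> carrier (obj C (i - 1))" for z
    using that by simp
  have d2 [simp]: "diff E' (i - 1) z \<in> carrier (obj E' i)" if "z \<in> carrier (obj E' (i - 1))" for z
    using that by simp
  obtain x' where x' [simp]: "x' \<in> carrier (obj E (i - 1))" and x_eq: "x = diff E (i - 1) x'"
    using w(2) s.C.coboundaryE unfolding x_def by blast
  have dsx: "s i x = diff C (i - 1) (s (i - 1) x')" unfolding x_eq by (simp add: s.map_d)
  have s'y: "s' i y = diff C (i - 1) (s (i - 1) x' \<ominus>\<^bsub>obj C (i - 1)\<^esub> c)"
  proof -
    have "s i x \<ominus>\<^bsub>obj C i\<^esub> s' i y = diff C (i - 1) c" using dc by (simp add: s.D.M.diff_eq_zero_iff)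
    then have "s i x \<ominus>\<^bsub>obj C i\<^esub> diff C (i - 1) c = s' i y"
      using s.D.M.diff_diff_self[of "s i x" i "s' i y"] by simp
    then show ?thesis using s.D.diff_diff[of "s (i - 1) x'" "i - 1" c] by (simp add: dsx)
  qed
  have "y \<in> cocycles E' i" using dy by (simp add: cocycles_def)
  moreover have "s' i y \<in> coboundaries C i" unfolding s'y by (rule s.D.coboundaryI) simp_all
  ultimately have "y \<in> coboundaries E' i" using assms(1) by (auto simp: hinj_def)
  then obtain y' where y' [simp]: "y' \<in> carrier (obj E' (i - 1))" and y_eq: "y = diff E' (i - 1) y'"
    using s'.C.coboundaryE by blast
  \<comment> \<open>With primitives x' of x and y' of y chosen, \<open>b\<close> is the error in the
    third coordinate. It is a cocycle of degree \<open>i - 1\<close>, so surjectivity of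
    \<open>s'\<close> there makes it equal to s'y'' + de; changing y' by y'' and using e as third
    coordinate removes the error.\<close>
  define b where "b = (s (i - 1) x' \<ominus>\<^bsub>obj C (i - 1)\<^esub> c) \<ominus>\<^bsub>obj C (i - 1)\<^esub> s' (i - 1) y'"
  have [simp]: "b \<in> carrier (obj C (i - 1))" by (simp add: b_def)
  have "s' i y = diff C (i - 1) (s' (i - 1) y')" unfolding y_eq by (simp add: s'.map_d)
  then have "diff C (i - 1) b = \<zero>\<^bsub>obj C i\<^esub>"
    using s.D.diff_diff[of "s (i - 1) x' \<ominus>\<^bsub>obj C (i - 1)\<^esub> c" "i - 1" "s' (i - 1) y'"] s'y
    by (simp add: b_def)
  then have "b \<in> cocycles C (i - 1)" by (simp add: cocycles_def)
  then obtain y'' e where y'': "y'' \<in> cocycles E' (i - 1)"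
    and e: "b \<ominus>\<^bsub>obj C (i - 1)\<^esub> s' (i - 1) y'' = diff C (i - 1 - 1) e" "e \<in> carrier (obj C (i - 1 - 1))"
    using assms(2) s.D.coboundaryE unfolding hsurj_def by (metis (no_types, lifting))
  have [simp]: "y'' \<in> carrier (obj E' (i - 1))" and dy'': "diff E' (i - 1) y'' = \<zero>\<^bsub>obj E' i\<^esub>"
    using y'' by (simp_all add: cocycles_def)
  let ?v = "fpair x' (fpair (y' \<oplus>\<^bsub>obj E' (i - 1)\<^esub> y'') e)"
  have "diff E' (i - 1) (y' \<oplus>\<^bsub>obj E' (i - 1)\<^esub> y'') = y"
    using s'.C.diff_add[of y' "i - 1" y''] by (simp add: dy'' y_eq)
  moreover have "(s (i - 1) x' \<ominus>\<^bsub>obj C (i - 1)\<^esub> s' (i - 1) (y' \<oplus>\<^bsub>obj E' (i - 1)\<^esub> y'')) \<ominus>\<^bsub>obj C (i - 1)\<^esub>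
      diff C (i - 1 - 1) e = c"
  proof -
    have "((p \<ominus>\<^bsub>obj C (i - 1)\<^esub> t) \<ominus>\<^bsub>obj C (i - 1)\<^esub> q) \<ominus>\<^bsub>obj C (i - 1)\<^esub> r =
        (p \<ominus>\<^bsub>obj C (i - 1)\<^esub> (q \<oplus>\<^bsub>obj C (i - 1)\<^esub> r)) \<ominus>\<^bsub>obj C (i - 1)\<^esub> t"
      if "p \<in> carrier (obj C (i - 1))" "q \<in> carrier (obj C (i - 1))" "r \<in> carrier (obj C (i - 1))"
        "t \<in> carrier (obj C (i - 1))" for p q r t
      using that by (simp add: a_minus_def s.D.M.minus_add s.D.M.a_ac)
    then show ?thesis unfolding e(1)[symmetric] b_def by (simp add: s'.map_add s.D.M.diff_diff_self)
  qed
  ultimately have "w = diff W (i - 1) ?v" by (simp add: w_eq x_eq)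
  moreover have "?v \<in> carrier (obj W (i - 1))" using e(2) by simp
  ultimately show "w \<in> coboundaries W i" unfolding coboundaries_def by (rule image_eqI)
qed

text \<open>A cocycle \<open>x\<close> lifts once its image in \<open>C\<close> is cohomologous to
  some s'y; a primitive of the difference is the third coordinate of the lift.\<close>

lemma hsurj_fst:
  assumes "hsurj E' C s' i"
  shows "hsurj W E (\<lambda>i. ffst) i"
  unfolding hsurj_def
proof
  fix x assume x: "x \<in> cocycles E i"
  then have [simp]: "x \<in> carrier (obj E i)" and dx: "diff E i x = \<zero>\<^bsub>obj E (i + 1)\<^esub>" by (auto simp: cocycles_def)
  obtain y c where y: "y \<in> cocycles E' i"
    and c: "s i x \<ominus>\<^bsub>obj C i\<^esub> s' i y = diff C (i - 1) c" "c \<in> carrier (obj C (i - 1))"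
    using assms s.map_cocycle[OF x] s.D.coboundaryE unfolding hsurj_def by (metis (no_types, lifting))
  have d1 [simp]: "diff C (i - 1) c \<in> carrier (obj C i)" using c(2) by simp
  have "fpair x (fpair y c) \<in> cocycles W i"
    using y dx c by (simp add: cocycles_def)
  moreover have "x \<ominus>\<^bsub>obj E i\<^esub> ffst (fpair x (fpair y c)) \<in> coboundaries E i"
    using s.C.coboundaryD(2) by simp
  ultimately show "\<exists>w\<in>cocycles W i. x \<ominus>\<^bsub>obj E i\<^esub> ffst w \<in> coboundaries E i" by blast
qed

end


subsection \<open>Quotients and truncation\<close>

definition quot_complex :: "('a, 'm) cochain \<Rightarrow> (int \<Rightarrow> 'm set) \<Rightarrow> ('a, 'm) cochain" where
  "quot_complex C N = \<lparr>obj = \<lambda>i. quot_module (obj C i) (N i),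
     diff = \<lambda>i x. coset_rep (obj C (i + 1)) (N (i + 1)) (diff C i x)\<rparr>"

lemma quot_complex_simps [simp]:
  "obj (quot_complex C N) i = quot_module (obj C i) (N i)"
  "diff (quot_complex C N) i x = coset_rep (obj C (i + 1)) (N (i + 1)) (diff C i x)"
  by (simp_all add: quot_complex_def)

locale subcplx = cplx R C
  for R :: "('a, 'r) ring_scheme" and C :: "('a, 'm) cochain" +
  fixes N :: "int \<Rightarrow> 'm set"
  assumes sub: "left_submodule R (obj C i) (N i)"
    and diff_sub: "x \<in> N i \<Longrightarrow> diff C i x \<in> N (i + 1)"
begin

abbreviation q where "q i \<equiv> coset_rep (obj C i) (N i)"
abbreviation Q where "Q \<equiv> quot_complex C N"

lemma carrier_Q: "carrier (obj Q i) = q i ` carrier (obj C i)"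
  and zero_Q: "\<zero>\<^bsub>obj Q i\<^esub> = q i \<zero>\<^bsub>obj C i\<^esub>"
  using left_module.quot_module_simps[OF left_module_obj sub] by simp_all

lemma q_zero_iff: "x \<in> carrier (obj C i) \<Longrightarrow> q i x = \<zero>\<^bsub>obj Q i\<^esub> \<longleftrightarrow> x \<in> N i"
  using left_module.coset_rep_zero_iff[OF left_module_obj sub] by simp

lemma q_eq_iff:
  "x \<in> carrier (obj C i) \<Longrightarrow> y \<in> carrier (obj C i) \<Longrightarrow> q i x = q i y \<longleftrightarrow> x \<ominus>\<^bsub>obj C i\<^esub> y \<in> N i"
  using left_module.coset_rep_eq_iff[OF left_module_obj sub] by simp

lemma q_carrier: "x \<in> carrier (obj C i) \<Longrightarrow> q i x \<in> carrier (obj C i)"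
  using left_module.coset_rep(1)[OF left_module_obj sub] by simp

lemma diff_q: "x \<in> carrier (obj C i) \<Longrightarrow> diff Q i (q i x) = q (i + 1) (diff C i x)"
  using induced_hom(1)[OF left_module_obj left_module_obj sub sub diff_hom diff_sub] by simp

lemma bounded_complex_quot: "bounded_complex R Q"
  unfolding bounded_complex_def
proof (intro conjI allI ballI)
  show "fg_module R (obj Q i)" for i
    using fg_module_quot[OF fg_module_obj sub] by simp
  show "diff Q i \<in> mod_hom R (obj Q i) (obj Q (i + 1))" for i
  proof -
    have "diff Q i = (\<lambda>x. q (i + 1) (diff C i x))" by (rule ext) simp
    then show ?thesis
      using induced_hom(2)[OF left_module_obj left_module_obj sub sub diff_hom diff_sub] by simp
  qed
  show "diff Q (i + 1) (diff Q i y) = \<zero>\<^bsub>obj Q (i + 2)\<^esub>" if y: "y \<in> carrier (obj Q i)" for i y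
  proof -
    obtain x where x: "x \<in> carrier (obj C i)" "y = q i x" using y unfolding carrier_Q by blast
    have "diff Q (i + 1) (diff Q i y) = q (i + 1 + 1) (diff C (i + 1) (diff C i x))"
      unfolding x(2) diff_q[OF x(1)] by (rule diff_q) (simp add: x)
    also have "\<dots> = q (i + 1 + 1) \<zero>\<^bsub>obj C (i + 1 + 1)\<^esub>"
      using x(1) by (subst dd) simp_all
    also have "\<dots> = \<zero>\<^bsub>obj Q (i + 2)\<^esub>" unfolding zero_Q by (simp add: add.commute)
    finally show ?thesis .
  qed
  obtain n where n: "\<And>i. \<bar>i\<bar> > n \<Longrightarrow> carrier (obj C i) = {\<zero>\<^bsub>obj C i\<^esub>}"
    using bounded_complex unfolding bounded_complex_def by blast
  show "\<exists>n. \<forall>i. \<bar>i\<bar> > n \<longrightarrow> carrier (obj Q i) = {\<zero>\<^bsub>obj Q i\<^esub>}"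
    by (rule exI[of _ n]) (unfold carrier_Q zero_Q, simp add: n)
qed

lemma chain_map_quot: "chain_map R C Q q"
  unfolding chain_map_def using coset_rep_hom[OF left_module_obj sub] diff_q by simp

end

lemma chain_map_induced:
  assumes "subcplx R C N" "subcplx R D N'" and f: "chain_map R C D f"
    and fN: "\<And>i x. x \<in> N i \<Longrightarrow> f i x \<in> N' i"
  shows "chain_map R (quot_complex C N) (quot_complex D N') (\<lambda>i x. coset_rep (obj D i) (N' i) (f i x))"
    and "x \<in> carrier (obj C i) \<Longrightarrow>
      coset_rep (obj D i) (N' i) (f i (coset_rep (obj C i) (N i) x)) = coset_rep (obj D i) (N' i) (f i x)"
proof -
  interpret C: subcplx R C N by fact
  interpret D: subcplx R D N' by fact
  interpret f: cmap R C D f by (intro cmapI C.bounded_complex D.bounded_complex f)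
  note ind = induced_hom[OF C.left_module_obj D.left_module_obj C.sub D.sub f.hom fN]
  show *: "coset_rep (obj D i) (N' i) (f i (coset_rep (obj C i) (N i) x)) = coset_rep (obj D i) (N' i) (f i x)"
    if "x \<in> carrier (obj C i)" for i x
    using ind(1) that by simp
  show "chain_map R C.Q D.Q (\<lambda>i x. D.q i (f i x))"
    unfolding chain_map_def
  proof (intro conjI allI ballI)
    show "(\<lambda>x. D.q i (f i x)) \<in> mod_hom R (obj C.Q i) (obj D.Q i)" for i
      using ind(2) by simp
    fix i y assume "y \<in> carrier (obj C.Q i)"
    then obtain x where x: "x \<in> carrier (obj C i)" "y = C.q i x" unfolding C.carrier_Q by blast
    have "D.q (i + 1) (f (i + 1) (diff C.Q i y)) = D.q (i + 1) (diff D i (f i x))"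
      unfolding x(2) C.diff_q[OF x(1)] using x(1) by (subst *) (simp_all add: f.map_d)
    also have "\<dots> = diff D.Q i (D.q i (f i y))"
      unfolding x(2) *[OF x(1)] using x(1) by (subst D.diff_q) simp_all
    finally show "D.q (i + 1) (f (i + 1) (diff C.Q i y)) = diff D.Q i (D.q i (f i y))" .
  qed
qed

text \<open>Lets a null-homotopy pass to quotient complexes; \<open>hom_zero_trunc\<close> uses it
  to truncate one. The homotopy has to respect the subcomplexes, just as the map does.\<close>

lemma homotopic_induced:
  assumes "subcplx R C N" "subcplx R D N'" and f: "chain_map R C D f"
    and h: "\<And>i. h i \<in> mod_hom R (obj C i) (obj D (i - 1))"
      "\<And>i x. x \<in> carrier (obj C i) \<Longrightarrow>
        f i x \<ominus>\<^bsub>obj D i\<^esub> \<zero>\<^bsub>obj D i\<^esub> = diff D (i - 1) (h i x) \<oplus>\<^bsub>obj D i\<^esub> h (i + 1) (diff C i x)"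
    and fN: "\<And>i x. x \<in> N i \<Longrightarrow> f i x \<in> N' i"
    and hN: "\<And>i x. x \<in> N i \<Longrightarrow> h i x \<in> N' (i - 1)"
  shows "homotopic R (quot_complex C N) (quot_complex D N')
    (\<lambda>i x. coset_rep (obj D i) (N' i) (f i x)) (\<lambda>i x. \<zero>\<^bsub>obj (quot_complex D N') i\<^esub>)"
proof -
  interpret C: subcplx R C N by fact
  interpret D: subcplx R D N' by fact
  interpret f: cmap R C D f by (intro cmapI C.bounded_complex D.bounded_complex f)
  interpret Dq: cmap R D D.Q D.q by (intro cmapI D.bounded_complex D.bounded_complex_quot D.chain_map_quot)
  note ind = induced_hom[OF C.left_module_obj D.left_module_obj C.sub D.sub h(1) hN]
  have indf: "D.q i (f i (C.q i x)) = D.q i (f i x)" if "x \<in> carrier (obj C i)" for i x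
    using chain_map_induced(2)[OF assms(1-3) fN] that by simp
  show ?thesis
  proof (rule homotopicI[where h = "\<lambda>i x. D.q (i - 1) (h i x)"])
    show "(\<lambda>x. D.q (i - 1) (h i x)) \<in> mod_hom R (obj C.Q i) (obj D.Q (i - 1))" for i
      using ind(2) by simp
    fix i y assume y: "y \<in> carrier (obj C.Q i)"
    then obtain x where x: "x \<in> carrier (obj C i)" "y = C.q i x" unfolding C.carrier_Q by blast
    have cl: "h i x \<in> carrier (obj D (i - 1))" "h (i + 1) (diff C i x) \<in> carrier (obj D i)"
      "diff D (i - 1) (h i x) \<in> carrier (obj D i)"
      using x mod_homD(1)[OF h(1), of x i] mod_homD(1)[OF h(1), of "diff C i x" "i + 1"] by simp_all
    have "D.q i (f i y) \<ominus>\<^bsub>obj D.Q i\<^esub> \<zero>\<^bsub>obj D.Q i\<^esub> = D.q i (f i x)"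
      unfolding x(2) indf[OF x(1)] by (rule Dq.D.M.diff_zero) (rule Dq.closed, simp add: x)
    also have "f i x = diff D (i - 1) (h i x) \<oplus>\<^bsub>obj D i\<^esub> h (i + 1) (diff C i x)"
      using h(2)[OF x(1)] x(1) by simp
    also have "D.q i \<dots> = D.q i (diff D (i - 1) (h i x)) \<oplus>\<^bsub>obj D.Q i\<^esub> D.q i (h (i + 1) (diff C i x))"
      by (rule Dq.map_add[OF cl(3,2)])
    also have "D.q i (diff D (i - 1) (h i x)) = diff D.Q (i - 1) (D.q (i - 1) (h i y))"
    proof -
      have "D.q (i - 1) (h i y) = D.q (i - 1) (h i x)" unfolding x(2) using ind(1)[OF _ x(1)] by simp
      then show ?thesis using D.diff_q[OF cl(1)] by simp
    qed
    also have "D.q i (h (i + 1) (diff C i x)) = D.q (i + 1 - 1) (h (i + 1) (diff C.Q i y))"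
      unfolding x(2) C.diff_q[OF x(1)] using ind(1)[of "i + 1" "diff C i x"] x(1) by simp
    finally show "D.q i (f i y) \<ominus>\<^bsub>obj D.Q i\<^esub> \<zero>\<^bsub>obj D.Q i\<^esub> =
      diff D.Q (i - 1) (D.q (i - 1) (h i y)) \<oplus>\<^bsub>obj D.Q i\<^esub> D.q (i + 1 - 1) (h (i + 1) (diff C.Q i y))" .
  qed
qed

text \<open>The truncation \<open>\<tau>\<^sup>\<ge>\<^sup>a C\<close> is the quotient of \<open>C\<close> by the following subcomplex.\<close>

definition trunc_sub :: "int \<Rightarrow> ('a, 'm) cochain \<Rightarrow> int \<Rightarrow> 'm set" where
  "trunc_sub a C i =
     (if i < a then carrier (obj C i) else if i = a then coboundaries C i else {\<zero>\<^bsub>obj C i\<^esub>})"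

abbreviation trunc :: "int \<Rightarrow> ('a, 'm) cochain \<Rightarrow> ('a, 'm) cochain" where
  "trunc a C \<equiv> quot_complex C (trunc_sub a C)"

abbreviation trunc_proj :: "int \<Rightarrow> ('a, 'm) cochain \<Rightarrow> int \<Rightarrow> 'm \<Rightarrow> 'm" where
  "trunc_proj a C i \<equiv> coset_rep (obj C i) (trunc_sub a C i)"

lemma subcplx_trunc:
  assumes "bounded_complex R C"
  shows "subcplx R C (trunc_sub a C)"
proof -
  interpret cplx R C using assms by (simp add: cplx_def)
  show ?thesis
  proof
    show "left_submodule R (obj C i) (trunc_sub a C i)" for i
      using left_submodule_coboundaries left_module.smult_closed[OF left_module_obj]
        left_module.smult_zero[OF left_module_obj]
      by (auto simp: trunc_sub_def left_submodule_def)
    \<comment> \<open>Two degrees matter: from \<open>a - 1\<close> everything goes to coboundaries,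
      and in degree \<open>a\<close> coboundaries go to zero.\<close>
    show "diff C i x \<in> trunc_sub a C (i + 1)" if "x \<in> trunc_sub a C i" for i x
      using that coboundary_cocycle[of x i]
      by (auto simp: trunc_sub_def cocycles_def coboundaries_def split: if_splits)
  qed
qed

lemma trunc_sub_map:
  assumes "cmap R C D f" "x \<in> trunc_sub a C i"
  shows "f i x \<in> trunc_sub a D i"
proof -
  interpret cmap R C D f by fact
  show ?thesis using assms(2) map_coboundary by (auto simp: trunc_sub_def split: if_splits)
qed

text \<open>A homotopy lowers the degree by one. From degrees up to \<open>a\<close> it lands below
  \<open>a\<close>, where the subcomplex is everything, and above \<open>a\<close> the subcomplex it
  starts from is zero. So no relation between \<open>h\<close> and the differentials is
  involved.\<close>

lemma trunc_sub_homotopy: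
  assumes "bounded_complex R C" "bounded_complex R D" "h \<in> mod_hom R (obj C i) (obj D (i - 1))"
    "x \<in> trunc_sub a C i"
  shows "h x \<in> trunc_sub a D (i - 1)"
proof -
  interpret C: subcplx R C "trunc_sub a C" by (rule subcplx_trunc[OF assms(1)])
  interpret D: subcplx R D "trunc_sub a D" by (rule subcplx_trunc[OF assms(2)])
  have "x \<in> carrier (obj C i)" using assms(4) C.sub[of i] by (auto simp: left_submodule_def)
  moreover have "\<zero>\<^bsub>obj D (i - 1)\<^esub> \<in> trunc_sub a D (i - 1)" using D.sub[of "i - 1"] by (simp add: left_submodule_def)
  ultimately show ?thesis
    using assms(4) mod_homD(1)[OF assms(3)]
      mod_hom_zero_minus(1)[OF C.M.abelian_group_axioms D.M.abelian_group_axioms assms(3)]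
    by (cases "i \<le> a") (auto simp: trunc_sub_def)
qed

lemma trunc_exact:
  assumes "bounded_complex R C" "i < a"
  shows "cocycles (trunc a C) i \<subseteq> coboundaries (trunc a C) i"
proof
  interpret C: subcplx R C "trunc_sub a C" by (rule subcplx_trunc[OF assms(1)])
  interpret T: cplx R "trunc a C" using C.bounded_complex_quot by (simp add: cplx_def)
  fix y assume "y \<in> cocycles (trunc a C) i"
  then obtain x where x: "x \<in> carrier (obj C i)" "y = C.q i x"
    using T.cocycleD(1) C.carrier_Q by blast
  then have "y = \<zero>\<^bsub>obj C.Q i\<^esub>" using assms(2) C.q_zero_iff[OF x(1)] by (simp add: trunc_sub_def)
  then show "y \<in> coboundaries (trunc a C) i" using T.coboundaryD(2) by simp
qed

text \<open>Below \<open>a\<close> the truncation is exact and zero serves as preimage. From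
  \<open>a\<close> on, cocycles of the truncation lift to cocycles.\<close>

lemma hsurj_trunc:
  assumes "bounded_complex R C"
  shows "hsurj C (trunc a C) (trunc_proj a C) i"
  unfolding hsurj_def
proof
  interpret C: subcplx R C "trunc_sub a C" by (rule subcplx_trunc[OF assms])
  interpret q: cmap R C C.Q C.q by (intro cmapI C.bounded_complex C.bounded_complex_quot C.chain_map_quot)
  fix y assume y: "y \<in> cocycles C.Q i"
  show "\<exists>x\<in>cocycles C i. y \<ominus>\<^bsub>obj C.Q i\<^esub> C.q i x \<in> coboundaries C.Q i"
  proof (cases "i < a")
    case True
    have "y \<ominus>\<^bsub>obj C.Q i\<^esub> C.q i \<zero>\<^bsub>obj C i\<^esub> \<in> cocycles C.Q i"
      by (rule q.D.cocycleD(6)[OF y q.map_cocycle[OF C.cocycleD(2)]])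
    then show ?thesis using trunc_exact[OF assms True] C.cocycleD(2) by blast
  next
    case False
    obtain x where x: "x \<in> carrier (obj C i)" "y = C.q i x"
      using q.D.cocycleD(1)[OF y] unfolding C.carrier_Q by blast
    have "C.q (i + 1) (diff C i x) = \<zero>\<^bsub>obj C.Q (i + 1)\<^esub>"
      using y unfolding cocycles_def x(2) using C.diff_q[OF x(1)] by simp
    then have "diff C i x \<in> trunc_sub a C (i + 1)" using x(1) C.q_zero_iff[of "diff C i x" "i + 1"] by simp
    \<comment> \<open>As \<open>i + 1 > a\<close>, the subcomplex is zero in degree
      \<open>i + 1\<close>, so \<open>diff C i x\<close> itself vanishes and not only its
      class.\<close>
    then have "x \<in> cocycles C i" using False x(1) by (simp add: trunc_sub_def cocycles_def)
    moreover have "y \<ominus>\<^bsub>obj C.Q i\<^esub> C.q i x = \<zero>\<^bsub>obj C.Q i\<^esub>"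
      unfolding x(2) by (rule q.D.M.diff_self) (rule q.closed[OF x(1)])
    ultimately show ?thesis using q.D.coboundaryD(2)[of i] by metis
  qed
qed

text \<open>From degree \<open>a\<close> on, the subcomplex consists of coboundaries of
  \<open>C\<close>, so a relation modulo the subcomplex is a relation modulo coboundaries.\<close>

lemma hinj_trunc:
  assumes "bounded_complex R C" "i \<ge> a"
  shows "hinj C (trunc a C) (trunc_proj a C) i"
  unfolding hinj_def
proof (intro ballI impI)
  interpret C: subcplx R C "trunc_sub a C" by (rule subcplx_trunc[OF assms(1)])
  interpret q: cmap R C C.Q C.q by (intro cmapI C.bounded_complex C.bounded_complex_quot C.chain_map_quot)
  fix x assume x: "x \<in> cocycles C i" "C.q i x \<in> coboundaries C.Q i"
  have xc: "x \<in> carrier (obj C i)" by (rule C.cocycleD(1)[OF x(1)])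
  obtain y' where "y' \<in> carrier (obj C.Q (i - 1))" "C.q i x = diff C.Q (i - 1) y'"
    using x(2) q.D.coboundaryE by blast
  then obtain y where y: "y \<in> carrier (obj C (i - 1))" "C.q i x = diff C.Q (i - 1) (C.q (i - 1) y)"
    unfolding C.carrier_Q by blast
  have dy: "diff C (i - 1) y \<in> coboundaries C i" by (rule C.coboundaryI) (simp_all add: y)
  then have dyc: "diff C (i - 1) y \<in> carrier (obj C i)" by (rule C.coboundaryD(1))
  have "C.q i x = C.q i (diff C (i - 1) y)" using y(2) C.diff_q[OF y(1)] by simp
  then have "x \<ominus>\<^bsub>obj C i\<^esub> diff C (i - 1) y \<in> trunc_sub a C i"
    using C.q_eq_iff[OF xc dyc] by simp
  then have "x \<ominus>\<^bsub>obj C i\<^esub> diff C (i - 1) y \<in> coboundaries C i"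
    using assms(2) C.coboundaryD(2) by (auto simp: trunc_sub_def split: if_splits)
  from C.coboundaryD(3)[OF this dy] show "x \<in> coboundaries C i"
    using xc dyc by (simp add: C.M.diff_add_eq)
qed

subsection \<open>Shifts\<close>

text \<open>Two complexes that differ only by the junk values of their differentials outside the carriers.\<close>

definition same_complex :: "('a, 'm) cochain \<Rightarrow> ('a, 'm) cochain \<Rightarrow> bool" where
  "same_complex C D \<longleftrightarrow> (\<forall>i. obj C i = obj D i) \<and> (\<forall>i. \<forall>x\<in>carrier (obj C i). diff C i x = diff D i x)"

lemma same_complex_chain_map:
  assumes "same_complex C D"
  shows "chain_map R E C f \<longleftrightarrow> chain_map R E D f" "chain_map R C E f \<longleftrightarrow> chain_map R D E f"
  using assms mod_homD(1)[of "f _" R "obj E _" "obj D _"] unfolding chain_map_def same_complex_def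
  by metis+

lemma same_complex_cocycles:
  assumes "same_complex C D"
  shows "cocycles C = cocycles D" "coboundaries C = coboundaries D"
  using assms by (auto simp: same_complex_def cocycles_def coboundaries_def fun_eq_iff)

lemma same_complex_hinj:
  assumes "same_complex C D"
  shows "hinj E C = hinj E D" "hinj C E = hinj D E" "hsurj E C = hsurj E D" "hsurj C E = hsurj D E"
  using assms by (simp_all add: fun_eq_iff hinj_def hsurj_def same_complex_cocycles[OF assms] same_complex_def)

lemma same_complex_homotopic:
  assumes "same_complex C D" "homotopic R E C f g"
  shows "homotopic R E D f g"
proof -
  obtain h where h: "\<And>i. h i \<in> mod_hom R (obj E i) (obj C (i - 1))"
    "\<And>i x. x \<in> carrier (obj E i) \<Longrightarrow>
      f i x \<ominus>\<^bsub>obj C i\<^esub> g i x = diff C (i - 1) (h i x) \<oplus>\<^bsub>obj C i\<^esub> h (i + 1) (diff E i x)"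
    using homotopicE[OF assms(2)] by blast
  show ?thesis
    by (rule homotopicI[where h = h])
      (use assms(1) h mod_homD(1)[OF h(1)] in \<open>simp_all add: same_complex_def\<close>)
qed

lemma bounded_complex_shift:
  assumes "bounded_complex R C"
  shows "bounded_complex R (shift k C)"
proof -
  interpret cplx R C using assms by (simp add: cplx_def)
  obtain n where n: "\<And>i. \<bar>i\<bar> > n \<Longrightarrow> carrier (obj C i) = {\<zero>\<^bsub>obj C i\<^esub>}"
    using bounded_complex unfolding bounded_complex_def by blast
  have e: "i + 1 + k = i + k + 1" "i + 2 + k = i + k + 1 + 1" for i by simp_all
  show ?thesis
    unfolding bounded_complex_def
  proof (intro conjI allI ballI exI[of _ "n + \<bar>k\<bar>"] impI)
    show "fg_module R (obj (shift k C) i)" for i using fg_module_obj by (simp add: shift_def)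
    show "diff (shift k C) i \<in> mod_hom R (obj (shift k C) i) (obj (shift k C) (i + 1))" for i
      using diff_hom[of "i + k"] mod_hom_uminus[OF left_module_obj diff_hom, of "i + k"]
      by (cases "even k") (simp_all add: shift_def e)
    show "diff (shift k C) (i + 1) (diff (shift k C) i x) = \<zero>\<^bsub>obj (shift k C) (i + 2)\<^esub>"
      if "x \<in> carrier (obj (shift k C) i)" for i x
      using that unfolding shift_def cochain.simps e by (auto simp: diff_minus simp del: add.assoc)
    show "carrier (obj (shift k C) i) = {\<zero>\<^bsub>obj (shift k C) i\<^esub>}" if "n + \<bar>k\<bar> < \<bar>i\<bar>" for i
      using that n[of "i + k"] by (simp add: shift_def)
  qed
qed

lemma obj_shift: "obj (shift k C) i = obj C (i + k)" by (simp add: shift_def)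

lemma diff_shift: "diff (shift k C) i x =
  (if even k then diff C (i + k) x else \<ominus>\<^bsub>obj C (i + k + 1)\<^esub> diff C (i + k) x)"
  by (simp add: shift_def)

lemma cocycles_shift:
  assumes "bounded_complex R C"
  shows "cocycles (shift k C) i = cocycles C (i + k)"
proof -
  interpret cplx R C using assms by (simp add: cplx_def)
  have e: "i + 1 + k = i + k + 1" by simp
  have "\<ominus>\<^bsub>obj C j\<^esub> y = \<zero>\<^bsub>obj C j\<^esub> \<longleftrightarrow> y = \<zero>\<^bsub>obj C j\<^esub>" if "y \<in> carrier (obj C j)" for j y
    using that M.minus_minus M.a_inv_zero by metis
  then show ?thesis unfolding cocycles_def obj_shift diff_shift e by auto
qed

text \<open>The sign in the shifted differential does not affect its image, as negation permutes the
  source module.\<close>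

lemma coboundaries_shift:
  assumes "bounded_complex R C"
  shows "coboundaries (shift k C) i = coboundaries C (i + k)"
proof -
  interpret cplx R C using assms by (simp add: cplx_def)
  have e: "i - 1 + k = i + k - 1" "i - 1 + k + 1 = i + k" by simp_all
  have "(\<lambda>x. \<ominus>\<^bsub>obj C j\<^esub> diff C (j - 1) x) ` carrier (obj C (j - 1)) = diff C (j - 1) ` carrier (obj C (j - 1))" for j
  proof -
    have *: "\<ominus>\<^bsub>obj C j\<^esub> diff C (j - 1) x = diff C (j - 1) (\<ominus>\<^bsub>obj C (j - 1)\<^esub> x)" if "x \<in> carrier (obj C (j - 1))" for x
      using diff_minus[OF that] by simp
    have "x \<in> (\<lambda>x. \<ominus>\<^bsub>obj C (j - 1)\<^esub> x) ` carrier (obj C (j - 1))" if "x \<in> carrier (obj C (j - 1))" for x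
      using that by (intro image_eqI[of _ _ "\<ominus>\<^bsub>obj C (j - 1)\<^esub> x"]) (simp_all add: M.minus_minus)
    then have "(\<lambda>x. \<ominus>\<^bsub>obj C (j - 1)\<^esub> x) ` carrier (obj C (j - 1)) = carrier (obj C (j - 1))" by auto
    then have "diff C (j - 1) ` carrier (obj C (j - 1)) =
      diff C (j - 1) ` (\<lambda>x. \<ominus>\<^bsub>obj C (j - 1)\<^esub> x) ` carrier (obj C (j - 1))" by simp
    also have "\<dots> = (\<lambda>x. \<ominus>\<^bsub>obj C j\<^esub> diff C (j - 1) x) ` carrier (obj C (j - 1))"
      unfolding image_image by (intro image_cong) (simp_all add: *)
    finally show ?thesis by simp
  qed
  then show ?thesis unfolding coboundaries_def obj_shift diff_shift e by (cases "even k") simp_all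
qed

lemma hinj_shift:
  assumes "bounded_complex R C" "bounded_complex R D"
  shows "hinj (shift k C) (shift k D) (\<lambda>i. f (i + k)) i \<longleftrightarrow> hinj C D f (i + k)"
    "hsurj (shift k C) (shift k D) (\<lambda>i. f (i + k)) i \<longleftrightarrow> hsurj C D f (i + k)"
  using assms by (simp_all add: hinj_def hsurj_def cocycles_shift coboundaries_shift obj_shift)

lemma cmap_shift:
  assumes "cmap R C D f"
  shows "cmap R (shift k C) (shift k D) (\<lambda>i. f (i + k))"
proof -
  interpret cmap R C D f by fact
  have e: "i + 1 + k = i + k + 1" for i by simp
  have "chain_map R (shift k C) (shift k D) (\<lambda>i. f (i + k))"
    unfolding chain_map_def obj_shift diff_shift e using hom by (auto simp: map_d map_minus)
  then show ?thesis by (intro cmapI bounded_complex_shift C.bounded_complex D.bounded_complex)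
qed

lemma homotopic_shift:
  assumes "bounded_complex R C" "bounded_complex R D" "homotopic R C D f g"
  shows "homotopic R (shift k C) (shift k D) (\<lambda>i. f (i + k)) (\<lambda>i. g (i + k))"
proof -
  interpret C: cplx R C using assms by (simp add: cplx_def)
  interpret D: cplx R D using assms by (simp add: cplx_def)
  obtain h where h: "\<And>i. h i \<in> mod_hom R (obj C i) (obj D (i - 1))"
    "\<And>i x. x \<in> carrier (obj C i) \<Longrightarrow>
      f i x \<ominus>\<^bsub>obj D i\<^esub> g i x = diff D (i - 1) (h i x) \<oplus>\<^bsub>obj D i\<^esub> h (i + 1) (diff C i x)"
    using homotopicE[OF assms(3)] by blast
  have e: "i - 1 + k = i + k - 1" "i + 1 + k = i + k + 1" "i + k - 1 + 1 = i + k" "i + k + 1 - 1 = i + k" for i by simp_all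
  have h_minus: "h (i + 1) (\<ominus>\<^bsub>obj C (i + 1)\<^esub> x) = \<ominus>\<^bsub>obj D i\<^esub> h (i + 1) x" if "x \<in> carrier (obj C (i + 1))" for i x
    using mod_hom_zero_minus(2)[OF C.M.abelian_group_axioms D.M.abelian_group_axioms h(1) that] by simp
  have h_cl: "h (i + 1) x \<in> carrier (obj D i)" if "x \<in> carrier (obj C (i + 1))" for i x
    using mod_homD(1)[OF h(1) that] by simp
  have d_minus: "diff D (i - 1) (\<ominus>\<^bsub>obj D (i - 1)\<^esub> x) = \<ominus>\<^bsub>obj D i\<^esub> diff D (i - 1) x" if "x \<in> carrier (obj D (i - 1))" for i x
    using D.diff_minus[OF that] by simp
  have d_cl: "diff D (i - 1) x \<in> carrier (obj D i)" if "x \<in> carrier (obj D (i - 1))" for i x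
    using that by simp
  show ?thesis
  \<comment> \<open>The homotopy takes the same sign as the differential. In both summands of the
    homotopy formula the two signs then cancel.\<close>
  proof (rule homotopicI[where h = "\<lambda>i x. if even k then h (i + k) x else \<ominus>\<^bsub>obj D (i + k - 1)\<^esub> h (i + k) x"],
      unfold obj_shift diff_shift e)
    show "(\<lambda>x. if even k then h (i + k) x else \<ominus>\<^bsub>obj D (i + k - 1)\<^esub> h (i + k) x)
        \<in> mod_hom R (obj C (i + k)) (obj D (i + k - 1))" for i
      using h(1) mod_hom_uminus[OF D.left_module_obj h(1)] by (cases "even k") simp_all
    fix i x assume x: "x \<in> carrier (obj C (i + k))"
    note [simp] = mod_homD(1)[OF h(1) x]
    have [simp]: "diff C (i + k) x \<in> carrier (obj C (i + k + 1))" using x by simp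
    show "f (i + k) x \<ominus>\<^bsub>obj D (i + k)\<^esub> g (i + k) x =
      (if even k then diff D (i + k - 1) (if even k then h (i + k) x else \<ominus>\<^bsub>obj D (i + k - 1)\<^esub> h (i + k) x)
       else \<ominus>\<^bsub>obj D (i + k)\<^esub> diff D (i + k - 1) (if even k then h (i + k) x else \<ominus>\<^bsub>obj D (i + k - 1)\<^esub> h (i + k) x)) \<oplus>\<^bsub>obj D (i + k)\<^esub>
      (if even k then h (i + k + 1) (if even k then diff C (i + k) x else \<ominus>\<^bsub>obj C (i + k + 1)\<^esub> diff C (i + k) x)
       else \<ominus>\<^bsub>obj D (i + k)\<^esub> h (i + k + 1) (if even k then diff C (i + k) x else \<ominus>\<^bsub>obj C (i + k + 1)\<^esub> diff C (i + k) x))"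
      using h(2)[OF x] d_minus[OF mod_homD(1)[OF h(1) x]] d_cl[OF mod_homD(1)[OF h(1) x]]
      by (cases "even k") (simp_all only: if_True if_False h_minus h_cl D.M.minus_minus \<open>diff C (i + k) x \<in> carrier (obj C (i + k + 1))\<close>)
  qed
qed

text \<open>For odd \<open>k\<close> the double negation cancels only on the carriers, hence
  \<open>same_complex\<close> and not equality. The premise \<open>l = - k\<close> covers both
  orders of shifting by \<open>k\<close> and by \<open>- k\<close>.\<close>

lemma same_complex_shift_shift:
  assumes "bounded_complex R C" "l = - k"
  shows "same_complex (shift k (shift l C)) C"
proof -
  interpret cplx R C using assms by (simp add: cplx_def)
  have e: "i + k + l = i" "i + k + 1 + l = i + 1" for i using assms(2) by simp_all
  have "even l \<longleftrightarrow> even k" using assms(2) by simp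
  then show ?thesis unfolding same_complex_def obj_shift diff_shift e by (auto simp: M.minus_minus)
qed

lemma same_complex_sym: "same_complex C D \<Longrightarrow> same_complex D C"
  by (auto simp: same_complex_def)

section \<open>Vanishing of morphisms in the derived category\<close>

text \<open>A version of \<open>quasi_iso\<close> that carries the boundedness of both complexes
  through \<open>cmap\<close> and tests cohomology on cocycles; see
  \<open>quasi_iso_iff_qis\<close>.\<close>

definition qis :: "('a, 'r) ring_scheme \<Rightarrow> ('a, 'm) cochain \<Rightarrow> ('a, 'm) cochain \<Rightarrow> (int \<Rightarrow> 'm \<Rightarrow> 'm) \<Rightarrow> bool" where
  "qis R C D f \<longleftrightarrow> cmap R C D f \<and> (\<forall>i. hinj C D f i \<and> hsurj C D f i)"

lemma cmap_comp: "cmap R C D f \<Longrightarrow> cmap R D E g \<Longrightarrow> cmap R C E (\<lambda>i. g i \<circ> f i)"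
  by (auto simp: cmap_def cmap_axioms_def chain_map_comp)

lemma cmap_zero: "bounded_complex R C \<Longrightarrow> bounded_complex R D \<Longrightarrow> cmap R C D (\<lambda>i x. \<zero>\<^bsub>obj D i\<^esub>)"
  by (intro cmapI chain_map_zero)

lemma cmap_bounded: "cmap R C D f \<Longrightarrow> bounded_complex R C" "cmap R C D f \<Longrightarrow> bounded_complex R D"
  by (auto simp: cmap_def cplx_def)

lemma qis_cmap: "qis R C D f \<Longrightarrow> cmap R C D f"
  by (simp add: qis_def)

lemma qis_comp: "qis R C D f \<Longrightarrow> qis R D E g \<Longrightarrow> qis R C E (\<lambda>i. g i \<circ> f i)"
  by (auto simp: qis_def cmap_comp intro!: cmap2.hinj_comp cmap2.hsurj_comp cmap2.intro)

lemma homotopic_eq: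
  assumes "cmap R C D f" "cmap R C D g" "\<And>i x. x \<in> carrier (obj C i) \<Longrightarrow> f i x = g i x"
  shows "homotopic R C D f g"
  using homotopic_refl[OF assms(1)] assms(3) by (simp add: homotopic_def)

lemma qis_id: "bounded_complex R C \<Longrightarrow> qis R C C (\<lambda>i x. x)"
proof -
  assume C: "bounded_complex R C"
  interpret cplx R C using C by (simp add: cplx_def)
  have "y \<ominus>\<^bsub>obj C i\<^esub> y \<in> coboundaries C i" if "y \<in> cocycles C i" for y i
    using cocycleD(1)[OF that] coboundaryD(2) by simp
  then show ?thesis
    using C by (auto simp: qis_def hinj_def hsurj_def intro!: cmapI chain_map_id)
qed

definition null_homotopic where
  "null_homotopic R C D f \<longleftrightarrow> homotopic R C D f (\<lambda>i x. \<zero>\<^bsub>obj D i\<^esub>)"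

lemma null_homotopic_comp_right:
  assumes "cmap R W C u" "null_homotopic R C D f"
  shows "null_homotopic R W D (\<lambda>i. f i \<circ> u i)"
  using homotopic_comp_right[OF assms(1), of D f "\<lambda>i x. \<zero>\<^bsub>obj D i\<^esub>"] assms(2)
  by (simp add: null_homotopic_def comp_def)

lemma null_homotopic_comp_left:
  assumes "cmap R D E v" "cmap R C D f" "null_homotopic R C D f"
  shows "null_homotopic R C E (\<lambda>i. v i \<circ> f i)"
proof -
  interpret v: cmap R D E v by fact
  interpret f: cmap R C D f by fact
  show ?thesis
    using homotopic_comp_left[OF assms(1,2) cmap_zero[OF cmap_bounded[OF assms(2)]]] assms(3)
    by (simp add: null_homotopic_def comp_def)
qed

lemma null_homotopic_cong:
  assumes "cmap R C D f" "cmap R C D g" "homotopic R C D f g" "null_homotopic R C D g"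
  shows "null_homotopic R C D f"
  using homotopic_trans[OF assms(1,2) cmap_zero[OF cmap_bounded[OF assms(1)]] assms(3)] assms(4)
  by (simp add: null_homotopic_def)

text \<open>A chain map \<open>E \<rightarrow> Y\<close> represents the zero morphism of the derived category precisely if it
  becomes null-homotopic after composition with some quasi-isomorphism.\<close>

definition kills ::
  "('a, 'r) ring_scheme \<Rightarrow> ('a, nat \<Rightarrow> 'b) cochain \<Rightarrow> ('a, nat \<Rightarrow> 'b) cochain \<Rightarrow>
    (int \<Rightarrow> (nat \<Rightarrow> 'b) \<Rightarrow> nat \<Rightarrow> 'b) \<Rightarrow> bool" where
  "kills R E Y f \<longleftrightarrow> (\<exists>W u. qis R W E u \<and> null_homotopic R W Y (\<lambda>i. f i \<circ> u i))"

text \<open>The Ore condition up to homotopy: a map and a quasi-isomorphism with common target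
  complete to a homotopy commutative square whose opposite side is again a
  quasi-isomorphism.\<close>

lemma hpullback_exists:
  fixes E E' C :: "('a, nat \<Rightarrow> 'b) cochain"
  assumes "cmap R E C s" "cmap R E' C s'"
  obtains W u v where "cmap R W E u" "cmap R W E' v" "homotopic R W C (\<lambda>i. s i \<circ> u i) (\<lambda>i. s' i \<circ> v i)"
    "qis R E' C s' \<longrightarrow> qis R W E u"
proof -
  interpret hpb R E E' C s s' using assms by (intro hpb.intro)
  have 1: "cmap R W E (\<lambda>i. ffst)" "cmap R W E' (\<lambda>i w. ffst (fsnd w))"
    by (intro cmapI bounded_complex_hpullback s.C.bounded_complex s'.C.bounded_complex chain_map_fst chain_map_snd)+
  moreover have "qis R E' C s' \<longrightarrow> qis R W E (\<lambda>i. ffst)"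
    using 1 hinj_fst hsurj_fst by (auto simp: qis_def)
  ultimately show thesis using homotopic_hpullback by (intro that)
qed

lemma killsI: "qis R W E u \<Longrightarrow> null_homotopic R W Y (\<lambda>i. f i \<circ> u i) \<Longrightarrow> kills R E Y f"
  unfolding kills_def by blast

lemma killsE:
  assumes "kills R E Y f"
  obtains W u where "qis R W E u" "null_homotopic R W Y (\<lambda>i. f i \<circ> u i)"
  using assms unfolding kills_def by blast

lemma kills_comp_qis:
  assumes "qis R W E u" "kills R W Y (\<lambda>i. f i \<circ> u i)"
  shows "kills R E Y f"
proof -
  obtain V w where w: "qis R V W w" "null_homotopic R V Y (\<lambda>i. f i \<circ> u i \<circ> w i)"
    by (rule killsE[OF assms(2)])
  show ?thesis
    by (rule killsI[OF qis_comp[OF w(1) assms(1)]]) (use w(2) in \<open>simp add: comp_assoc\<close>)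
qed

lemma kills_cong:
  assumes "cmap R E Y f" "cmap R E Y g" "homotopic R E Y f g" "kills R E Y g"
  shows "kills R E Y f"
proof -
  obtain W u where u: "qis R W E u" "null_homotopic R W Y (\<lambda>i. g i \<circ> u i)"
    by (rule killsE[OF assms(4)])
  have "null_homotopic R W Y (\<lambda>i. f i \<circ> u i)"
    using null_homotopic_cong[OF cmap_comp[OF qis_cmap[OF u(1)] assms(1)] cmap_comp[OF qis_cmap[OF u(1)] assms(2)]
      homotopic_comp_right[OF qis_cmap[OF u(1)] assms(3)] u(2)] .
  then show ?thesis by (rule killsI[OF u(1)])
qed

lemma kills_comp_left:
  assumes "kills R E Y f" "cmap R E Y f" "cmap R Y Z v"
  shows "kills R E Z (\<lambda>i. v i \<circ> f i)"
proof -
  obtain W u where u: "qis R W E u" "null_homotopic R W Y (\<lambda>i. f i \<circ> u i)"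
    by (rule killsE[OF assms(1)])
  have "null_homotopic R W Z (\<lambda>i. v i \<circ> (f i \<circ> u i))"
    by (rule null_homotopic_comp_left[OF assms(3) cmap_comp[OF qis_cmap[OF u(1)] assms(2)] u(2)])
  then show ?thesis by (intro killsI[OF u(1)]) (simp add: comp_assoc)
qed

text \<open>The quasi-isomorphism onto \<open>E\<close> that kills \<open>f\<close> is pulled back
  along \<open>p\<close> to one onto \<open>E'\<close>.\<close>

lemma kills_comp_right:
  assumes "kills R E Y f" "cmap R E Y f" "cmap R E' E p"
  shows "kills R E' Y (\<lambda>i. f i \<circ> p i)"
proof -
  obtain W u where u: "qis R W E u" "null_homotopic R W Y (\<lambda>i. f i \<circ> u i)"
    by (rule killsE[OF assms(1)])
  obtain V a b where V: "cmap R V E' a" "cmap R V W b" "homotopic R V E (\<lambda>i. p i \<circ> a i) (\<lambda>i. u i \<circ> b i)"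
    "qis R W E u \<longrightarrow> qis R V E' a"
    by (rule hpullback_exists[OF assms(3) qis_cmap[OF u(1)]])
  have pa: "cmap R V E (\<lambda>i. p i \<circ> a i)" and ub: "cmap R V E (\<lambda>i. u i \<circ> b i)"
    by (rule cmap_comp[OF V(1) assms(3)], rule cmap_comp[OF V(2) qis_cmap[OF u(1)]])
  have "null_homotopic R V Y (\<lambda>i. f i \<circ> (p i \<circ> a i))"
  proof (rule null_homotopic_cong[OF cmap_comp[OF pa assms(2)] cmap_comp[OF ub assms(2)]])
    show "homotopic R V Y (\<lambda>i. f i \<circ> (p i \<circ> a i)) (\<lambda>i. f i \<circ> (u i \<circ> b i))"
      by (rule homotopic_comp_left[OF assms(2) pa ub V(3)])
    show "null_homotopic R V Y (\<lambda>i. f i \<circ> (u i \<circ> b i))"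
      using null_homotopic_comp_right[OF V(2) u(2)] by (simp add: comp_assoc)
  qed
  then show ?thesis by (intro killsI[OF V(4)[rule_format, OF u(1)]]) (simp add: comp_assoc)
qed

text \<open>For exact \<open>Y\<close> the map from the zero complex is a quasi-isomorphism. Pulling
  it back along \<open>f\<close> gives a quasi-isomorphism onto \<open>E\<close> after which
  \<open>f\<close> is homotopic to a map through zero.\<close>

lemma kills_exact_target:
  fixes Y :: "('a, nat \<Rightarrow> 'b) cochain"
  assumes f: "cmap R E Y f" and Y: "\<And>i. cocycles Y i \<subseteq> coboundaries Y i"
  shows "kills R E Y f"
proof -
  interpret f: cmap R E Y f by fact
  let ?z = "\<lambda>i x. \<zero>\<^bsub>obj Y i\<^esub>"
  have z: "cmap R zero_complex Y ?z"
    by (intro cmap_zero bounded_complex_zero f.C.ring_R f.D.bounded_complex)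
  interpret Z: cplx R zero_complex
    using bounded_complex_zero[OF f.C.ring_R] by (simp add: cplx_def)
  have hs: "hsurj zero_complex Y ?z i" for i
    unfolding hsurj_def
  proof (intro ballI bexI)
    show "y \<ominus>\<^bsub>obj Y i\<^esub> \<zero>\<^bsub>obj Y i\<^esub> \<in> coboundaries Y i" if "y \<in> cocycles Y i" for y
      using f.D.cocycleD(1)[OF that] subsetD[OF Y that] by simp
  qed (rule Z.cocycleD(2))
  have hi: "hinj zero_complex Y ?z i" for i
    unfolding hinj_def by (intro ballI impI subsetD[OF zero_complex_exact])
  have q: "qis R zero_complex Y ?z"
    unfolding qis_def using z hs hi by (intro conjI allI)
  obtain W u v where W: "cmap R W E u" "cmap R W zero_complex v"
    "homotopic R W Y (\<lambda>i. f i \<circ> u i) (\<lambda>i. ?z i \<circ> v i)" "qis R zero_complex Y ?z \<longrightarrow> qis R W E u"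
    by (rule hpullback_exists[OF f z])
  then have "null_homotopic R W Y (\<lambda>i. f i \<circ> u i)" by (simp add: null_homotopic_def comp_def)
  then show ?thesis by (rule killsI[OF W(4)[rule_format, OF q]])
qed

text \<open>A null-homotopy of the composite makes \<open>g\<close> factor through the cocone
  \<open>P\<close> of \<open>t\<close>. As \<open>t\<close> is a quasi-isomorphism, \<open>P\<close>
  is exact, and maps into an exact complex are killed.\<close>

lemma kills_if_null_homotopic:
  fixes Y :: "('a, nat \<Rightarrow> 'b) cochain"
  assumes t: "qis R Y Y' t" and g: "cmap R W Y g" and null: "null_homotopic R W Y' (\<lambda>i. t i \<circ> g i)"
  shows "kills R W Y g"
proof -
  interpret t: cmap R Y Y' t by (rule qis_cmap[OF t])
  interpret g: cmap R W Y g by (rule g)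
  let ?z = "\<lambda>i x. \<zero>\<^bsub>obj Y' i\<^esub>"
  have z: "cmap R zero_complex Y' ?z"
    by (intro cmap_zero bounded_complex_zero t.C.ring_R t.D.bounded_complex)
  have hpb: "hpb R zero_complex Y Y' ?z t"
    by (intro hpb.intro z t.cmap_axioms)
  define P where "P = hpullback zero_complex ?z Y t Y'"
  note P_facts = hpb.bounded_complex_hpullback[OF hpb, folded P_def]
    hpb.chain_map_fst[OF hpb, folded P_def] hpb.chain_map_snd[OF hpb, folded P_def]
    bounded_complex_zero[OF t.C.ring_R]
  have P: "cocycles P i \<subseteq> coboundaries P i" for i
  proof
    fix w assume w: "w \<in> cocycles P i"
    \<comment> \<open>With \<open>t\<close> as the second leg, the projection of \<open>P\<close> to
      the zero complex is injective on cohomology, which makes \<open>P\<close> exact.\<close>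
    have "hinj P zero_complex (\<lambda>i. ffst) i" using t by (unfold P_def, intro hpb.hinj_fst[OF hpb]) (auto simp: qis_def)
    moreover have "ffst w \<in> coboundaries zero_complex i"
      by (rule subsetD[OF zero_complex_exact cmap.map_cocycle[OF cmapI[OF P_facts(1,4,2)] w]])
    ultimately show "w \<in> coboundaries P i" using w by (auto simp: hinj_def)
  qed
  \<comment> \<open>The pullback compares \<open>?z\<close> with \<open>t\<close> in this order, so
    the homotopy has to run from zero to the composite.\<close>
  have hz: "homotopic R W Y' (\<lambda>i x. \<zero>\<^bsub>obj Y' i\<^esub>) (\<lambda>i. t i \<circ> g i)"
    using null unfolding null_homotopic_def
    by (rule homotopic_sym[OF cmap_comp[OF g qis_cmap[OF t]] cmap_zero[OF g.C.bounded_complex t.D.bounded_complex]])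
  obtain h where h: "\<forall>i. h i \<in> mod_hom R (obj W i) (obj Y' (i - 1))"
    "\<forall>i. \<forall>x\<in>carrier (obj W i). \<zero>\<^bsub>obj Y' i\<^esub> \<ominus>\<^bsub>obj Y' i\<^esub> (t i \<circ> g i) x =
      diff Y' (i - 1) (h i x) \<oplus>\<^bsub>obj Y' i\<^esub> h (i + 1) (diff W i x)"
    using hz unfolding homotopic_def by (elim exE conjE) (rule that)
  let ?\<gamma> = "\<lambda>i x. fpair \<zero>\<^bsub>obj (zero_complex :: ('a, nat \<Rightarrow> 'b) cochain) i\<^esub> (fpair (g i x) (h i x))"
  have "chain_map R W P ?\<gamma>"
    using h by (unfold P_def, intro hpb.chain_map_pair[OF hpb] g cmap_zero g.C.bounded_complex P_facts(4)) simp_all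
  then have \<gamma>: "cmap R W P ?\<gamma>"
    by (intro cmapI g.C.bounded_complex P_facts(1))
  have "kills R W Y (\<lambda>i. (\<lambda>w. ffst (fsnd w)) \<circ> ?\<gamma> i)"
    by (rule kills_comp_left[OF kills_exact_target[OF \<gamma> P] \<gamma>])
      (intro cmapI P_facts t.C.bounded_complex)
  then show ?thesis by (simp add: comp_def)
qed

lemma kills_if_kills_qis_comp:
  fixes Y :: "('a, nat \<Rightarrow> 'b) cochain"
  assumes t: "qis R Y Y' t" and g: "cmap R W Y g" and "kills R W Y' (\<lambda>i. t i \<circ> g i)"
  shows "kills R W Y g"
proof -
  obtain V u where u: "qis R V W u" "null_homotopic R V Y' (\<lambda>i. t i \<circ> g i \<circ> u i)"
    by (rule killsE[OF assms(3)])
  show ?thesis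
    by (rule kills_comp_qis[OF u(1) kills_if_null_homotopic[OF t cmap_comp[OF qis_cmap[OF u(1)] g]]])
      (use u(2) in \<open>simp add: comp_assoc\<close>)
qed

subsection \<open>Truncation and vanishing\<close>

definition trunc_map :: "int \<Rightarrow> ('a, 'm) cochain \<Rightarrow> (int \<Rightarrow> 'm \<Rightarrow> 'm) \<Rightarrow> int \<Rightarrow> 'm \<Rightarrow> 'm" where
  "trunc_map a D f i x = trunc_proj a D i (f i x)"

lemma cmap_trunc_proj: "bounded_complex R C \<Longrightarrow> cmap R C (trunc a C) (trunc_proj a C)"
  using subcplx.bounded_complex_quot[OF subcplx_trunc] subcplx.chain_map_quot[OF subcplx_trunc]
  by (blast intro: cmapI)

lemma cmap_trunc_map:
  assumes "cmap R C D f"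
  shows "cmap R (trunc a C) (trunc a D) (trunc_map a D f)"
proof -
  interpret cmap R C D f by fact
  note sub = subcplx_trunc[OF C.bounded_complex] subcplx_trunc[OF D.bounded_complex]
  have "chain_map R (trunc a C) (trunc a D) (\<lambda>i x. trunc_proj a D i (f i x))"
    by (rule chain_map_induced(1)[OF sub chain_map trunc_sub_map[OF assms]])
  then show ?thesis
    unfolding trunc_map_def by (intro cmapI subcplx.bounded_complex_quot sub)
qed

lemma trunc_map_proj:
  assumes "cmap R C D f" "x \<in> carrier (obj C i)"
  shows "trunc_map a D f i (trunc_proj a C i x) = trunc_proj a D i (f i x)"
proof -
  interpret cmap R C D f by fact
  show ?thesis
    unfolding trunc_map_def
    by (rule chain_map_induced(2)[OF subcplx_trunc[OF C.bounded_complex] subcplx_trunc[OF D.bounded_complex]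
      chain_map trunc_sub_map[OF assms(1)] assms(2)])
qed

text \<open>The naturality square of the truncation commutes on carriers only, not as an equality of
  functions. As a homotopy it can be fed to \<open>kills_cong\<close> and
  \<open>homotopic_hinj\<close>.\<close>

lemma homotopic_trunc:
  assumes "cmap R C D f"
  shows "homotopic R C (trunc a D) (\<lambda>i. trunc_proj a D i \<circ> f i) (\<lambda>i. trunc_map a D f i \<circ> trunc_proj a C i)"
proof -
  note bc = cmap_bounded[OF assms]
  show ?thesis
    by (rule homotopic_eq[OF cmap_comp[OF assms cmap_trunc_proj[OF bc(2)], of a]
        cmap_comp[OF cmap_trunc_proj[OF bc(1)] cmap_trunc_map[OF assms], of a]])
      (simp add: trunc_map_proj[OF assms])
qed

text \<open>Below \<open>a\<close> both truncations are exact; from \<open>a\<close> on,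
  two-out-of-three in the naturality square applies. The hypothesis concerns degrees from
  \<open>a\<close> on because \<open>hom_zero_trunc\<close> uses a map that need not be a
  quasi-isomorphism below.\<close>

lemma qis_trunc_map:
  assumes w: "cmap R C D w" and hw: "\<And>i. i \<ge> a \<Longrightarrow> hinj C D w i \<and> hsurj C D w i"
  shows "qis R (trunc a C) (trunc a D) (trunc_map a D w)"
proof -
  interpret w: cmap R C D w by fact
  interpret qC: cmap R C "trunc a C" "trunc_proj a C" by (rule cmap_trunc_proj[OF w.C.bounded_complex])
  interpret qD: cmap R D "trunc a D" "trunc_proj a D" by (rule cmap_trunc_proj[OF w.D.bounded_complex])
  interpret t: cmap R "trunc a C" "trunc a D" "trunc_map a D w" by (rule cmap_trunc_map[OF w])
  interpret a: cmap2 R C D "trunc a D" w "trunc_proj a D" ..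
  interpret b: cmap2 R C "trunc a C" "trunc a D" "trunc_proj a C" "trunc_map a D w" ..
  note c = cmap_comp[OF w qD.cmap_axioms] cmap_comp[OF qC.cmap_axioms t.cmap_axioms] homotopic_trunc[OF w]
  have "hinj (trunc a C) (trunc a D) (trunc_map a D w) i \<and> hsurj (trunc a C) (trunc a D) (trunc_map a D w) i" for i
  proof (cases "i \<ge> a")
    case True
    have "hinj C (trunc a D) (\<lambda>i. trunc_proj a D i \<circ> w i) i" "hsurj C (trunc a D) (\<lambda>i. trunc_proj a D i \<circ> w i) i"
      using hw[OF True] hinj_trunc[OF w.D.bounded_complex True] hsurj_trunc[OF w.D.bounded_complex]
      by (auto intro: a.hinj_comp a.hsurj_comp)
    then have "hinj C (trunc a D) (\<lambda>i. trunc_map a D w i \<circ> trunc_proj a C i) i"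
      "hsurj C (trunc a D) (\<lambda>i. trunc_map a D w i \<circ> trunc_proj a C i) i"
      using homotopic_hinj[OF c] homotopic_hsurj[OF c] by auto
    then show ?thesis
      using b.hinj_left b.hsurj_left hsurj_trunc[OF w.C.bounded_complex] by blast
  next
    case False
    then have ex: "cocycles (trunc a C) i \<subseteq> coboundaries (trunc a C) i" "cocycles (trunc a D) i \<subseteq> coboundaries (trunc a D) i"
      by (auto intro!: trunc_exact w.C.bounded_complex w.D.bounded_complex del: subsetI)
    have "y \<ominus>\<^bsub>obj (trunc a D) i\<^esub> trunc_map a D w i \<zero>\<^bsub>obj (trunc a C) i\<^esub> \<in> coboundaries (trunc a D) i"
      if "y \<in> cocycles (trunc a D) i" for y
      using ex(2) qD.D.cocycleD(6)[OF that t.map_cocycle[OF qC.D.cocycleD(2)]] by blast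
    then show ?thesis using ex(1) qC.D.cocycleD(2)[of i] unfolding hinj_def hsurj_def by blast
  qed
  then show ?thesis using t.cmap_axioms by (simp add: qis_def)
qed

lemma qis_trunc_proj:
  assumes "bounded_complex R Y" "\<And>i. i < a \<Longrightarrow> cocycles Y i \<subseteq> coboundaries Y i"
  shows "qis R Y (trunc a Y) (trunc_proj a Y)"
proof -
  have "hinj Y (trunc a Y) (trunc_proj a Y) i" for i
    using assms(2)[of i] hinj_trunc[OF assms(1), of a i] by (cases "i < a") (auto simp: hinj_def)
  then show ?thesis using cmap_trunc_proj[OF assms(1)] hsurj_trunc[OF assms(1)] by (simp add: qis_def)
qed

text \<open>Cohomology of the truncation is a quotient of that of \<open>C\<close> in every degree.
  Hence truncating creates no cohomology above an upper bound.\<close>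

lemma trunc_exact':
  assumes C: "bounded_complex R C" and exact: "cocycles C i \<subseteq> coboundaries C i"
  shows "cocycles (trunc b C) i \<subseteq> coboundaries (trunc b C) i"
proof
  interpret q: cmap R C "trunc b C" "trunc_proj b C" by (rule cmap_trunc_proj[OF C])
  fix y assume y: "y \<in> cocycles (trunc b C) i"
  obtain x where x: "x \<in> cocycles C i" "y \<ominus>\<^bsub>obj (trunc b C) i\<^esub> trunc_proj b C i x \<in> coboundaries (trunc b C) i"
    using hsurj_trunc[OF C] y unfolding hsurj_def by blast
  have p: "trunc_proj b C i x \<in> coboundaries (trunc b C) i"
    by (rule q.map_coboundary[OF subsetD[OF exact x(1)]])
  show "y \<in> coboundaries (trunc b C) i"
    using q.D.coboundaryD(3)[OF x(2) p] q.D.M.diff_add_eq[OF q.D.cocycleD(1)[OF y] q.D.coboundaryD(1)[OF p]] by simp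
qed

text \<open>The orthogonality of the standard t-structure: up to a quasi-isomorphism on
  \<open>Y\<close>, the map factors through \<open>trunc b W\<close>, and this complex is exact in
  all degrees.\<close>

lemma kills_if_separated:
  fixes Y :: "('a, nat \<Rightarrow> 'b) cochain"
  assumes f: "cmap R W Y f"
    and W: "\<And>i. i \<ge> b \<Longrightarrow> cocycles W i \<subseteq> coboundaries W i"
    and Y: "\<And>i. i < b \<Longrightarrow> cocycles Y i \<subseteq> coboundaries Y i"
  shows "kills R W Y f"
proof -
  interpret f: cmap R W Y f by fact
  note q = cmap_trunc_proj[OF f.C.bounded_complex, of b] cmap_trunc_proj[OF f.D.bounded_complex, of b]
  have "cocycles (trunc b W) i \<subseteq> coboundaries (trunc b W) i" for i
    using W[of i] trunc_exact[OF f.C.bounded_complex, of i b] trunc_exact'[OF f.C.bounded_complex, of i b]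
    by (cases "i < b") (simp_all add: not_less)
  then have "kills R W (trunc b W) (trunc_proj b W)" by (rule kills_exact_target[OF q(1)])
  then have "kills R W (trunc b Y) (\<lambda>i. trunc_map b Y f i \<circ> trunc_proj b W i)"
    by (rule kills_comp_left[OF _ q(1) cmap_trunc_map[OF f]])
  then have "kills R W (trunc b Y) (\<lambda>i. trunc_proj b Y i \<circ> f i)"
    by (rule kills_cong[OF cmap_comp[OF f q(2)] cmap_comp[OF q(1) cmap_trunc_map[OF f]] homotopic_trunc[OF f]])
  moreover have "qis R Y (trunc b Y) (trunc_proj b Y)"
    by (rule qis_trunc_proj[OF f.D.bounded_complex]) (rule Y)
  ultimately show ?thesis by (intro kills_if_kills_qis_comp[OF _ f])
qed

text \<open>The projection of \<open>Y\<close> to its truncation is a quasi-isomorphism, and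
  \<open>f\<close> followed by it factors through the truncation of \<open>E\<close>.\<close>

lemma kills_if_kills_trunc:
  fixes Y :: "('a, nat \<Rightarrow> 'b) cochain"
  assumes f: "cmap R E Y f" and Y: "\<And>i. i < a \<Longrightarrow> cocycles Y i \<subseteq> coboundaries Y i"
    and k: "kills R (trunc a E) (trunc a Y) (trunc_map a Y f)"
  shows "kills R E Y f"
proof -
  interpret f: cmap R E Y f by fact
  note q = cmap_trunc_proj[OF f.C.bounded_complex, of a] cmap_trunc_proj[OF f.D.bounded_complex, of a]
  have "kills R E (trunc a Y) (\<lambda>i. trunc_map a Y f i \<circ> trunc_proj a E i)"
    by (rule kills_comp_right[OF k cmap_trunc_map[OF f] q(1)])
  then have "kills R E (trunc a Y) (\<lambda>i. trunc_proj a Y i \<circ> f i)"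
    by (rule kills_cong[OF cmap_comp[OF f q(2)] cmap_comp[OF q(1) cmap_trunc_map[OF f]] homotopic_trunc[OF f]])
  moreover have "qis R Y (trunc a Y) (trunc_proj a Y)"
    by (rule qis_trunc_proj[OF f.D.bounded_complex]) (rule Y)
  ultimately show ?thesis by (intro kills_if_kills_qis_comp[OF _ f])
qed

text \<open>Vanishing of all morphisms from \<open>B\<close> to \<open>Y\<close>, without
  equivalence classes: the second leg of every roof is killed. \<open>Hom_vanishes_iff\<close> makes
  the connection.\<close>

definition hom_zero ::
  "('a, 'r) ring_scheme \<Rightarrow> ('a, nat \<Rightarrow> 'b) cochain \<Rightarrow> ('a, nat \<Rightarrow> 'b) cochain \<Rightarrow> bool" where
  "hom_zero R B Y \<longleftrightarrow> (\<forall>E s f. qis R E B s \<longrightarrow> cmap R E Y f \<longrightarrow> kills R E Y f)"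

lemma hom_zeroI: "(\<And>E s f. qis R E B s \<Longrightarrow> cmap R E Y f \<Longrightarrow> kills R E Y f) \<Longrightarrow> hom_zero R B Y"
  by (simp add: hom_zero_def)

lemma hom_zeroD: "hom_zero R B Y \<Longrightarrow> qis R E B s \<Longrightarrow> cmap R E Y f \<Longrightarrow> kills R E Y f"
  unfolding hom_zero_def by blast

text \<open>Pulling \<open>f\<close> back along \<open>t\<close> replaces it by a map into
  \<open>Y\<close> without changing the source up to quasi-isomorphism.\<close>

lemma hom_zero_qis_target:
  assumes "hom_zero R Z Y" and t: "qis R Y Y' t"
  shows "hom_zero R Z Y'"
proof (rule hom_zeroI)
  fix E s f assume s: "qis R E Z s" and f: "cmap R E Y' f"
  obtain U u v where U: "cmap R U E u" "cmap R U Y v" "homotopic R U Y' (\<lambda>i. f i \<circ> u i) (\<lambda>i. t i \<circ> v i)"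
    "qis R Y Y' t \<longrightarrow> qis R U E u"
    by (rule hpullback_exists[OF f qis_cmap[OF t]])
  have u: "qis R U E u" using U(4) t by simp
  have "kills R U Y v" by (rule hom_zeroD[OF assms(1) qis_comp[OF u s] U(2)])
  then have "kills R U Y' (\<lambda>i. t i \<circ> v i)" by (rule kills_comp_left[OF _ U(2) qis_cmap[OF t]])
  then have "kills R U Y' (\<lambda>i. f i \<circ> u i)"
    by (rule kills_cong[OF cmap_comp[OF U(1) f] cmap_comp[OF U(2) qis_cmap[OF t]] U(3)])
  then show "kills R E Y' f" by (rule kills_comp_qis[OF u])
qed

text \<open>The adjunction between upper truncation and inclusion, for vanishing only. From left to
  right a roof over \<open>Z\<close> is truncated. From right to left a roof over the truncation is
  pulled back to \<open>Z\<close>, killed there, and the killing data are truncated.\<close>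

lemma hom_zero_trunc:
  fixes Z Y :: "('a, nat \<Rightarrow> 'b) cochain"
  assumes Z: "bounded_complex R Z" and Y: "bounded_complex R Y"
    and exact: "\<And>i. i < a \<Longrightarrow> cocycles Y i \<subseteq> coboundaries Y i"
  shows "hom_zero R (trunc a Z) Y \<longleftrightarrow> hom_zero R Z Y"
proof
  assume hz: "hom_zero R (trunc a Z) Y"
  have "qis R Y (trunc a Y) (trunc_proj a Y)" by (rule qis_trunc_proj[OF Y]) (rule exact)
  then have hz': "hom_zero R (trunc a Z) (trunc a Y)" by (rule hom_zero_qis_target[OF hz])
  show "hom_zero R Z Y"
  proof (rule hom_zeroI)
    fix E s f assume s: "qis R E Z s" and f: "cmap R E Y f"
    have "qis R (trunc a E) (trunc a Z) (trunc_map a Z s)"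
      by (rule qis_trunc_map[OF qis_cmap[OF s]]) (use s in \<open>simp add: qis_def\<close>)
    then have "kills R (trunc a E) (trunc a Y) (trunc_map a Y f)"
      by (rule hom_zeroD[OF hz' _ cmap_trunc_map[OF f]])
    then show "kills R E Y f" by (intro kills_if_kills_trunc[OF f exact])
  qed
next
  assume hz: "hom_zero R Z Y"
  show "hom_zero R (trunc a Z) Y"
  proof (rule hom_zeroI)
    fix E s f assume s: "qis R E (trunc a Z) s" and f: "cmap R E Y f"
    note q = cmap_trunc_proj[OF Z, of a]
    note E = cmap_bounded(1)[OF f]
    obtain E' u p where E': "cmap R E' Z u" "cmap R E' E p"
      "homotopic R E' (trunc a Z) (\<lambda>i. trunc_proj a Z i \<circ> u i) (\<lambda>i. s i \<circ> p i)"
      "qis R E (trunc a Z) s \<longrightarrow> qis R E' Z u"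
      by (rule hpullback_exists[OF q qis_cmap[OF s]])
    have u: "qis R E' Z u" using E'(4) s by simp
    have "kills R E' Y (\<lambda>i. f i \<circ> p i)" by (rule hom_zeroD[OF hz u cmap_comp[OF E'(2) f]])
    then obtain W w where w: "qis R W E' w" "null_homotopic R W Y (\<lambda>i. f i \<circ> p i \<circ> w i)" by (rule killsE)
    let ?v = "\<lambda>i. p i \<circ> w i"
    have v: "cmap R W E ?v" by (rule cmap_comp[OF qis_cmap[OF w(1)] E'(2)])
    \<comment> \<open>From degree \<open>a\<close> on, the projection of \<open>Z\<close> and
      \<open>u\<close> are isomorphisms on cohomology. The homotopic composite of \<open>p\<close>
      and \<open>s\<close> inherits this, and since \<open>s\<close> is a quasi-isomorphism so does
      \<open>p\<close>.\<close>
    have p_iso: "hinj E' E p i \<and> hsurj E' E p i" if "i \<ge> a" for i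
    proof -
      have "hinj E' (trunc a Z) (\<lambda>i. trunc_proj a Z i \<circ> u i) i \<and> hsurj E' (trunc a Z) (\<lambda>i. trunc_proj a Z i \<circ> u i) i"
        using cmap2.hinj_comp[OF cmap2.intro[OF E'(1) q]] cmap2.hsurj_comp[OF cmap2.intro[OF E'(1) q]]
          u hinj_trunc[OF Z that] hsurj_trunc[OF Z, of a i] by (auto simp: qis_def)
      moreover note c = cmap_comp[OF E'(1) q] cmap_comp[OF E'(2) qis_cmap[OF s]] E'(3)
      ultimately have "hinj E' (trunc a Z) (\<lambda>i. s i \<circ> p i) i \<and> hsurj E' (trunc a Z) (\<lambda>i. s i \<circ> p i) i"
        using homotopic_hinj[OF c] homotopic_hsurj[OF c] by blast
      then show ?thesis
        using cmap2.hinj_right[OF cmap2.intro[OF E'(2) qis_cmap[OF s]]]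
          cmap2.hsurj_right[OF cmap2.intro[OF E'(2) qis_cmap[OF s]]] s by (auto simp: qis_def)
    qed
    have "hinj W E ?v i \<and> hsurj W E ?v i" if "i \<ge> a" for i
      using p_iso[OF that] w(1) cmap2.hinj_comp[OF cmap2.intro[OF qis_cmap[OF w(1)] E'(2)]]
        cmap2.hsurj_comp[OF cmap2.intro[OF qis_cmap[OF w(1)] E'(2)]] by (auto simp: qis_def)
    \<comment> \<open>\<open>?v\<close> itself may fail to be a quasi-isomorphism below
      \<open>a\<close>; truncation makes those degrees exact.\<close>
    then have tv: "qis R (trunc a W) (trunc a E) (trunc_map a E ?v)" by (rule qis_trunc_map[OF v])
    have W: "bounded_complex R W" by (rule cmap_bounded(1)[OF v])
    have fv: "cmap R W Y (\<lambda>i. f i \<circ> ?v i)" by (rule cmap_comp[OF v f])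
    obtain h where h: "\<forall>i. h i \<in> mod_hom R (obj W i) (obj Y (i - 1))"
      "\<forall>i. \<forall>x\<in>carrier (obj W i). (f i \<circ> ?v i) x \<ominus>\<^bsub>obj Y i\<^esub> \<zero>\<^bsub>obj Y i\<^esub> =
         diff Y (i - 1) (h i x) \<oplus>\<^bsub>obj Y i\<^esub> h (i + 1) (diff W i x)"
      using w(2) unfolding null_homotopic_def homotopic_def comp_assoc by (elim exE conjE) (rule that)
    have "null_homotopic R (trunc a W) (trunc a Y) (trunc_map a Y (\<lambda>i. f i \<circ> ?v i))"
      unfolding null_homotopic_def trunc_map_def
      by (rule homotopic_induced[OF subcplx_trunc[OF W] subcplx_trunc[OF Y] cmap.chain_map[OF fv]])
        (use h trunc_sub_map[OF fv] trunc_sub_homotopy[OF W Y] in blast)+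
    moreover have "homotopic R (trunc a W) (trunc a Y)
      (\<lambda>i. trunc_map a Y f i \<circ> trunc_map a E ?v i) (trunc_map a Y (\<lambda>i. f i \<circ> ?v i))"
    proof (rule homotopic_eq[OF cmap_comp[OF cmap_trunc_map[OF v] cmap_trunc_map[OF f]] cmap_trunc_map[OF fv]])
      fix i x assume "x \<in> carrier (obj (trunc a W) i)"
      \<comment> \<open>Elements of a quotient module are chosen representatives, hence elements of
        \<open>W\<close> itself.\<close>
      then have "x \<in> carrier (obj W i)"
        unfolding subcplx.carrier_Q[OF subcplx_trunc[OF W]] using subcplx.q_carrier[OF subcplx_trunc[OF W]] by blast
      then have "?v i x \<in> carrier (obj E i)" by (rule cmap.closed[OF v])
      from trunc_map_proj[OF f this]
      show "(trunc_map a Y f i \<circ> trunc_map a E ?v i) x = trunc_map a Y (\<lambda>i. f i \<circ> ?v i) i x"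
        by (simp add: trunc_map_def)
    qed
    ultimately have "null_homotopic R (trunc a W) (trunc a Y) (\<lambda>i. trunc_map a Y f i \<circ> trunc_map a E ?v i)"
      by (intro null_homotopic_cong[OF cmap_comp[OF cmap_trunc_map[OF v] cmap_trunc_map[OF f]] cmap_trunc_map[OF fv]])
    then have "kills R (trunc a E) (trunc a Y) (trunc_map a Y f)" by (rule killsI[OF tv])
    then show "kills R E Y f" by (intro kills_if_kills_trunc[OF f exact])
  qed
qed

lemma qis_exact_source:
  assumes "qis R E B s" "cocycles B i \<subseteq> coboundaries B i"
  shows "cocycles E i \<subseteq> coboundaries E i"
proof
  fix x assume x: "x \<in> cocycles E i"
  have "s i x \<in> coboundaries B i"
    by (rule subsetD[OF assms(2) cmap.map_cocycle[OF qis_cmap[OF assms(1)] x]])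
  then show "x \<in> coboundaries E i" using assms(1) x by (auto simp: qis_def hinj_def)
qed

text \<open>The truncation \<open>\<tau>\<^sup><\<^sup>b Y\<close> as the cocone of \<open>Y \<rightarrow> \<tau>\<^sup>\<ge>\<^sup>b Y\<close>.  The usual subcomplex
  of cocycles would only consist of finitely generated modules over a noetherian ring.\<close>

definition lower_trunc :: "int \<Rightarrow> ('a, nat \<Rightarrow> 'b) cochain \<Rightarrow> ('a, nat \<Rightarrow> 'b) cochain" where
  "lower_trunc b Y = hpullback Y (trunc_proj b Y) zero_complex (\<lambda>i x. \<zero>\<^bsub>obj (trunc b Y) i\<^esub>) (trunc b Y)"

lemma hpb_lower_trunc:
  fixes Y :: "('a, nat \<Rightarrow> 'b) cochain"
  assumes "bounded_complex R Y"
  shows "hpb R Y zero_complex (trunc b Y) (trunc_proj b Y) (\<lambda>i x. \<zero>\<^bsub>obj (trunc b Y) i\<^esub>)"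
proof -
  note q = cmap_trunc_proj[OF assms, of b]
  have "ring R" using assms by (simp add: cplx.ring_R cplx_def)
  then show ?thesis
    by (intro hpb.intro q cmap_zero bounded_complex_zero cmap_bounded(2)[OF q])
qed

lemma bounded_complex_lower_trunc:
  fixes Y :: "('a, nat \<Rightarrow> 'b) cochain"
  shows "bounded_complex R Y \<Longrightarrow> bounded_complex R (lower_trunc b Y)"
  unfolding lower_trunc_def by (rule hpb.bounded_complex_hpullback[OF hpb_lower_trunc])

lemma cmap_lower_trunc:
  fixes Y :: "('a, nat \<Rightarrow> 'b) cochain"
  assumes "bounded_complex R Y"
  shows "cmap R (lower_trunc b Y) Y (\<lambda>i. ffst)"
  using hpb.chain_map_fst[OF hpb_lower_trunc[OF assms]] bounded_complex_lower_trunc[OF assms] assms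
  by (auto simp: lower_trunc_def intro: cmapI)

text \<open>From degree \<open>b\<close> on, the projection to \<open>trunc b Y\<close> is injective
  on cohomology, and it is surjective in every degree, so its cocone is exact there. The chase
  resembles \<open>hinj_fst\<close>, but now the first coordinate has to be corrected.\<close>

lemma lower_trunc_exact_above:
  fixes Y :: "('a, nat \<Rightarrow> 'b) cochain"
  assumes Y: "bounded_complex R Y" and i: "i \<ge> b"
  shows "cocycles (lower_trunc b Y) i \<subseteq> coboundaries (lower_trunc b Y) i"
proof
  interpret L: cplx R "lower_trunc b Y" using bounded_complex_lower_trunc[OF Y] by (simp add: cplx_def)
  interpret Y: cplx R Y using Y by (simp add: cplx_def)
  interpret q: cmap R Y "trunc b Y" "trunc_proj b Y" by (rule cmap_trunc_proj[OF Y])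
  let ?T = "trunc b Y"
  fix w assume w: "w \<in> cocycles (lower_trunc b Y) i"
  define x c where "x = ffst w" and "c = fsnd (fsnd w)"
  have w_eq: "w = fpair x (fpair undefined c)" and x [simp]: "x \<in> carrier (obj Y i)"
    and c [simp]: "c \<in> carrier (obj ?T (i - 1))"
    and dx: "diff Y i x = \<zero>\<^bsub>obj Y (i + 1)\<^esub>"
    and qx: "(trunc_proj b Y i x \<ominus>\<^bsub>obj ?T i\<^esub> \<zero>\<^bsub>obj ?T i\<^esub>) \<ominus>\<^bsub>obj ?T i\<^esub> diff ?T (i - 1) c = \<zero>\<^bsub>obj ?T i\<^esub>"
    using w by (simp_all add: x_def c_def lower_trunc_def cocycles_def eq_fpair_iff
      del: quot_complex_simps q.D.M.diff_zero)
  have dc: "diff ?T (i - 1) c \<in> carrier (obj ?T i)" using q.D.diff_closed[OF _ c] by simp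
  have qx_cl: "trunc_proj b Y i x \<in> carrier (obj ?T i)" by (rule q.closed[OF x])
  have qx': "trunc_proj b Y i x = diff ?T (i - 1) c"
    using qx q.D.M.diff_zero[OF qx_cl] q.D.M.diff_eq_zero_iff[OF qx_cl dc] by metis
  have xz: "x \<in> cocycles Y i" using dx by (simp add: cocycles_def)
  have "x \<in> coboundaries Y i"
    using hinj_trunc[OF Y i] xz qx' q.D.coboundaryI[OF _ c, of i] by (auto simp: hinj_def)
  then obtain x' where x': "x' \<in> carrier (obj Y (i - 1))" "x = diff Y (i - 1) x'" by (rule Y.coboundaryE)
  have qx'_cl: "trunc_proj b Y (i - 1) x' \<in> carrier (obj ?T (i - 1))" by (rule q.closed[OF x'(1)])
  have dqx': "diff ?T (i - 1) (trunc_proj b Y (i - 1) x') = diff ?T (i - 1) c"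
    using q.map_d[of i "i - 1" x'] x' qx' by simp
  \<comment> \<open>The error in the third coordinate for the primitive x'. It is a cocycle of the
    truncation; up to a coboundary it comes from a cocycle y of \<open>Y\<close>, and x' - y is the
    corrected primitive.\<close>
  let ?b = "trunc_proj b Y (i - 1) x' \<ominus>\<^bsub>obj ?T (i - 1)\<^esub> c"
  have b_cl: "?b \<in> carrier (obj ?T (i - 1))" by (rule q.D.M.minus_closed[OF qx'_cl c])
  have "diff ?T (i - 1) ?b = \<zero>\<^bsub>obj ?T (i - 1 + 1)\<^esub>"
    unfolding q.D.diff_diff[OF qx'_cl c] dqx' by (rule q.D.M.diff_self) (use dc in simp)
  then have "?b \<in> cocycles ?T (i - 1)" using b_cl by (simp add: cocycles_def)
  then obtain y where y: "y \<in> cocycles Y (i - 1)"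
    "?b \<ominus>\<^bsub>obj ?T (i - 1)\<^esub> trunc_proj b Y (i - 1) y \<in> coboundaries ?T (i - 1)"
    using hsurj_trunc[OF Y] unfolding hsurj_def by blast
  obtain e where e: "e \<in> carrier (obj ?T (i - 1 - 1))"
    "?b \<ominus>\<^bsub>obj ?T (i - 1)\<^esub> trunc_proj b Y (i - 1) y = diff ?T (i - 1 - 1) e"
    by (rule q.D.coboundaryE[OF y(2)])
  have yc: "y \<in> carrier (obj Y (i - 1))" and dy: "diff Y (i - 1) y = \<zero>\<^bsub>obj Y i\<^esub>"
    using y(1) by (simp_all add: cocycles_def)
  have qy_cl: "trunc_proj b Y (i - 1) y \<in> carrier (obj ?T (i - 1))" by (rule q.closed[OF yc])
  let ?x = "x' \<ominus>\<^bsub>obj Y (i - 1)\<^esub> y"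
  have x_cl: "?x \<in> carrier (obj Y (i - 1))" using x'(1) yc by simp
  have dxx: "diff Y (i - 1) ?x = x"
    using Y.diff_diff[OF x'(1) yc] by (simp add: dy x'(2)[symmetric])
  have "((trunc_proj b Y (i - 1) ?x \<ominus>\<^bsub>obj ?T (i - 1)\<^esub> \<zero>\<^bsub>obj ?T (i - 1)\<^esub>) \<ominus>\<^bsub>obj ?T (i - 1)\<^esub> diff ?T (i - 1 - 1) e) = c"
  proof -
    have "trunc_proj b Y (i - 1) ?x \<ominus>\<^bsub>obj ?T (i - 1)\<^esub> \<zero>\<^bsub>obj ?T (i - 1)\<^esub> = trunc_proj b Y (i - 1) ?x"
      by (rule q.D.M.diff_zero[OF q.closed[OF x_cl]])
    also have "\<dots> = trunc_proj b Y (i - 1) x' \<ominus>\<^bsub>obj ?T (i - 1)\<^esub> trunc_proj b Y (i - 1) y"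
      by (rule q.map_diff[OF x'(1) yc])
    finally have 1: "trunc_proj b Y (i - 1) ?x \<ominus>\<^bsub>obj ?T (i - 1)\<^esub> \<zero>\<^bsub>obj ?T (i - 1)\<^esub> = \<dots>" .
    have "?b \<ominus>\<^bsub>obj ?T (i - 1)\<^esub> trunc_proj b Y (i - 1) y =
      (trunc_proj b Y (i - 1) x' \<ominus>\<^bsub>obj ?T (i - 1)\<^esub> trunc_proj b Y (i - 1) y) \<ominus>\<^bsub>obj ?T (i - 1)\<^esub> c"
      using qx'_cl qy_cl c by (simp only: a_minus_def q.D.M.a_ac q.D.M.a_inv_closed)
    then show ?thesis
      unfolding 1 e(2)[symmetric] using q.D.M.diff_diff_self[OF q.D.M.minus_closed[OF qx'_cl qy_cl] c] by simp
  qed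
  then have "w = diff (lower_trunc b Y) (i - 1) (fpair ?x (fpair undefined e))"
    using dxx by (simp add: w_eq lower_trunc_def del: quot_complex_simps)
  moreover have "fpair ?x (fpair undefined e) \<in> carrier (obj (lower_trunc b Y) (i - 1))"
    using x_cl e(1) by (simp add: lower_trunc_def del: quot_complex_simps)
  ultimately show "w \<in> coboundaries (lower_trunc b Y) i" unfolding coboundaries_def by (rule image_eqI)
qed

text \<open>Injectivity of the cocone into \<open>Y\<close> in degree \<open>i\<close> needs the
  truncation to be exact in degree \<open>i - 1\<close>, hence the bound \<open>i \<le> b\<close>.
  Exactness of \<open>Y\<close> then carries over.\<close>

lemma lower_trunc_exact_below:
  fixes Y :: "('a, nat \<Rightarrow> 'b) cochain"
  assumes Y: "bounded_complex R Y" and i: "i \<le> b" and ex: "cocycles Y i \<subseteq> coboundaries Y i"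
  shows "cocycles (lower_trunc b Y) i \<subseteq> coboundaries (lower_trunc b Y) i"
proof
  fix w assume w: "w \<in> cocycles (lower_trunc b Y) i"
  interpret T: cplx R "trunc b Y" using cmap_bounded(2)[OF cmap_trunc_proj[OF Y]] by (simp add: cplx_def)
  interpret Z: cplx R "zero_complex :: ('a, nat \<Rightarrow> 'b) cochain"
    using bounded_complex_zero[OF T.ring_R] by (simp add: cplx_def)
  let ?z = "\<lambda>i x :: nat \<Rightarrow> 'b. \<zero>\<^bsub>obj (trunc b Y) i\<^esub>"
  have "hinj zero_complex (trunc b Y) ?z i"
    unfolding hinj_def by (intro ballI impI subsetD[OF zero_complex_exact])
  moreover have "hsurj zero_complex (trunc b Y) ?z (i - 1)"
    unfolding hsurj_def
  proof (intro ballI bexI)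
    fix y assume y: "y \<in> cocycles (trunc b Y) (i - 1)"
    show "y \<ominus>\<^bsub>obj (trunc b Y) (i - 1)\<^esub> \<zero>\<^bsub>obj (trunc b Y) (i - 1)\<^esub> \<in> coboundaries (trunc b Y) (i - 1)"
      using T.M.diff_zero[OF T.cocycleD(1)[OF y]] subsetD[OF trunc_exact[OF Y] y] i by simp
  qed (rule Z.cocycleD(2))
  ultimately have "hinj (lower_trunc b Y) Y (\<lambda>i. ffst) i"
    unfolding lower_trunc_def by (rule hpb.hinj_fst[OF hpb_lower_trunc[OF Y]])
  moreover have "ffst w \<in> coboundaries Y i"
    by (rule subsetD[OF ex cmap.map_cocycle[OF cmap_lower_trunc[OF Y] w]])
  ultimately show "w \<in> coboundaries (lower_trunc b Y) i" using w by (simp add: hinj_def)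
qed

text \<open>The dual adjunction. In the triangle formed by \<open>lower_trunc b Y\<close>,
  \<open>Y\<close> and \<open>trunc b Y\<close>, a complex with cohomology only below
  \<open>b\<close> has no nonzero morphisms to the third term nor to its shift by -1. The two
  directions of the proof use these two facts respectively.\<close>

lemma hom_zero_lower_trunc:
  fixes B Y :: "('a, nat \<Rightarrow> 'b) cochain"
  assumes Y: "bounded_complex R Y" and exact: "\<And>i. i \<ge> b \<Longrightarrow> cocycles B i \<subseteq> coboundaries B i"
  shows "hom_zero R B (lower_trunc b Y) \<longleftrightarrow> hom_zero R B Y"
proof
  let ?T = "trunc b Y"
  note q = cmap_trunc_proj[OF Y, of b]
  note hpb = hpb_lower_trunc[OF Y, of b]
  assume hz: "hom_zero R B (lower_trunc b Y)"
  show "hom_zero R B Y"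
  proof (rule hom_zeroI)
    fix E s f assume s: "qis R E B s" and f: "cmap R E Y f"
    \<comment> \<open>\<open>E\<close> has cohomology only below \<open>b\<close> and
      \<open>?T\<close> only from \<open>b\<close> on.\<close>
    have "kills R E ?T (\<lambda>i. trunc_proj b Y i \<circ> f i)"
      by (rule kills_if_separated[OF cmap_comp[OF f q], of b])
        (use qis_exact_source[OF s exact] trunc_exact[OF Y] in blast)+
    then obtain U u where u: "qis R U E u" "null_homotopic R U ?T (\<lambda>i. trunc_proj b Y i \<circ> f i \<circ> u i)"
      by (rule killsE)
    obtain h where h: "\<forall>i. h i \<in> mod_hom R (obj U i) (obj ?T (i - 1))"
      "\<forall>i. \<forall>x\<in>carrier (obj U i). (trunc_proj b Y i \<circ> f i \<circ> u i) x \<ominus>\<^bsub>obj ?T i\<^esub> \<zero>\<^bsub>obj ?T i\<^esub> =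
         diff ?T (i - 1) (h i x) \<oplus>\<^bsub>obj ?T i\<^esub> h (i + 1) (diff U i x)"
      using u(2) unfolding null_homotopic_def homotopic_def by (elim exE conjE) (rule that)
    have U: "bounded_complex R U" by (rule cmap_bounded(1)[OF qis_cmap[OF u(1)]])
    have fu: "cmap R U Y (\<lambda>i. f i \<circ> u i)" by (rule cmap_comp[OF qis_cmap[OF u(1)] f])
    have z: "cmap R U zero_complex (\<lambda>i x. undefined)"
      using cmap_zero[OF U bounded_complex_zero[of R]] U by (simp add: cplx.ring_R cplx_def)
    \<comment> \<open>The null-homotopy of the composite into \<open>?T\<close> is exactly the third
      coordinate needed to lift the map to the cocone.\<close>
    have "chain_map R U (lower_trunc b Y) (\<lambda>i x. fpair ((f i \<circ> u i) x) (fpair undefined (h i x)))"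
      unfolding lower_trunc_def
      by (rule hpb.chain_map_pair[OF hpb fu z]) (use h in \<open>simp_all del: quot_complex_simps\<close>)
    then have g: "cmap R U (lower_trunc b Y) (\<lambda>i x. fpair ((f i \<circ> u i) x) (fpair undefined (h i x)))"
      by (intro cmapI U bounded_complex_lower_trunc[OF Y])
    have "kills R U Y (\<lambda>i. ffst \<circ> (\<lambda>x. fpair ((f i \<circ> u i) x) (fpair undefined (h i x))))"
      by (rule kills_comp_left[OF hom_zeroD[OF hz qis_comp[OF u(1) s] g] g cmap_lower_trunc[OF Y]])
    then have "kills R U Y (\<lambda>i. f i \<circ> u i)" by (simp add: comp_def)
    then show "kills R E Y f" by (rule kills_comp_qis[OF u(1)])
  qed
next
  let ?T = "trunc b Y"
  assume hz: "hom_zero R B Y"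
  show "hom_zero R B (lower_trunc b Y)"
  proof (rule hom_zeroI)
    fix E s f assume s: "qis R E B s" and f: "cmap R E (lower_trunc b Y) f"
    have "kills R E Y (\<lambda>i. ffst \<circ> f i)"
      by (rule hom_zeroD[OF hz s cmap_comp[OF f cmap_lower_trunc[OF Y]]])
    then obtain U u where u: "qis R U E u" "null_homotopic R U Y (\<lambda>i. ffst \<circ> f i \<circ> u i)" by (rule killsE)
    define g where "g = (\<lambda>i. f i \<circ> u i)"
    have g: "cmap R U (lower_trunc b Y) g" unfolding g_def by (rule cmap_comp[OF qis_cmap[OF u(1)] f])
    obtain h where h: "\<forall>i. h i \<in> mod_hom R (obj U i) (obj Y (i - 1))"
      "\<forall>i. \<forall>x\<in>carrier (obj U i). (ffst \<circ> f i \<circ> u i) x \<ominus>\<^bsub>obj Y i\<^esub> \<zero>\<^bsub>obj Y i\<^esub> =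
         diff Y (i - 1) (h i x) \<oplus>\<^bsub>obj Y i\<^esub> h (i + 1) (diff U i x)"
      using u(2) unfolding null_homotopic_def homotopic_def by (elim exE conjE) (rule that)
    interpret Y: cplx R Y using Y by (simp add: cplx_def)
    interpret g: cmap R U "lower_trunc b Y" g by (rule g)
    interpret q: cmap R Y ?T "trunc_proj b Y" by (rule cmap_trunc_proj[OF Y])
    define g1 g3 where "g1 i x = ffst (g i x)" and "g3 i x = fsnd (fsnd (g i x))" for i x
    have cl: "g1 i x \<in> carrier (obj Y i)" "g3 i x \<in> carrier (obj ?T (i - 1))" "ffst (fsnd (g i x)) = undefined"
      "h i x \<in> carrier (obj Y (i - 1))"
      if "x \<in> carrier (obj U i)" for i x
      using g.closed[OF that] mod_homD(1)[OF h(1)[rule_format] that]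
      by (simp_all add: g1_def g3_def lower_trunc_def del: quot_complex_simps)
    have g_eq: "g i x = fpair (g1 i x) (fpair undefined (g3 i x))" if "x \<in> carrier (obj U i)" for i x
      using cl(3)[OF that] by (simp add: eq_fpair_iff g1_def g3_def)
    have g1: "g1 i x = diff Y (i - 1) (h i x) \<oplus>\<^bsub>obj Y i\<^esub> h (i + 1) (diff U i x)" if "x \<in> carrier (obj U i)" for i x
      using h(2)[rule_format, OF that] cl(1)[OF that] by (simp add: g1_def g_def)
    have g3d: "g3 (i + 1) (diff U i x) = trunc_proj b Y i (g1 i x) \<ominus>\<^bsub>obj ?T i\<^esub> diff ?T (i - 1) (g3 i x)"
      if x: "x \<in> carrier (obj U i)" for i x
    proof -
      have "g3 (i + 1) (diff U i x) =
         (trunc_proj b Y i (g1 i x) \<ominus>\<^bsub>obj ?T i\<^esub> \<zero>\<^bsub>obj ?T i\<^esub>) \<ominus>\<^bsub>obj ?T i\<^esub> diff ?T (i - 1) (g3 i x)"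
        unfolding g3_def[of "i + 1"] g.map_d[OF refl x]
        by (simp add: lower_trunc_def g1_def g3_def del: quot_complex_simps)
      then show ?thesis using q.D.M.diff_zero[OF q.closed[OF cl(1)[OF x]]] by simp
    qed
    \<comment> \<open>Subtracting from \<open>g\<close> the boundary of the homotopy with
      coordinates h, \<open>undefined\<close> and 0 cancels the first coordinate; \<open>k\<close>
      is what remains in the third.\<close>
    define k where "k i x = g3 i x \<ominus>\<^bsub>obj ?T (i - 1)\<^esub> trunc_proj b Y (i - 1) (h i x)" for i x
    have k_hom: "k i \<in> mod_hom R (obj U i) (obj ?T (i - 1))" for i
    proof -
      have "g3 i \<in> mod_hom R (obj U i) (obj ?T (i - 1))"
        using mod_homD[OF g.hom[of i]]
        by (intro mod_homI) (simp_all add: g3_def lower_trunc_def del: quot_complex_simps)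
      then show ?thesis
        unfolding k_def a_minus_def
        by (intro mod_hom_plus mod_hom_uminus mod_hom_comp[OF _ q.hom] q.D.left_module_obj h(1)[rule_format])
    qed
    \<comment> \<open>The third coordinate sits one degree lower and has differential -d, which is
      the shift by -1 together with its sign.\<close>
    let ?S = "shift (- 1) ?T"
    have S: "bounded_complex R ?S" by (rule bounded_complex_shift[OF q.D.bounded_complex])
    have k_d: "k (i + 1) (diff U i x) = diff ?S i (k i x)" if x: "x \<in> carrier (obj U i)" for i x
    proof -
      have dx: "diff U i x \<in> carrier (obj U (i + 1))" using x by simp
      have hdx: "h (i + 1) (diff U i x) \<in> carrier (obj Y i)" using cl(4)[OF dx] by simp
      have dhx: "diff Y (i - 1) (h i x) \<in> carrier (obj Y i)" using cl(4)[OF x] by simp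
      have dg3: "diff ?T (i - 1) (g3 i x) \<in> carrier (obj ?T i)" by (rule q.D.diff_closed) (simp_all add: cl(2)[OF x] del: quot_complex_simps)
      note qc = q.closed[OF hdx] q.closed[OF dhx]
      have "k (i + 1) (diff U i x) = (trunc_proj b Y i (g1 i x) \<ominus>\<^bsub>obj ?T i\<^esub> diff ?T (i - 1) (g3 i x))
        \<ominus>\<^bsub>obj ?T i\<^esub> trunc_proj b Y i (h (i + 1) (diff U i x))"
        unfolding k_def g3d[OF x] by simp
      also have "trunc_proj b Y i (g1 i x) = trunc_proj b Y i (diff Y (i - 1) (h i x)) \<oplus>\<^bsub>obj ?T i\<^esub> trunc_proj b Y i (h (i + 1) (diff U i x))"
        unfolding g1[OF x] by (rule q.map_add[OF dhx hdx])
      also have "((trunc_proj b Y i (diff Y (i - 1) (h i x)) \<oplus>\<^bsub>obj ?T i\<^esub> trunc_proj b Y i (h (i + 1) (diff U i x)))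
          \<ominus>\<^bsub>obj ?T i\<^esub> diff ?T (i - 1) (g3 i x)) \<ominus>\<^bsub>obj ?T i\<^esub> trunc_proj b Y i (h (i + 1) (diff U i x)) =
        trunc_proj b Y i (diff Y (i - 1) (h i x)) \<ominus>\<^bsub>obj ?T i\<^esub> diff ?T (i - 1) (g3 i x)"
        by (rule q.D.M.add_diff_diff_eq[OF qc(2,1) dg3])
      also have "\<dots> = \<ominus>\<^bsub>obj ?T i\<^esub> (diff ?T (i - 1) (g3 i x) \<ominus>\<^bsub>obj ?T i\<^esub> trunc_proj b Y i (diff Y (i - 1) (h i x)))"
        by (rule q.D.M.minus_diff[OF dg3 qc(2), symmetric])
      also have "trunc_proj b Y i (diff Y (i - 1) (h i x)) = diff ?T (i - 1) (trunc_proj b Y (i - 1) (h i x))"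
        by (rule q.map_d) (simp_all add: cl(4)[OF x])
      also have "diff ?T (i - 1) (g3 i x) \<ominus>\<^bsub>obj ?T i\<^esub> \<dots> = diff ?T (i - 1) (k i x)"
        unfolding k_def using q.D.diff_diff[OF cl(2)[OF x] q.closed[OF cl(4)[OF x]]] by simp
      finally show ?thesis by (simp add: diff_shift del: quot_complex_simps)
    qed
    have "chain_map R U ?S k"
      unfolding chain_map_def using k_hom k_d by (simp add: obj_shift del: quot_complex_simps)
    then have k: "cmap R U ?S k" by (intro cmapI g.C.bounded_complex S)
    \<comment> \<open>\<open>U\<close> has cohomology only below \<open>b\<close>, while
      \<open>?S\<close>, which is \<open>?T\<close> moved up by one degree, has it only above
      \<open>b\<close>.\<close>
    have kk: "kills R U ?S k"
    proof (rule kills_if_separated[OF k, of b])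
      show "cocycles U i \<subseteq> coboundaries U i" if "b \<le> i" for i
        by (rule qis_exact_source[OF qis_comp[OF u(1) s] exact[OF that]])
      show "cocycles ?S i \<subseteq> coboundaries ?S i" if "i < b" for i
        using trunc_exact[OF Y, of "i - 1" b] that
        by (simp add: cocycles_shift[OF q.D.bounded_complex] coboundaries_shift[OF q.D.bounded_complex])
    qed
    \<comment> \<open>The inclusion of the third coordinate, that is, the map of the triangle from
      the shift of \<open>trunc b Y\<close> into the cocone.\<close>
    define j where "j i c = fpair \<zero>\<^bsub>obj Y i\<^esub> (fpair undefined c)" for i and c :: "nat \<Rightarrow> 'b"
    have jk: "cmap R ?S (lower_trunc b Y) j"
    proof (intro cmapI S g.D.bounded_complex, unfold chain_map_def, intro conjI allI ballI)
      interpret S: cplx R ?S using S by (simp add: cplx_def)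
      show "j i \<in> mod_hom R (obj ?S i) (obj (lower_trunc b Y) i)" for i
        using left_module.smult_zero[OF Y.left_module_obj]
        by (intro mod_homI) (simp_all add: j_def obj_shift lower_trunc_def del: quot_complex_simps)
      fix i c assume c: "c \<in> carrier (obj ?S i)"
      have dc: "diff ?T (i - 1) c \<in> carrier (obj ?T i)"
        using c by (intro q.D.diff_closed) (simp_all add: obj_shift del: quot_complex_simps)
      have q0: "trunc_proj b Y i \<zero>\<^bsub>obj Y i\<^esub> = \<zero>\<^bsub>obj ?T i\<^esub>" by (rule q.map_zero)
      show "j (i + 1) (diff ?S i c) = diff (lower_trunc b Y) i (j i c)"
        using dc by (simp add: j_def lower_trunc_def diff_shift q0 q.D.M.zero_diff[OF dc] del: quot_complex_simps)
    qed
    have hom: "homotopic R U (lower_trunc b Y) g (\<lambda>i. j i \<circ> k i)"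
    proof (rule homotopicI[where h = "\<lambda>i x. fpair (h i x) (fpair undefined \<zero>\<^bsub>obj ?T (i - 1 - 1)\<^esub>)"])
      show "(\<lambda>x. fpair (h i x) (fpair undefined \<zero>\<^bsub>obj ?T (i - 1 - 1)\<^esub>)) \<in> mod_hom R (obj U i) (obj (lower_trunc b Y) (i - 1))" for i
        using mod_homD[OF h(1)[rule_format, of i]] left_module.smult_zero[OF q.D.left_module_obj]
        by (intro mod_homI) (simp_all add: lower_trunc_def del: quot_complex_simps)
      fix i x assume x: "x \<in> carrier (obj U i)"
      have dx: "diff U i x \<in> carrier (obj U (i + 1))" using x by simp
      have hdx: "h (i + 1) (diff U i x) \<in> carrier (obj Y i)" using cl(4)[OF dx] by simp
      have dhx: "diff Y (i - 1) (h i x) \<in> carrier (obj Y i)" using cl(4)[OF x] by simp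
      have qh: "trunc_proj b Y (i - 1) (h i x) \<in> carrier (obj ?T (i - 1))" by (rule q.closed[OF cl(4)[OF x]])
      have kx: "k i x \<in> carrier (obj ?T (i - 1))" by (rule mod_homD(1)[OF k_hom x])
      have jkx: "j i (k i x) \<in> carrier (obj (lower_trunc b Y) i)"
        using kx by (simp add: j_def lower_trunc_def del: quot_complex_simps)
      let ?H = "fpair (h i x) (fpair undefined \<zero>\<^bsub>obj ?T (i - 1 - 1)\<^esub>)"
      let ?H' = "fpair (h (i + 1) (diff U i x)) (fpair undefined \<zero>\<^bsub>obj ?T (i + 1 - 1 - 1)\<^esub>)"
      have d0: "diff ?T (i - 1 - 1) \<zero>\<^bsub>obj ?T (i - 1 - 1)\<^esub> = \<zero>\<^bsub>obj ?T (i - 1)\<^esub>"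
        using q.D.diff_zero'[of "i - 1 - 1"] by simp
      have dH: "diff (lower_trunc b Y) (i - 1) ?H =
        fpair (diff Y (i - 1) (h i x)) (fpair undefined (trunc_proj b Y (i - 1) (h i x)))"
        using q.D.M.diff_zero[OF qh] by (simp add: lower_trunc_def d0[simplified] del: quot_complex_simps)
      have "(diff (lower_trunc b Y) (i - 1) ?H \<oplus>\<^bsub>obj (lower_trunc b Y) i\<^esub> ?H') \<oplus>\<^bsub>obj (lower_trunc b Y) i\<^esub> j i (k i x)
        = fpair (g1 i x) (fpair undefined (g3 i x))"
      proof -
        have "trunc_proj b Y (i - 1) (h i x) \<oplus>\<^bsub>obj ?T (i - 1)\<^esub> k i x = g3 i x"
          unfolding k_def using q.D.M.diff_add_eq[OF cl(2)[OF x] qh] q.D.M.a_comm[OF qh q.D.M.minus_closed[OF cl(2)[OF x] qh]] by simp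
        then show ?thesis
          unfolding dH using g1[OF x] cl(1)[OF x] q.D.M.r_zero[OF qh] hdx dhx
          by (simp add: lower_trunc_def j_def del: quot_complex_simps)
      qed
      then have eq: "g i x = (diff (lower_trunc b Y) (i - 1) ?H \<oplus>\<^bsub>obj (lower_trunc b Y) i\<^esub> ?H') \<oplus>\<^bsub>obj (lower_trunc b Y) i\<^esub> j i (k i x)"
        using g_eq[OF x] by simp
      have "diff (lower_trunc b Y) (i - 1) ?H \<oplus>\<^bsub>obj (lower_trunc b Y) i\<^esub> ?H' \<in> carrier (obj (lower_trunc b Y) i)"
        unfolding dH using hdx dhx qh q.D.M.r_zero[OF qh] by (simp add: lower_trunc_def del: quot_complex_simps)
      then show "g i x \<ominus>\<^bsub>obj (lower_trunc b Y) i\<^esub> (j i \<circ> k i) x =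
        diff (lower_trunc b Y) (i - 1) ?H \<oplus>\<^bsub>obj (lower_trunc b Y) i\<^esub> ?H'"
        unfolding eq using g.D.M.add_diff_eq[OF _ jkx] by simp
    qed
    have "kills R U (lower_trunc b Y) (\<lambda>i. j i \<circ> k i)" by (rule kills_comp_left[OF kk k jk])
    then have "kills R U (lower_trunc b Y) g" by (rule kills_cong[OF g cmap_comp[OF k jk] hom])
    then show "kills R E (lower_trunc b Y) f" unfolding g_def by (rule kills_comp_qis[OF u(1)])
  qed
qed

section \<open>Shifting both arguments\<close>

lemma hom_zero_same_complex:
  fixes B Y :: "('a, nat \<Rightarrow> 'b) cochain"
  assumes hz: "hom_zero R B Y" and B: "same_complex B' B" and Y: "same_complex Y Y'"
    and bc: "bounded_complex R B" "bounded_complex R Y"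
  shows "hom_zero R B' Y'"
proof (rule hom_zeroI)
  fix E s f assume s: "qis R E B' s" and f: "cmap R E Y' f"
  have E: "bounded_complex R E" by (rule cmap_bounded(1)[OF f])
  have "chain_map R E B s"
    using cmap.chain_map[OF qis_cmap[OF s]] by (simp add: same_complex_chain_map[OF B])
  then have "qis R E B s"
    using s by (simp add: qis_def same_complex_hinj[OF B] cmapI[OF E bc(1)])
  moreover have "cmap R E Y f"
    using cmap.chain_map[OF f] by (intro cmapI E bc) (simp add: same_complex_chain_map[OF Y])
  ultimately have "kills R E Y f" by (rule hom_zeroD[OF hz])
  then obtain W u where u: "qis R W E u" "null_homotopic R W Y (\<lambda>i. f i \<circ> u i)" by (rule killsE)
  have "null_homotopic R W Y' (\<lambda>i. f i \<circ> u i)"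
    using same_complex_homotopic[OF Y] u(2) Y by (simp add: null_homotopic_def same_complex_def)
  then show "kills R E Y' f" by (rule killsI[OF u(1)])
qed

lemma qis_shift:
  assumes "qis R C D f"
  shows "qis R (shift k C) (shift k D) (\<lambda>i. f (i + k))"
  using assms hinj_shift[OF cmap_bounded[OF qis_cmap[OF assms]]] cmap_shift[OF qis_cmap[OF assms]]
  by (simp add: qis_def)

lemma qis_same_complex_target:
  assumes "qis R E C f" "same_complex C D" "bounded_complex R D"
  shows "qis R E D f"
  using assms cmap.chain_map[OF qis_cmap[OF assms(1)]] cmap_bounded(1)[OF qis_cmap[OF assms(1)]]
  by (simp add: qis_def same_complex_hinj[OF assms(2)] same_complex_chain_map[OF assms(2)] cmapI)

lemma cmap_same_complex_target:
  assumes "cmap R E C f" "same_complex C D" "bounded_complex R D"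
  shows "cmap R E D f"
  using cmap.chain_map[OF assms(1)] cmap_bounded(1)[OF assms(1)] assms(3)
  by (simp add: same_complex_chain_map[OF assms(2)] cmapI)

text \<open>A roof is moved back by \<open>- k\<close>, killed there, and the killing
  quasi-isomorphism is moved forward by \<open>k\<close>.\<close>

lemma hom_zero_shift:
  fixes B Y :: "('a, nat \<Rightarrow> 'b) cochain"
  assumes hz: "hom_zero R B Y" and bc: "bounded_complex R B" "bounded_complex R Y"
  shows "hom_zero R (shift k B) (shift k Y)"
proof (rule hom_zeroI)
  fix E s f assume s: "qis R E (shift k B) s" and f: "cmap R E (shift k Y) f"
  have E: "bounded_complex R E" by (rule cmap_bounded(1)[OF f])
  let ?E = "shift (- k) E"
  have "qis R ?E B (\<lambda>i. s (i + - k))"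
    by (rule qis_same_complex_target[OF qis_shift[OF s] same_complex_shift_shift[OF bc(1)] bc(1)]) simp
  moreover have f': "cmap R ?E Y (\<lambda>i. f (i + - k))"
    by (rule cmap_same_complex_target[OF cmap_shift[OF f] same_complex_shift_shift[OF bc(2)] bc(2)]) simp
  ultimately have "kills R ?E Y (\<lambda>i. f (i + - k))" by (rule hom_zeroD[OF hz])
  then obtain W u where u: "qis R W ?E u" "null_homotopic R W Y (\<lambda>i. f (i + - k) \<circ> u i)" by (rule killsE)
  have "qis R (shift k W) E (\<lambda>i. u (i + k))"
    by (rule qis_same_complex_target[OF qis_shift[OF u(1)] same_complex_shift_shift[OF E refl] E])
  moreover have "null_homotopic R (shift k W) (shift k Y) (\<lambda>i. f i \<circ> u (i + k))"
    using homotopic_shift[OF cmap_bounded(1)[OF qis_cmap[OF u(1)]] bc(2) u(2)[unfolded null_homotopic_def], of k]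
    by (simp add: null_homotopic_def obj_shift)
  ultimately show "kills R E (shift k Y) f" by (rule killsI)
qed

text \<open>Both sides differ by shifting source and target simultaneously; the resulting double
  shift returns the original complex only up to \<open>same_complex\<close>.\<close>

lemma hom_zero_shift_adjoint:
  fixes B Y :: "('a, nat \<Rightarrow> 'b) cochain"
  assumes bc: "bounded_complex R B" "bounded_complex R Y"
  shows "hom_zero R (shift (- k) B) Y \<longleftrightarrow> hom_zero R B (shift k Y)"
proof
  note sb = bounded_complex_shift
  have refl: "same_complex C C" for C :: "('a, nat \<Rightarrow> 'b) cochain" by (simp add: same_complex_def)
  assume "hom_zero R (shift (- k) B) Y"
  then have "hom_zero R (shift k (shift (- k) B)) (shift k Y)" by (rule hom_zero_shift[OF _ sb[OF bc(1)] bc(2)])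
  then show "hom_zero R B (shift k Y)"
    by (rule hom_zero_same_complex[OF _ same_complex_sym[OF same_complex_shift_shift[OF bc(1) HOL.refl]] refl
        sb[OF sb[OF bc(1)]] sb[OF bc(2)]])
next
  note sb = bounded_complex_shift
  have refl: "same_complex C C" for C :: "('a, nat \<Rightarrow> 'b) cochain" by (simp add: same_complex_def)
  assume "hom_zero R B (shift k Y)"
  then have "hom_zero R (shift (- k) B) (shift (- k) (shift k Y))" by (rule hom_zero_shift[OF _ bc(1) sb[OF bc(2)]])
  then show "hom_zero R (shift (- k) B) Y"
    by (rule hom_zero_same_complex[OF _ refl same_complex_shift_shift[OF bc(2)] sb[OF bc(1)] sb[OF sb[OF bc(2)]]]) simp
qed

section \<open>Roofs and vanishing morphism sets\<close>

lemma quasi_iso_iff_qis: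
  "bounded_complex R C \<Longrightarrow> bounded_complex R D \<Longrightarrow> quasi_iso R C D f \<longleftrightarrow> qis R C D f"
  by (auto simp: quasi_iso_iff qis_def intro: cmapI dest: cmap.chain_map)

lemma chain_map_iff_cmap:
  "bounded_complex R C \<Longrightarrow> bounded_complex R D \<Longrightarrow> chain_map R C D f \<longleftrightarrow> cmap R C D f"
  by (auto intro: cmapI dest: cmap.chain_map)

lemma roofs_iff:
  assumes "bounded_complex R C" "bounded_complex R D"
  shows "(E, s, f) \<in> roofs R C D \<longleftrightarrow> qis R E C s \<and> cmap R E D f"
proof (cases "bounded_complex R E")
  case True
  then show ?thesis
    using assms by (simp add: roofs_def Db_objects_def quasi_iso_iff_qis chain_map_iff_cmap)
next
  case False
  then show ?thesis using cmap_bounded(1)[of R E D f] by (auto simp: roofs_def Db_objects_def)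
qed

lemma zero_roof:
  assumes "bounded_complex R C" "bounded_complex R D"
  shows "(C, (\<lambda>i x. x), (\<lambda>i x. \<zero>\<^bsub>obj D i\<^esub>)) \<in> roofs R C D"
  using assms by (simp add: roofs_iff qis_id cmap_zero)

lemma roof_equiv_refl:
  assumes bc: "bounded_complex R C" "bounded_complex R D" and r: "(E, s, f) \<in> roofs R C D"
  shows "((E, s, f), (E, s, f)) \<in> roof_equiv R C D"
proof -
  have sf: "qis R E C s" "cmap R E D f" using r by (simp_all add: roofs_iff[OF bc])
  have E: "bounded_complex R E" by (rule cmap_bounded(1)[OF sf(2)])
  have id: "(\<lambda>i. g i \<circ> (\<lambda>x. x)) = g" for g :: "int \<Rightarrow> (nat \<Rightarrow> 'a) \<Rightarrow> nat \<Rightarrow> 'a" by (simp add: comp_def)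
  show ?thesis
    unfolding roof_equiv_def
    using r E chain_map_id homotopic_refl[OF qis_cmap[OF sf(1)]] homotopic_refl[OF sf(2)] sf(1)
    by (auto simp: Db_objects_def id quasi_iso_iff_qis[OF E bc(1)]
        intro!: exI[of _ E] exI[of _ "\<lambda>i x. x"])
qed

text \<open>Being equivalent to the zero roof yields a refinement that kills the second leg.
  Conversely, when all second legs are killed, any two roofs become equivalent on a common
  refinement, so there is a single class.\<close>

lemma Hom_vanishes_iff:
  assumes bc: "bounded_complex R C" "bounded_complex R D"
  shows "Hom_vanishes R C D \<longleftrightarrow> hom_zero R C D"
proof
  assume "Hom_vanishes R C D"
  then have single: "c = Db_zero R C D" if "c \<in> Db_Hom R C D" for c
    using that by (simp add: Hom_vanishes_def)
  show "hom_zero R C D"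
  proof (rule hom_zeroI)
    fix E s f assume s: "qis R E C s" and f: "cmap R E D f"
    then have r: "(E, s, f) \<in> roofs R C D" by (simp add: roofs_iff[OF bc])
    then have "roof_equiv R C D `` {(E, s, f)} = Db_zero R C D"
      by (intro single) (simp add: Db_Hom_def quotientI)
    \<comment> \<open>Reflexivity puts the roof into its own class, which is the class of the zero
      roof.\<close>
    then have "(E, s, f) \<in> Db_zero R C D" using roof_equiv_refl[OF bc r] by blast
    then obtain W u v where W: "W \<in> Db_objects R" "chain_map R W C u" "chain_map R W E v"
      "quasi_iso R W C (\<lambda>i. (\<lambda>x. x) \<circ> u i)" "homotopic R W C (\<lambda>i. (\<lambda>x. x) \<circ> u i) (\<lambda>i. s i \<circ> v i)"
      "homotopic R W D (\<lambda>i. (\<lambda>x. \<zero>\<^bsub>obj D i\<^esub>) \<circ> u i) (\<lambda>i. f i \<circ> v i)"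
      unfolding Db_zero_def roof_equiv_def by blast
    have Wb: "bounded_complex R W" using W(1) by (simp add: Db_objects_def)
    have v: "cmap R W E v" by (rule cmapI[OF Wb cmap_bounded(1)[OF f] W(3)])
    have u: "qis R W C u" using W(4) by (simp add: quasi_iso_iff_qis[OF Wb bc(1)] comp_def)
    have usv: "cmap R W C u" "cmap R W C (\<lambda>i. s i \<circ> v i)" "homotopic R W C u (\<lambda>i. s i \<circ> v i)"
      using qis_cmap[OF u] cmap_comp[OF v qis_cmap[OF s]] W(5) by (simp_all add: comp_def)
    \<comment> \<open>The definition makes the leg \<open>u\<close> from \<open>W\<close> to
      \<open>C\<close> a quasi-isomorphism. It is homotopic to the composite of \<open>v\<close> and
      \<open>s\<close>, so two-out-of-three shows that \<open>v\<close> is one too.\<close>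
    interpret sv: cmap2 R W E C v s by (intro cmap2.intro v qis_cmap[OF s])
    have "hinj W C (\<lambda>i. s i \<circ> v i) i \<and> hsurj W C (\<lambda>i. s i \<circ> v i) i" for i
      using homotopic_hinj[OF usv] homotopic_hsurj[OF usv] u by (auto simp: qis_def)
    then have "qis R W E v"
      using v sv.hinj_right sv.hsurj_right s by (auto simp: qis_def)
    moreover have "null_homotopic R W D (\<lambda>i. f i \<circ> v i)"
      unfolding null_homotopic_def
      using W(6) by (intro homotopic_sym[OF cmap_zero[OF Wb bc(2)] cmap_comp[OF v f]]) (simp add: comp_def)
    ultimately show "kills R E D f" by (rule killsI)
  qed
next
  assume hz: "hom_zero R C D"
  have eq: "((E, s, f), (E', s', f')) \<in> roof_equiv R C D"
    if r: "(E, s, f) \<in> roofs R C D" "(E', s', f') \<in> roofs R C D" for E s f E' s' f'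
  proof -
    have s: "qis R E C s" "cmap R E D f" and s': "qis R E' C s'" "cmap R E' D f'"
      using r by (simp_all add: roofs_iff[OF bc])
    obtain P a b where P: "cmap R P E a" "cmap R P E' b" "homotopic R P C (\<lambda>i. s i \<circ> a i) (\<lambda>i. s' i \<circ> b i)"
      "qis R E' C s' \<longrightarrow> qis R P E a"
      by (rule hpullback_exists[OF qis_cmap[OF s(1)] qis_cmap[OF s'(1)]])
    have a: "qis R P E a" using P(4) s'(1) by simp
    have sa: "qis R P C (\<lambda>i. s i \<circ> a i)" by (rule qis_comp[OF a s(1)])
    \<comment> \<open>The refinement is built in two stages: \<open>v\<close> kills the second leg
      of the first roof, then \<open>w\<close> that of the other, and the first remains
      null-homotopic.\<close>
    obtain V v where v: "qis R V P v" "null_homotopic R V D (\<lambda>i. f i \<circ> a i \<circ> v i)"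
      by (rule killsE[OF hom_zeroD[OF hz sa cmap_comp[OF P(1) s(2)]]])
    obtain W w where w: "qis R W V w" "null_homotopic R W D (\<lambda>i. f' i \<circ> (b i \<circ> v i) \<circ> w i)"
      by (rule killsE[OF hom_zeroD[OF hz qis_comp[OF v(1) sa]
        cmap_comp[OF cmap_comp[OF qis_cmap[OF v(1)] P(2)] s'(2)]]])
    have Wb: "bounded_complex R W" by (rule cmap_bounded(1)[OF qis_cmap[OF w(1)]])
    have vw: "qis R W P (\<lambda>i. v i \<circ> w i)" by (rule qis_comp[OF w(1) v(1)])
    let ?u = "\<lambda>i. a i \<circ> (v i \<circ> w i)" and ?v = "\<lambda>i. b i \<circ> (v i \<circ> w i)"
    have u: "qis R W E ?u" and v': "cmap R W E' ?v"
      by (rule qis_comp[OF vw a], rule cmap_comp[OF qis_cmap[OF vw] P(2)])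
    have n1: "null_homotopic R W D (\<lambda>i. f i \<circ> ?u i)"
      using null_homotopic_comp_right[OF qis_cmap[OF w(1)] v(2)] by (simp add: comp_assoc)
    have n2: "null_homotopic R W D (\<lambda>i. f' i \<circ> ?v i)" using w(2) by (simp add: comp_assoc)
    have fu: "cmap R W D (\<lambda>i. f i \<circ> ?u i)" by (rule cmap_comp[OF qis_cmap[OF u] s(2)])
    have fv: "cmap R W D (\<lambda>i. f' i \<circ> ?v i)" by (rule cmap_comp[OF v' s'(2)])
    have z: "cmap R W D (\<lambda>i x. \<zero>\<^bsub>obj D i\<^esub>)" by (rule cmap_zero[OF Wb bc(2)])
    have "homotopic R W D (\<lambda>i. f i \<circ> ?u i) (\<lambda>i. f' i \<circ> ?v i)"
      by (rule homotopic_trans[OF fu z fv n1[unfolded null_homotopic_def]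
        homotopic_sym[OF fv z n2[unfolded null_homotopic_def]]])
    moreover have "homotopic R W C (\<lambda>i. s i \<circ> ?u i) (\<lambda>i. s' i \<circ> ?v i)"
      using homotopic_comp_right[OF qis_cmap[OF vw] P(3)] by (simp add: comp_assoc)
    moreover have "quasi_iso R W C (\<lambda>i. s i \<circ> ?u i)"
      using qis_comp[OF u s(1)] by (simp add: quasi_iso_iff_qis[OF Wb bc(1)])
    moreover have "W \<in> Db_objects R" "chain_map R W E ?u" "chain_map R W E' ?v"
      using Wb cmap.chain_map[OF qis_cmap[OF u]] cmap.chain_map[OF v'] by (simp_all add: Db_objects_def)
    ultimately show ?thesis using r unfolding roof_equiv_def by blast
  qed
  \<comment> \<open>Every class is the full set of roofs, so the quotient has exactly one element,
    nonempty by \<open>zero_roof\<close>.\<close>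
  have "roof_equiv R C D `` {r} = roofs R C D" if "r \<in> roofs R C D" for r
  proof
    show "roof_equiv R C D `` {r} \<subseteq> roofs R C D" by (auto simp: roof_equiv_def)
    show "roofs R C D \<subseteq> roof_equiv R C D `` {r}"
    proof
      fix r' assume "r' \<in> roofs R C D"
      then show "r' \<in> roof_equiv R C D `` {r}" using that eq by (cases r, cases r') auto
    qed
  qed
  then show "Hom_vanishes R C D"
    using zero_roof[OF bc] unfolding Hom_vanishes_def Db_Hom_def Db_zero_def quotient_def by auto
qed

section \<open>Positive torsion pairs\<close>

lemma Db_interval_iff:
  "C \<in> Db_interval R a b \<longleftrightarrow>
    bounded_complex R C \<and> (\<forall>i. i < a \<or> b < i \<longrightarrow> cocycles C i \<subseteq> coboundaries C i)"
  using cplx.trivial_cohomology_iff[of R C]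
  by (auto simp: Db_interval_def Db_objects_def cplx_def not_le del: subsetI)

text \<open>The witness is \<open>trunc a (shift (- k) B)\<close>. It depends on \<open>B\<close>
  and \<open>k\<close> only, so one object tests against all \<open>Y\<close> at once.\<close>

lemma Hom_shift_left:
  assumes B: "B \<in> Db_interval R a b" and k: "k \<le> 0"
  shows "\<exists>B'\<in>Db_interval R a b. \<forall>Y\<in>Db_interval R a b.
    Hom_vanishes R B (shift k Y) \<longleftrightarrow> Hom_vanishes R B' Y"
proof
  have bc: "bounded_complex R B" using B by (simp add: Db_interval_iff)
  let ?B = "shift (- k) B"
  have sb: "bounded_complex R ?B" by (rule bounded_complex_shift[OF bc])
  have tb: "bounded_complex R (trunc a ?B)" by (rule cmap_bounded(2)[OF cmap_trunc_proj[OF sb]])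
  \<comment> \<open>As \<open>- k \<ge> 0\<close>, the shift moves cohomology down, so the upper
    bound \<open>b\<close> survives; only the lower bound has to be restored by truncation.\<close>
  have ex: "cocycles ?B i \<subseteq> coboundaries ?B i" if "b < i" for i
    using B k that by (simp add: cocycles_shift[OF bc] coboundaries_shift[OF bc] Db_interval_iff)
  then show "trunc a ?B \<in> Db_interval R a b"
    using tb trunc_exact[OF sb] trunc_exact'[OF sb ex] by (auto simp: Db_interval_iff del: subsetI)
  show "\<forall>Y\<in>Db_interval R a b. Hom_vanishes R B (shift k Y) \<longleftrightarrow> Hom_vanishes R (trunc a ?B) Y"
  proof
    fix Y assume Y: "Y \<in> Db_interval R a b"
    then have Yb: "bounded_complex R Y" and Ye: "\<And>i. i < a \<Longrightarrow> cocycles Y i \<subseteq> coboundaries Y i"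
      by (simp_all add: Db_interval_iff)
    have "hom_zero R (trunc a ?B) Y \<longleftrightarrow> hom_zero R ?B Y"
      by (rule hom_zero_trunc[OF sb Yb]) (rule Ye)
    then show "Hom_vanishes R B (shift k Y) \<longleftrightarrow> Hom_vanishes R (trunc a ?B) Y"
      by (simp add: Hom_vanishes_iff bc Yb tb bounded_complex_shift hom_zero_shift_adjoint)
  qed
qed

text \<open>Dual: shifting \<open>Y\<close> by \<open>k \<le> 0\<close> moves cohomology up, so the
  lower bound survives and what passes above \<open>b\<close> is cut off.\<close>

lemma Hom_shift_right:
  assumes Y: "Y \<in> Db_interval R a b" and k: "k \<le> 0"
  shows "\<exists>Y'\<in>Db_interval R a b. \<forall>B\<in>Db_interval R a b.
    Hom_vanishes R B (shift k Y) \<longleftrightarrow> Hom_vanishes R B Y'"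
proof
  have bc: "bounded_complex R Y" using Y by (simp add: Db_interval_iff)
  let ?Y = "shift k Y"
  have sb: "bounded_complex R ?Y" by (rule bounded_complex_shift[OF bc])
  \<comment> \<open>\<open>lower_trunc\<close> keeps the degrees strictly below its index, hence
    \<open>b + 1\<close>.\<close>
  have lb: "bounded_complex R (lower_trunc (b + 1) ?Y)" by (rule bounded_complex_lower_trunc[OF sb])
  have "cocycles ?Y i \<subseteq> coboundaries ?Y i" if "i < a" for i
    using Y k that by (simp add: cocycles_shift[OF bc] coboundaries_shift[OF bc] Db_interval_iff)
  then have "cocycles (lower_trunc (b + 1) ?Y) i \<subseteq> coboundaries (lower_trunc (b + 1) ?Y) i"
    if "i < a \<or> b < i" for i
    using that lower_trunc_exact_above[OF sb, of "b + 1" i] lower_trunc_exact_below[OF sb, of i "b + 1"]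
    by (cases "b < i") auto
  then show "lower_trunc (b + 1) ?Y \<in> Db_interval R a b"
    using lb by (simp add: Db_interval_iff)
  show "\<forall>B\<in>Db_interval R a b. Hom_vanishes R B (shift k Y) \<longleftrightarrow> Hom_vanishes R B (lower_trunc (b + 1) ?Y)"
  proof
    fix B assume B: "B \<in> Db_interval R a b"
    then have Bb: "bounded_complex R B" and Be: "\<And>i. i \<ge> b + 1 \<Longrightarrow> cocycles B i \<subseteq> coboundaries B i"
      by (simp_all add: Db_interval_iff)
    have "hom_zero R B (lower_trunc (b + 1) ?Y) \<longleftrightarrow> hom_zero R B ?Y"
      by (rule hom_zero_lower_trunc[OF sb]) (rule Be)
    then show "Hom_vanishes R B (shift k Y) \<longleftrightarrow> Hom_vanishes R B (lower_trunc (b + 1) ?Y)"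
      by (simp add: Hom_vanishes_iff Bb sb lb)
  qed
qed

section \<open>Meets and joins of torsion pairs, and positivity\<close>

context
  fixes R :: "('a, 'r) ring_scheme" and d :: nat
begin

private abbreviation (input) "\<C> \<equiv> Db_interval R (- int d + 2) 0"

lemma torsion_pairs_iff:
  "(T, F) \<in> torsion_pairs R d \<longleftrightarrow>
    T = {t \<in> \<C>. \<forall>f\<in>F. Hom_vanishes R t f} \<and> F = {f \<in> \<C>. \<forall>t\<in>T. Hom_vanishes R t f}"
  unfolding torsion_pairs_def by blast

lemma torsion_poset_simps:
  "carrier (torsion_poset R d) = torsion_pairs R d"
  "p \<sqsubseteq>\<^bsub>torsion_poset R d\<^esub> q \<longleftrightarrow> fst p \<subseteq> fst q"
  by (simp_all add: torsion_poset_def)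

lemma torsion_pairD:
  assumes "p \<in> torsion_pairs R d"
  shows "t \<in> fst p \<Longrightarrow> t \<in> \<C>" "f \<in> snd p \<Longrightarrow> f \<in> \<C>"
    "t \<in> fst p \<Longrightarrow> f \<in> snd p \<Longrightarrow> Hom_vanishes R t f"
    "t \<in> \<C> \<Longrightarrow> (\<And>f. f \<in> snd p \<Longrightarrow> Hom_vanishes R t f) \<Longrightarrow> t \<in> fst p"
    "f \<in> \<C> \<Longrightarrow> (\<And>t. t \<in> fst p \<Longrightarrow> Hom_vanishes R t f) \<Longrightarrow> f \<in> snd p"
proof -
  have eqs: "fst p = {t \<in> \<C>. \<forall>f\<in>snd p. Hom_vanishes R t f}"
    "snd p = {f \<in> \<C>. \<forall>t\<in>fst p. Hom_vanishes R t f}"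
    using assms torsion_pairs_iff[of "fst p" "snd p"] unfolding prod.collapse by blast+
  have T: "u \<in> fst p \<longleftrightarrow> u \<in> \<C> \<and> (\<forall>f\<in>snd p. Hom_vanishes R u f)" for u
    by (subst eqs(1)) (rule mem_Collect_eq)
  have F: "v \<in> snd p \<longleftrightarrow> v \<in> \<C> \<and> (\<forall>t\<in>fst p. Hom_vanishes R t v)" for v
    by (subst eqs(2)) (rule mem_Collect_eq)
  show "t \<in> fst p \<Longrightarrow> t \<in> \<C>" "t \<in> fst p \<Longrightarrow> f \<in> snd p \<Longrightarrow> Hom_vanishes R t f"
    "t \<in> \<C> \<Longrightarrow> (\<And>f. f \<in> snd p \<Longrightarrow> Hom_vanishes R t f) \<Longrightarrow> t \<in> fst p"
    using T[of t] by blast+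
  show "f \<in> snd p \<Longrightarrow> f \<in> \<C>"
    "f \<in> \<C> \<Longrightarrow> (\<And>t. t \<in> fst p \<Longrightarrow> Hom_vanishes R t f) \<Longrightarrow> f \<in> snd p"
    using F[of f] by blast+
qed

text \<open>The meet is known only through its universal property, so it is compared with an
  explicit lower bound: the intersection of the torsion classes with its right orthogonal. This is a
  torsion pair because the orthogonal contains both torsion-free classes.\<close>

lemma fst_meet_torsion:
  assumes p: "p \<in> torsion_pairs R d" and q: "q \<in> torsion_pairs R d"
  shows "fst (p \<sqinter>\<^bsub>torsion_poset R d\<^esub> q) = fst p \<inter> fst q"
proof
  interpret L: lattice "torsion_poset R d" by (rule lattice_torsion_poset)
  have pq: "p \<in> carrier (torsion_poset R d)" "q \<in> carrier (torsion_poset R d)"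
    using p q by (simp_all add: torsion_poset_simps)
  show "fst (p \<sqinter>\<^bsub>torsion_poset R d\<^esub> q) \<subseteq> fst p \<inter> fst q"
    using L.meet_left[OF pq] L.meet_right[OF pq] by (simp add: torsion_poset_simps)
  define T where "T = fst p \<inter> fst q"
  define F where "F = {f \<in> \<C>. \<forall>t\<in>T. Hom_vanishes R t f}"
  have "t \<in> T" if t: "t \<in> \<C>" "\<forall>f\<in>F. Hom_vanishes R t f" for t
  proof -
    have "f \<in> F" if "f \<in> snd p \<or> f \<in> snd q" for f
      using that torsion_pairD(2,3)[OF p] torsion_pairD(2,3)[OF q] by (auto simp: F_def T_def)
    then have "t \<in> fst p" "t \<in> fst q" using t by (auto intro: torsion_pairD(4)[OF p] torsion_pairD(4)[OF q])
    then show ?thesis by (simp add: T_def)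
  qed
  moreover have "t \<in> \<C>" if "t \<in> T" for t using that torsion_pairD(1)[OF p] by (simp add: T_def)
  ultimately have "T = {t \<in> \<C>. \<forall>f\<in>F. Hom_vanishes R t f}" by (auto simp: F_def)
  then have TF: "(T, F) \<in> torsion_pairs R d" using F_def torsion_pairs_iff by blast
  then have "(T, F) \<sqsubseteq>\<^bsub>torsion_poset R d\<^esub> p \<sqinter>\<^bsub>torsion_poset R d\<^esub> q"
    using pq by (intro L.meet_le) (auto simp: torsion_poset_simps T_def)
  then show "fst p \<inter> fst q \<subseteq> fst (p \<sqinter>\<^bsub>torsion_poset R d\<^esub> q)"
    by (simp add: torsion_poset_simps T_def)
qed

text \<open>The order speaks about torsion classes only, so inclusions of torsion-free classes are
  obtained by passing to orthogonals, which reverses them.\<close>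

lemma snd_join_torsion:
  assumes p: "p \<in> torsion_pairs R d" and q: "q \<in> torsion_pairs R d"
  shows "snd (p \<squnion>\<^bsub>torsion_poset R d\<^esub> q) = snd p \<inter> snd q"
proof
  interpret L: lattice "torsion_poset R d" by (rule lattice_torsion_poset)
  have pq: "p \<in> carrier (torsion_poset R d)" "q \<in> carrier (torsion_poset R d)"
    using p q by (simp_all add: torsion_poset_simps)
  let ?j = "p \<squnion>\<^bsub>torsion_poset R d\<^esub> q"
  have j: "?j \<in> torsion_pairs R d" using L.join_closed[OF pq] by (simp add: torsion_poset_simps)
  have "fst p \<subseteq> fst ?j" "fst q \<subseteq> fst ?j"
    using L.join_left[OF pq] L.join_right[OF pq] by (simp_all add: torsion_poset_simps)
  then show "snd ?j \<subseteq> snd p \<inter> snd q"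
    using torsion_pairD(2,3)[OF j] by (auto intro!: torsion_pairD(5)[OF p] torsion_pairD(5)[OF q])
  define F where "F = snd p \<inter> snd q"
  define T where "T = {t \<in> \<C>. \<forall>f\<in>F. Hom_vanishes R t f}"
  have pT: "fst p \<subseteq> T" "fst q \<subseteq> T"
    using torsion_pairD(1,3)[OF p] torsion_pairD(1,3)[OF q] by (auto simp: T_def F_def)
  have "f \<in> F" if f: "f \<in> \<C>" "\<forall>t\<in>T. Hom_vanishes R t f" for f
  proof -
    have "f \<in> snd p" "f \<in> snd q"
      by (rule torsion_pairD(5)[OF p f(1)], use f(2) pT in blast)
        (rule torsion_pairD(5)[OF q f(1)], use f(2) pT in blast)
    then show ?thesis by (simp add: F_def)
  qed
  moreover have "f \<in> \<C>" if "f \<in> F" for f using that torsion_pairD(2)[OF p] by (simp add: F_def)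
  ultimately have "F = {f \<in> \<C>. \<forall>t\<in>T. Hom_vanishes R t f}" by (auto simp: T_def)
  then have TF: "(T, F) \<in> torsion_pairs R d" using T_def torsion_pairs_iff by blast
  have "?j \<sqsubseteq>\<^bsub>torsion_poset R d\<^esub> (T, F)"
    using pq TF pT by (intro L.join_le) (auto simp: torsion_poset_simps)
  then have "fst ?j \<subseteq> T" by (simp add: torsion_poset_simps)
  then show "snd p \<inter> snd q \<subseteq> snd ?j"
    using torsion_pairD(2,3)[OF TF] unfolding F_def[symmetric] by (auto intro!: torsion_pairD(5)[OF j])
qed

lemma positive_torsion_pairs_iff:
  "p \<in> positive_torsion_pairs R d \<longleftrightarrow> p \<in> torsion_pairs R d \<and>
    (\<forall>k\<le>-1. \<forall>t\<in>fst p. \<forall>f\<in>snd p. Hom_vanishes R t (shift k f))"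
  by (auto simp: positive_torsion_pairs_def)

lemma meet_positive:
  assumes p: "p \<in> positive_torsion_pairs R d" and q: "q \<in> positive_torsion_pairs R d"
  shows "p \<sqinter>\<^bsub>torsion_poset R d\<^esub> q \<in> positive_torsion_pairs R d"
proof -
  let ?m = "p \<sqinter>\<^bsub>torsion_poset R d\<^esub> q"
  interpret L: lattice "torsion_poset R d" by (rule lattice_torsion_poset)
  have pq: "p \<in> torsion_pairs R d" "q \<in> torsion_pairs R d"
    using p q by (simp_all add: positive_torsion_pairs_iff)
  then have m: "?m \<in> torsion_pairs R d"
    using L.meet_closed[of p q] by (simp add: torsion_poset_simps)
  note m_eq = fst_meet_torsion[OF pq]
  have "Hom_vanishes R t (shift k f)" if k: "k \<le> -1" and t: "t \<in> fst ?m" and f: "f \<in> snd ?m" for k t f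
  proof -
    obtain t' where t': "t' \<in> \<C>"
      "\<And>Y. Y \<in> \<C> \<Longrightarrow> Hom_vanishes R t (shift k Y) \<longleftrightarrow> Hom_vanishes R t' Y"
      using Hom_shift_left[OF torsion_pairD(1)[OF m t], of k] k by auto
    \<comment> \<open>For a positive pair \<open>r\<close>, the object \<open>t'\<close>
      representing the shifted vanishing stays in the torsion class. Applied to \<open>p\<close> and
      \<open>q\<close>, this puts \<open>t'\<close> into the meet, where it can be tested against
      the given \<open>f\<close>.\<close>
    have "t' \<in> fst r" if r: "r \<in> positive_torsion_pairs R d" "t \<in> fst r" for r
    proof -
      have r': "r \<in> torsion_pairs R d" using r by (simp add: positive_torsion_pairs_iff)
      show ?thesis
      proof (rule torsion_pairD(4)[OF r' t'(1)])
        fix g assume g: "g \<in> snd r"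
        have "Hom_vanishes R t (shift k g)" using r g k by (simp add: positive_torsion_pairs_iff)
        then show "Hom_vanishes R t' g" using t'(2)[OF torsion_pairD(2)[OF r' g]] by simp
      qed
    qed
    then have "t' \<in> fst ?m" using p q t unfolding m_eq by blast
    then have "Hom_vanishes R t' f" by (rule torsion_pairD(3)[OF m _ f])
    then show ?thesis using t'(2)[OF torsion_pairD(2)[OF m f]] by simp
  qed
  then show ?thesis using m by (simp add: positive_torsion_pairs_iff)
qed

lemma join_positive:
  assumes p: "p \<in> positive_torsion_pairs R d" and q: "q \<in> positive_torsion_pairs R d"
  shows "p \<squnion>\<^bsub>torsion_poset R d\<^esub> q \<in> positive_torsion_pairs R d"
proof -
  let ?j = "p \<squnion>\<^bsub>torsion_poset R d\<^esub> q"
  interpret L: lattice "torsion_poset R d" by (rule lattice_torsion_poset)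
  have pq: "p \<in> torsion_pairs R d" "q \<in> torsion_pairs R d"
    using p q by (simp_all add: positive_torsion_pairs_iff)
  then have j: "?j \<in> torsion_pairs R d"
    using L.join_closed[of p q] by (simp add: torsion_poset_simps)
  note j_eq = snd_join_torsion[OF pq]
  have "Hom_vanishes R t (shift k f)" if k: "k \<le> -1" and t: "t \<in> fst ?j" and f: "f \<in> snd ?j" for k t f
  proof -
    obtain f' where f': "f' \<in> \<C>"
      "\<And>B. B \<in> \<C> \<Longrightarrow> Hom_vanishes R B (shift k f) \<longleftrightarrow> Hom_vanishes R B f'"
      using Hom_shift_right[OF torsion_pairD(2)[OF j f], of k] k by auto
    \<comment> \<open>The mirror image: the torsion-free class of a positive pair contains
      \<open>f'\<close>, and for the join it is torsion-free classes that intersect.\<close>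
    have "f' \<in> snd r" if r: "r \<in> positive_torsion_pairs R d" "f \<in> snd r" for r
    proof -
      have r': "r \<in> torsion_pairs R d" using r by (simp add: positive_torsion_pairs_iff)
      show ?thesis
      proof (rule torsion_pairD(5)[OF r' f'(1)])
        fix g assume g: "g \<in> fst r"
        have "Hom_vanishes R g (shift k f)" using r g k by (simp add: positive_torsion_pairs_iff)
        then show "Hom_vanishes R g f'" using f'(2)[OF torsion_pairD(1)[OF r' g]] by simp
      qed
    qed
    then have "f' \<in> snd ?j" using p q f unfolding j_eq by blast
    then have "Hom_vanishes R t f'" by (rule torsion_pairD(3)[OF j t])
    then show ?thesis using f'(2)[OF torsion_pairD(1)[OF j t]] by simp
  qed
  then show ?thesis using j by (simp add: positive_torsion_pairs_iff)
qed

lemma lattice_positive_torsion_poset: "lattice (positive_torsion_poset R d)"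
proof -
  let ?L = "torsion_poset R d" and ?P = "positive_torsion_poset R d"
  interpret L: lattice ?L by (rule lattice_torsion_poset)
  have simps: "carrier ?P = positive_torsion_pairs R d" "eq ?P = (=)" "le ?P = le ?L"
    by (simp_all add: positive_torsion_poset_def torsion_poset_def)
  have sub: "p \<in> carrier ?L" if "p \<in> positive_torsion_pairs R d" for p
    using that by (simp add: positive_torsion_pairs_iff torsion_poset_simps)
  have po: "partial_order ?P"
    by unfold_locales
      (unfold simps, (simp | blast intro: L.le_refl L.le_trans L.le_antisym sub)+)
  have "\<exists>s. least ?P s (Upper ?P {p, q})" if pq: "p \<in> carrier ?P" "q \<in> carrier ?P" for p q
  proof -
    have "p \<in> carrier ?L" "q \<in> carrier ?L" using pq sub by (simp_all add: simps)
    note L.join_left[OF this] L.join_right[OF this] L.join_le[OF _ _ this]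
    \<comment> \<open>The order is restricted, so an upper bound among positive pairs is an upper
      bound among all pairs; the join of \<open>?L\<close> lies below it and is itself
      positive.\<close>
    then have "least ?P (p \<squnion>\<^bsub>?L\<^esub> q) (Upper ?P {p, q})"
      using pq[unfolded simps] join_positive[of p q] sub unfolding least_def Upper_def simps by blast
    then show ?thesis by blast
  qed
  moreover have "\<exists>s. greatest ?P s (Lower ?P {p, q})" if pq: "p \<in> carrier ?P" "q \<in> carrier ?P" for p q
  proof -
    have "p \<in> carrier ?L" "q \<in> carrier ?L" using pq sub by (simp_all add: simps)
    note L.meet_left[OF this] L.meet_right[OF this] L.meet_le[OF _ _ this]
    then have "greatest ?P (p \<sqinter>\<^bsub>?L\<^esub> q) (Lower ?P {p, q})"
      using pq[unfolded simps] meet_positive[of p q] sub unfolding greatest_def Lower_def simps by blast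
    then show ?thesis by blast
  qed
  ultimately show ?thesis
    using po by (simp add: lattice_def upper_semilattice_def lower_semilattice_def
      upper_semilattice_axioms_def lower_semilattice_axioms_def)
qed

end

theorem theorem4p12:
  fixes K :: "('k, 'r) ring_scheme" and \<Lambda> :: "('k, 'a) module" and d :: nat
  assumes "algebraically_closed K"
    and "finite_dimensional_algebra K \<Lambda>"
    and "d \<ge> 2"
  shows "(\<forall>p \<in> positive_torsion_pairs \<Lambda> d. \<forall>q \<in> positive_torsion_pairs \<Lambda> d.
            p \<sqinter>\<^bsub>torsion_poset \<Lambda> d\<^esub> q \<in> positive_torsion_pairs \<Lambda> d \<and>
            p \<squnion>\<^bsub>torsion_poset \<Lambda> d\<^esub> q \<in> positive_torsion_pairs \<Lambda> d) \<and>
         lattice (positive_torsion_poset \<Lambda> d)"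
  using meet_positive join_positive lattice_positive_torsion_poset by blast

end
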